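(* Let $\mathcal D$ be a small $K$-linear category, $(C,\Delta_C,\varepsilon_C)$ a $K$-coalgebra and $(\mathcal D,C,\psi)$ a right-right entwining structure. Let $\mathscr F:\mathscr M(\psi)_{\mathcal D}^C\to \mathrm{Mod}\text{-}\mathcal D$ be the forgetful functor and $\mathscr G:\mathrm{Mod}\text{-}\mathcal D\to\mathscr M(\psi)_{\mathcal D}^C$, $\mathcal N\mapsto\mathcal N\otimes C$, its right adjoint. Then $(\mathscr F,\mathscr G)$ is a Frobenius pair if and only if there exist $\theta\in V_1$ and $\eta\in W_1$ such that $$\varepsilon_C(d)f=\sum\hat f\circ\theta_X(c_f\otimes d),\qquad \varepsilon_C(d)f=\sum\hat f_\psi\circ\theta_X(d^\psi\otimes c_f)$$ for all $X,Y\in Ob(\mathcal D)$, $f\in Hom_{\mathcal D}(X,Y)$ and $d\in C$, where $\eta(X,Y)(f)=\sum\hat f\otimes c_f$.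
   Context: $K$ is a field; Sweedler notation $\Delta_C(c)=c_1\otimes c_2$ and $\rho(m)=m_0\otimes m_1$ (summation omitted) is used. A right module over a small $K$-linear category $\mathcal D$ is a $K$-linear functor $\mathcal D^{op}\to \mathrm{Vect}_K$; $\mathrm{Mod}\text{-}\mathcal D$ is the category of these. A (right-right) entwining structure $(\mathcal D,C,\psi)$ consists of a small $K$-linear category $\mathcal D$, a $K$-coalgebra $C$ and $K$-linear maps $\psi_{XY}:C\otimes Hom_{\mathcal D}(X,Y)\to Hom_{\mathcal D}(X,Y)\otimes C$ for $X,Y\in Ob(\mathcal D)$, written $\psi_{XY}(c\otimes f)=f_\psi\otimes c^\psi$ (summation omitted; $\psi'$ denotes a second application of $\psi$), such that for $f\in Hom_{\mathcal D}(X,Y)$, $g\in Hom_{\mathcal D}(Y,Z)$, $c\in C$: $(gf)_\psi\otimes c^\psi=g_\psi f_{\psi'}\otimes (c^{\psi})^{\psi'}$; $\ \varepsilon_C(c^\psi)f_\psi=\varepsilon_C(c)f$; $\ f_\psi\otimes\Delta_C(c^\psi)=(f_\psi)_{\psi'}\otimes (c_1)^{\psi'}\otimes (c_2)^\psi$; $\ \psi_{XX}(c\otimes \mathrm{id}_X)=\mathrm{id}_X\otimes c$. An entwined module over $(\mathcal D,C,\psi)$ is a right $\mathcal D$-module $\mathcal M$ with a right $C$-comodule structure on each $\mathcal M(Y)$ such that $(\mathcal M(f)(m))_0\otimes(\mathcal M(f)(m))_1=\mathcal M(f_\psi)(m_0)\otimes (m_1)^\psi$ for $f\in Hom_{\mathcal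 D}(Y,X)$, $m\in\mathcal M(X)$. Morphisms are $\mathcal D$-module morphisms that are objectwise $C$-colinear; the category is $\mathscr M(\psi)_{\mathcal D}^C$. The forgetful functor $\mathscr F$ forgets the $C$-coactions. For $\mathcal N\in \mathrm{Mod}\text{-}\mathcal D$, $\mathscr G(\mathcal N)=\mathcal N\otimes C$ is given by $(\mathcal N\otimes C)(X)=\mathcal N(X)\otimes C$, $(\mathcal N\otimes C)(f)(n\otimes c)=\mathcal N(f_\psi)(n)\otimes c^\psi$, with coaction $n\otimes c\mapsto n\otimes c_1\otimes c_2$; $\mathscr G$ is right adjoint to $\mathscr F$. $V_1$ is the $K$-space of all collections $\theta=\{\theta_X:C\otimes C\to End_{\mathcal D}(X)\}_{X\in Ob(\mathcal D)}$ of $K$-linear maps such that, for all $c,d\in C$ and $f\in Hom_{\mathcal D}(Y,X)$, $\theta_X(c\otimes d)\circ f=(f_\psi)_{\psi'}\circ\theta_Y(c^{\psi'}\otimes d^{\psi})$ and $\theta_X(c\otimes d_1)\otimes d_2=(\theta_X(c_2\otimes d))_\psi\otimes (c_1)^\psi$. $W_1=\mathrm{Nat}(h,h\otimes C)$ is the $K$-space of natural transformations between the functors $h,\ h\otimes C:\mathcal D^{op}\otimes\mathcal D\to \mathrm{Vect}_K$ given by $h(X,Y)=Hom_{\mathcal D}(X,Y)$, $h(\phi)(f)=\phi''f\phi'$, and $(h\otimes C)(X,Y)=Hom_{\mathcal D}(X,Y)\otimes C$, $(h\otimes C)(\phi)(f\otimes c)=\phi''f\phi'_\psi\otimes c^\psi$,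 for $\phi=(\phi',\phi'')$ with $\phi':X'\to X$, $\phi'':Y\to Y'$ in $\mathcal D$. For a functor $F$ with right adjoint $G$, the pair $(F,G)$ is a Frobenius pair if $G$ is also a left adjoint of $F$. *)

theory Defs
  imports "HOL-Algebra.Free_Abelian_Groups" "HOL-Algebra.Module"
begin

section \<open>Categories, functors, adjunctions\<close>

text \<open>
  Arrows do not carry their domain and codomain, so composition and the arrow part of a functor
  receive the objects as arguments: \<open>Comp A X Y Z g f\<close> is \<open>g \<circ> f\<close> for \<open>f : X \<rightarrow> Y\<close> and
  \<open>g : Y \<rightarrow> Z\<close>.
\<close>

record ('o, 'a) category =
  Ob :: "'o set"
  Arr :: "'o \<Rightarrow> 'o \<Rightarrow> 'a set"
  Ident :: "'o \<Rightarrow> 'a"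
  Comp :: "'o \<Rightarrow> 'o \<Rightarrow> 'o \<Rightarrow> 'a \<Rightarrow> 'a \<Rightarrow> 'a"

locale category =
  fixes A :: "('o, 'a, 'e) category_scheme"
  assumes Ident_Arr: "X \<in> Ob A \<Longrightarrow> Ident A X \<in> Arr A X X"
    and Comp_Arr: "\<lbrakk>X \<in> Ob A; Y \<in> Ob A; Z \<in> Ob A; f \<in> Arr A X Y; g \<in> Arr A Y Z\<rbrakk>
        \<Longrightarrow> Comp A X Y Z g f \<in> Arr A X Z"
    and Comp_Ident_left: "\<lbrakk>X \<in> Ob A; Y \<in> Ob A; f \<in> Arr A X Y\<rbrakk> \<Longrightarrow> Comp A X Y Y (Ident A Y) f = f"
    and Comp_Ident_right: "\<lbrakk>X \<in> Ob A; Y \<in> Ob A; f \<in> Arr A X Y\<rbrakk> \<Longrightarrow> Comp A X X Y f (Ident A X) = f"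
    and Comp_assoc: "\<lbrakk>W \<in> Ob A; X \<in> Ob A; Y \<in> Ob A; Z \<in> Ob A;
          f \<in> Arr A W X; g \<in> Arr A X Y; h \<in> Arr A Y Z\<rbrakk>
        \<Longrightarrow> Comp A W Y Z h (Comp A W X Y g f) = Comp A W X Z (Comp A X Y Z h g) f"

record ('o, 'a, 'p, 'b) cat_functor =
  on_ob :: "'o \<Rightarrow> 'p"
  on_arr :: "'o \<Rightarrow> 'o \<Rightarrow> 'a \<Rightarrow> 'b"

locale cat_functor =
  source: category A + target: category B
  for A :: "('o, 'a, 'e) category_scheme" and B :: "('p, 'b, 'f) category_scheme"
    and F :: "('o, 'a, 'p, 'b) cat_functor" +
  assumes on_ob_Ob: "X \<in> Ob A \<Longrightarrow> on_ob F X \<in> Ob B"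
    and on_arr_Arr: "\<lbrakk>X \<in> Ob A; Y \<in> Ob A; f \<in> Arr A X Y\<rbrakk>
        \<Longrightarrow> on_arr F X Y f \<in> Arr B (on_ob F X) (on_ob F Y)"
    and on_arr_Ident: "X \<in> Ob A \<Longrightarrow> on_arr F X X (Ident A X) = Ident B (on_ob F X)"
    and on_arr_Comp: "\<lbrakk>X \<in> Ob A; Y \<in> Ob A; Z \<in> Ob A; f \<in> Arr A X Y; g \<in> Arr A Y Z\<rbrakk>
        \<Longrightarrow> on_arr F X Z (Comp A X Y Z g f) =
            Comp B (on_ob F X) (on_ob F Y) (on_ob F Z) (on_arr F Y Z g) (on_arr F X Y f)"

definition left_adjoint ::
  "('o, 'a, 'e) category_scheme \<Rightarrow> ('p, 'b, 'f) category_scheme \<Rightarrow>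
   ('o, 'a, 'p, 'b) cat_functor \<Rightarrow> ('p, 'b, 'o, 'a) cat_functor \<Rightarrow> bool" where
  "left_adjoint A B F G \<longleftrightarrow>
     cat_functor A B F \<and> cat_functor B A G \<and>
     (\<exists>\<Phi>. (\<forall>X\<in>Ob A. \<forall>Y\<in>Ob B. bij_betw (\<Phi> X Y) (Arr B (on_ob F X) Y) (Arr A X (on_ob G Y))) \<and>
          (\<forall>X\<in>Ob A. \<forall>X'\<in>Ob A. \<forall>Y\<in>Ob B. \<forall>Y'\<in>Ob B.
             \<forall>u\<in>Arr A X' X. \<forall>v\<in>Arr B Y Y'. \<forall>g\<in>Arr B (on_ob F X) Y.
               \<Phi> X' Y' (Comp B (on_ob F X') Y Y' v
                           (Comp B (on_ob F X') (on_ob F X) Y g (on_arr F X' X u))) =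
               Comp A X' (on_ob G Y) (on_ob G Y') (on_arr G Y Y' v)
                    (Comp A X' X (on_ob G Y) (\<Phi> X Y g) u)))"

definition frobenius_pair ::
  "('o, 'a, 'e) category_scheme \<Rightarrow> ('p, 'b, 'f) category_scheme \<Rightarrow>
   ('o, 'a, 'p, 'b) cat_functor \<Rightarrow> ('p, 'b, 'o, 'a) cat_functor \<Rightarrow> bool" where
  "frobenius_pair A B F G \<longleftrightarrow> left_adjoint A B F G \<and> left_adjoint B A G F"


section \<open>Tensor products of vector spaces\<close>

definition linear_maps ::
  "('k, 'r) ring_scheme \<Rightarrow> ('k, 'v, 'e) module_scheme \<Rightarrow> ('k, 'w, 'f) module_scheme \<Rightarrow> ('v \<Rightarrow> 'w) set"
  where
  "linear_maps K V W = {f \<in> carrier V \<rightarrow> carrier W.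
     (\<forall>x\<in>carrier V. \<forall>y\<in>carrier V. f (x \<oplus>\<^bsub>V\<^esub> y) = f x \<oplus>\<^bsub>W\<^esub> f y) \<and>
     (\<forall>a\<in>carrier K. \<forall>x\<in>carrier V. f (a \<odot>\<^bsub>V\<^esub> x) = a \<odot>\<^bsub>W\<^esub> f x)}"

type_synonym ('v, 'w) tensor = "('v \<times> 'w \<Rightarrow>\<^sub>0 int) set"

text \<open>
  \<open>V \<otimes> W\<close> is the free abelian group on \<open>V \<times> W\<close> modulo biadditivity and
  \<open>(a v, w) = (v, a w)\<close>; its elements are cosets.
\<close>

definition tensor_relators ::
  "('k, 'r) ring_scheme \<Rightarrow> ('k, 'v, 'e) module_scheme \<Rightarrow> ('k, 'w, 'f) module_scheme \<Rightarrow> ('v, 'w) tensor"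
  where
  "tensor_relators K V W =
     {frag_of (v \<oplus>\<^bsub>V\<^esub> v', w) - frag_of (v, w) - frag_of (v', w) | v v' w.
        v \<in> carrier V \<and> v' \<in> carrier V \<and> w \<in> carrier W} \<union>
     {frag_of (v, w \<oplus>\<^bsub>W\<^esub> w') - frag_of (v, w) - frag_of (v, w') | v w w'.
        v \<in> carrier V \<and> w \<in> carrier W \<and> w' \<in> carrier W} \<union>
     {frag_of (a \<odot>\<^bsub>V\<^esub> v, w) - frag_of (v, a \<odot>\<^bsub>W\<^esub> w) | a v w.
        a \<in> carrier K \<and> v \<in> carrier V \<and> w \<in> carrier W}"

definition tensor_null ::
  "('k, 'r) ring_scheme \<Rightarrow> ('k, 'v, 'e) module_scheme \<Rightarrow> ('k, 'w, 'f) module_scheme \<Rightarrow> ('v, 'w) tensor"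
  where
  "tensor_null K V W = generate (free_Abelian_group (carrier V \<times> carrier W)) (tensor_relators K V W)"

definition pure ::
  "('k, 'r) ring_scheme \<Rightarrow> ('k, 'v, 'e) module_scheme \<Rightarrow> ('k, 'w, 'f) module_scheme \<Rightarrow>
   'v \<Rightarrow> 'w \<Rightarrow> ('v, 'w) tensor" where
  "pure K V W v w =
     tensor_null K V W #>\<^bsub>free_Abelian_group (carrier V \<times> carrier W)\<^esub> frag_of (v, w)"

text \<open>The multiplicative fields of the record are not used by \<^locale>\<open>module\<close>.\<close>

definition tensor ::
  "('k, 'r) ring_scheme \<Rightarrow> ('k, 'v, 'e) module_scheme \<Rightarrow> ('k, 'w, 'f) module_scheme \<Rightarrow>
   ('k, ('v, 'w) tensor) module" where
  "tensor K V W =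
     (let G = free_Abelian_group (carrier V \<times> carrier W); N = tensor_null K V W in
      \<lparr>carrier = carrier (G Mod N), mult = undefined, one = undefined,
       zero = one (G Mod N), add = mult (G Mod N),
       smult = \<lambda>a t. the_elem
         ((\<lambda>x. N #>\<^bsub>G\<^esub> frag_extend (\<lambda>(v, w). frag_of (a \<odot>\<^bsub>V\<^esub> v, w)) x) ` t)\<rparr>)"

text \<open>
  Sweedler notation: if \<open>t = \<Sum> a \<otimes> b\<close>, then \<open>tsum T t E\<close> is \<open>\<Sum> E a b\<close>, computed in \<open>T\<close>.
  For bilinear \<open>E\<close> the value does not depend on the representative \<open>x\<close> of the coset \<open>t\<close>
  (this is the linear map out of the tensor product that \<open>E\<close> induces), so the image below is
  a singleton.
\<close>

definition tsum ::
  "('k, 't, 'e) module_scheme \<Rightarrow> ('v, 'w) tensor \<Rightarrow> ('v \<Rightarrow> 'w \<Rightarrow> 't) \<Rightarrow> 't" where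
  "tsum T t E = the_elem
     ((\<lambda>x. \<Oplus>\<^bsub>T\<^esub> p \<in> Poly_Mapping.keys x.
           add_pow T (Poly_Mapping.lookup x p) (E (fst p) (snd p))) ` t)"


section \<open>Coalgebras and comodules\<close>

record ('k, 'c) coalgebra = "('k, 'c) module" +
  comult :: "'c \<Rightarrow> ('c, 'c) tensor"
  counit :: "'c \<Rightarrow> 'k"

locale coalgebra =
  field K + module K C
  for K :: "('k, 'r) ring_scheme" and C :: "('k, 'c, 'e) coalgebra_scheme" +
  assumes comult_linear: "comult C \<in> linear_maps K C (tensor K C C)"
    and counit_closed: "counit C \<in> carrier C \<rightarrow> carrier K"
    and counit_add: "\<lbrakk>c \<in> carrier C; d \<in> carrier C\<rbrakk>
        \<Longrightarrow> counit C (c \<oplus>\<^bsub>C\<^esub> d) = counit C c \<oplus>\<^bsub>K\<^esub> counit C d"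
    and counit_smult: "\<lbrakk>a \<in> carrier K; c \<in> carrier C\<rbrakk>
        \<Longrightarrow> counit C (a \<odot>\<^bsub>C\<^esub> c) = a \<otimes>\<^bsub>K\<^esub> counit C c"
    and coassoc: "c \<in> carrier C \<Longrightarrow>
        tsum (tensor K C (tensor K C C)) (comult C c) (\<lambda>c1 c2.
          tsum (tensor K C (tensor K C C)) (comult C c1) (\<lambda>c11 c12.
            pure K C (tensor K C C) c11 (pure K C C c12 c2))) =
        tsum (tensor K C (tensor K C C)) (comult C c) (\<lambda>c1 c2.
          tsum (tensor K C (tensor K C C)) (comult C c2) (\<lambda>c21 c22.
            pure K C (tensor K C C) c1 (pure K C C c21 c22)))"
    and counit_left: "c \<in> carrier C \<Longrightarrow> tsum C (comult C c) (\<lambda>c1 c2. counit C c1 \<odot>\<^bsub>C\<^esub> c2) = c"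
    and counit_right: "c \<in> carrier C \<Longrightarrow> tsum C (comult C c) (\<lambda>c1 c2. counit C c2 \<odot>\<^bsub>C\<^esub> c1) = c"

locale comodule =
  coalgebra K C + V: module K V
  for K :: "('k, 'r) ring_scheme" and C :: "('k, 'c, 'e) coalgebra_scheme"
    and V :: "('k, 'v, 'f) module_scheme" and \<rho> :: "'v \<Rightarrow> ('v, 'c) tensor" +
  assumes coaction_linear: "\<rho> \<in> linear_maps K V (tensor K V C)"
    and coaction_coassoc: "m \<in> carrier V \<Longrightarrow>
        tsum (tensor K V (tensor K C C)) (\<rho> m) (\<lambda>m0 m1.
          tsum (tensor K V (tensor K C C)) (\<rho> m0) (\<lambda>m00 m01.
            pure K V (tensor K C C) m00 (pure K C C m01 m1))) =
        tsum (tensor K V (tensor K C C)) (\<rho> m) (\<lambda>m0 m1.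
          tsum (tensor K V (tensor K C C)) (comult C m1) (\<lambda>c1 c2.
            pure K V (tensor K C C) m0 (pure K C C c1 c2)))"
    and coaction_counit: "m \<in> carrier V \<Longrightarrow> tsum V (\<rho> m) (\<lambda>m0 m1. counit C m1 \<odot>\<^bsub>V\<^esub> m0) = m"


section \<open>Linear categories and entwining structures\<close>

record ('k, 'o, 'm) linear_category = "('o, 'm) category" +
  Hom :: "'o \<Rightarrow> 'o \<Rightarrow> ('k, 'm) module"

locale linear_category =
  field K + category D
  for K :: "('k, 'r) ring_scheme" and D :: "('k, 'o, 'm, 'e) linear_category_scheme" +
  assumes Hom_module: "\<lbrakk>X \<in> Ob D; Y \<in> Ob D\<rbrakk> \<Longrightarrow> module K (Hom D X Y)"
    and carrier_Hom: "\<lbrakk>X \<in> Ob D; Y \<in> Ob D\<rbrakk> \<Longrightarrow> carrier (Hom D X Y) = Arr D X Y"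
    and Comp_linear_left: "\<lbrakk>X \<in> Ob D; Y \<in> Ob D; Z \<in> Ob D; f \<in> Arr D X Y\<rbrakk>
        \<Longrightarrow> (\<lambda>g. Comp D X Y Z g f) \<in> linear_maps K (Hom D Y Z) (Hom D X Z)"
    and Comp_linear_right: "\<lbrakk>X \<in> Ob D; Y \<in> Ob D; Z \<in> Ob D; g \<in> Arr D Y Z\<rbrakk>
        \<Longrightarrow> (\<lambda>f. Comp D X Y Z g f) \<in> linear_maps K (Hom D X Y) (Hom D X Z)"

type_synonym ('o, 'm, 'c) entwining = "'o \<Rightarrow> 'o \<Rightarrow> ('c, 'm) tensor \<Rightarrow> ('m, 'c) tensor"

locale entwining_structure =
  linear_category K D + coalgebra K C
  for K :: "('k, 'r) ring_scheme" and D :: "('k, 'o, 'm, 'd) linear_category_scheme"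
    and C :: "('k, 'c, 'e) coalgebra_scheme" and \<psi> :: "('o, 'm, 'c) entwining" +
  assumes \<psi>_linear: "\<lbrakk>X \<in> Ob D; Y \<in> Ob D\<rbrakk>
        \<Longrightarrow> \<psi> X Y \<in> linear_maps K (tensor K C (Hom D X Y)) (tensor K (Hom D X Y) C)"
    and \<psi>_Comp: "\<lbrakk>X \<in> Ob D; Y \<in> Ob D; Z \<in> Ob D; f \<in> Arr D X Y; g \<in> Arr D Y Z; c \<in> carrier C\<rbrakk> \<Longrightarrow>
        \<psi> X Z (pure K C (Hom D X Z) c (Comp D X Y Z g f)) =
        tsum (tensor K (Hom D X Z) C) (\<psi> Y Z (pure K C (Hom D Y Z) c g)) (\<lambda>g' c'.
          tsum (tensor K (Hom D X Z) C) (\<psi> X Y (pure K C (Hom D X Y) c' f)) (\<lambda>f' c''.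
            pure K (Hom D X Z) C (Comp D X Y Z g' f') c''))"
    and \<psi>_counit: "\<lbrakk>X \<in> Ob D; Y \<in> Ob D; f \<in> Arr D X Y; c \<in> carrier C\<rbrakk> \<Longrightarrow>
        tsum (Hom D X Y) (\<psi> X Y (pure K C (Hom D X Y) c f)) (\<lambda>f' c'.
          counit C c' \<odot>\<^bsub>Hom D X Y\<^esub> f') =
        counit C c \<odot>\<^bsub>Hom D X Y\<^esub> f"
    and \<psi>_comult: "\<lbrakk>X \<in> Ob D; Y \<in> Ob D; f \<in> Arr D X Y; c \<in> carrier C\<rbrakk> \<Longrightarrow>
        tsum (tensor K (Hom D X Y) (tensor K C C)) (\<psi> X Y (pure K C (Hom D X Y) c f)) (\<lambda>f' c'.
          tsum (tensor K (Hom D X Y) (tensor K C C)) (comult C c') (\<lambda>c1 c2.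
            pure K (Hom D X Y) (tensor K C C) f' (pure K C C c1 c2))) =
        tsum (tensor K (Hom D X Y) (tensor K C C)) (comult C c) (\<lambda>c1 c2.
          tsum (tensor K (Hom D X Y) (tensor K C C)) (\<psi> X Y (pure K C (Hom D X Y) c2 f)) (\<lambda>f' c2'.
            tsum (tensor K (Hom D X Y) (tensor K C C)) (\<psi> X Y (pure K C (Hom D X Y) c1 f')) (\<lambda>f'' c1'.
              pure K (Hom D X Y) (tensor K C C) f'' (pure K C C c1' c2'))))"
    and \<psi>_Ident: "\<lbrakk>X \<in> Ob D; c \<in> carrier C\<rbrakk> \<Longrightarrow>
        \<psi> X X (pure K C (Hom D X X) c (Ident D X)) = pure K (Hom D X X) C (Ident D X) c"


section \<open>The category of right modules over a linear category\<close>

text \<open>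
  The objects of \<open>Vect\<^sub>K\<close> are the \<open>K\<close>-vector spaces whose carrier is a subset of a
  type \<open>'u\<close>, which plays the role of the universe of small sets.
  For \<open>f : Y \<rightarrow> X\<close>, \<open>act M Y X f\<close> is the map \<open>M(f) : M(X) \<rightarrow> M(Y)\<close>.
\<close>

record ('k, 'o, 'm, 'u) right_module =
  at_ob :: "'o \<Rightarrow> ('k, 'u) module"
  act :: "'o \<Rightarrow> 'o \<Rightarrow> 'm \<Rightarrow> 'u \<Rightarrow> 'u"

locale right_module =
  linear_category K D
  for K :: "('k, 'r) ring_scheme" and D :: "('k, 'o, 'm, 'd) linear_category_scheme"
    and M :: "('k, 'o, 'm, 'u, 'e) right_module_scheme" +
  assumes at_ob_module: "X \<in> Ob D \<Longrightarrow> module K (at_ob M X)"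
    and act_linear: "\<lbrakk>X \<in> Ob D; Y \<in> Ob D; f \<in> Arr D Y X\<rbrakk>
        \<Longrightarrow> act M Y X f \<in> linear_maps K (at_ob M X) (at_ob M Y)"
    and act_linear_Hom: "\<lbrakk>X \<in> Ob D; Y \<in> Ob D; m \<in> carrier (at_ob M X)\<rbrakk>
        \<Longrightarrow> (\<lambda>f. act M Y X f m) \<in> linear_maps K (Hom D Y X) (at_ob M Y)"
    and act_Ident: "\<lbrakk>X \<in> Ob D; m \<in> carrier (at_ob M X)\<rbrakk> \<Longrightarrow> act M X X (Ident D X) m = m"
    and act_Comp: "\<lbrakk>X \<in> Ob D; Y \<in> Ob D; Z \<in> Ob D; f \<in> Arr D X Y; g \<in> Arr D Y Z;
          m \<in> carrier (at_ob M Z)\<rbrakk>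
        \<Longrightarrow> act M X Z (Comp D X Y Z g f) m = act M X Y f (act M Y Z g m)"

text \<open>
  Families of maps are extensional (undefined off the objects and off the carriers), so that
  equality of arrows is equality of natural transformations.
\<close>

definition module_morphisms ::
  "('k, 'r) ring_scheme \<Rightarrow> ('k, 'o, 'm, 'd) linear_category_scheme \<Rightarrow>
   ('k, 'o, 'm, 'u, 'e) right_module_scheme \<Rightarrow> ('k, 'o, 'm, 'u, 'f) right_module_scheme \<Rightarrow>
   ('o \<Rightarrow> 'u \<Rightarrow> 'u) set" where
  "module_morphisms K D M N =
     {\<alpha> \<in> (\<Pi>\<^sub>E X\<in>Ob D. linear_maps K (at_ob M X) (at_ob N X) \<inter> extensional (carrier (at_ob M X))).
        \<forall>X\<in>Ob D. \<forall>Y\<in>Ob D. \<forall>f\<in>Arr D Y X. \<forall>m\<in>carrier (at_ob M X).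
          \<alpha> Y (act M Y X f m) = act N Y X f (\<alpha> X m)}"

definition identity_morphism ::
  "('k, 'o, 'm, 'd) linear_category_scheme \<Rightarrow> ('k, 'o, 'm, 'u, 'e) right_module_scheme \<Rightarrow>
   'o \<Rightarrow> 'u \<Rightarrow> 'u" where
  "identity_morphism D M = (\<lambda>X\<in>Ob D. \<lambda>m\<in>carrier (at_ob M X). m)"

definition compose_morphisms ::
  "('k, 'o, 'm, 'd) linear_category_scheme \<Rightarrow> ('k, 'o, 'm, 'u, 'e) right_module_scheme \<Rightarrow>
   ('o \<Rightarrow> 'u \<Rightarrow> 'u) \<Rightarrow> ('o \<Rightarrow> 'u \<Rightarrow> 'u) \<Rightarrow> 'o \<Rightarrow> 'u \<Rightarrow> 'u" where
  "compose_morphisms D M \<beta> \<alpha> = (\<lambda>X\<in>Ob D. compose (carrier (at_ob M X)) (\<beta> X) (\<alpha> X))"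

definition module_category ::
  "('k, 'r) ring_scheme \<Rightarrow> ('k, 'o, 'm, 'd) linear_category_scheme \<Rightarrow>
   (('k, 'o, 'm, 'u) right_module, 'o \<Rightarrow> 'u \<Rightarrow> 'u) category" where
  "module_category K D =
     \<lparr>Ob = {M. right_module K D M},
      Arr = module_morphisms K D,
      Ident = identity_morphism D,
      Comp = \<lambda>M N P. compose_morphisms D M\<rparr>"


section \<open>The category of entwined modules\<close>

record ('k, 'o, 'm, 'u, 'c) entwined_module = "('k, 'o, 'm, 'u) right_module" +
  coact :: "'o \<Rightarrow> 'u \<Rightarrow> ('u, 'c) tensor"

locale entwined_module =
  entwining_structure K D C \<psi> + right_module K D M
  for K :: "('k, 'r) ring_scheme" and D :: "('k, 'o, 'm, 'd) linear_category_scheme"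
    and C :: "('k, 'c, 'e) coalgebra_scheme" and \<psi> :: "('o, 'm, 'c) entwining"
    and M :: "('k, 'o, 'm, 'u, 'c, 'f) entwined_module_scheme" +
  assumes coact_comodule: "X \<in> Ob D \<Longrightarrow> comodule K C (at_ob M X) (coact M X)"
    and coact_act: "\<lbrakk>X \<in> Ob D; Y \<in> Ob D; f \<in> Arr D Y X; m \<in> carrier (at_ob M X)\<rbrakk> \<Longrightarrow>
        coact M Y (act M Y X f m) =
        tsum (tensor K (at_ob M Y) C) (coact M X m) (\<lambda>m0 m1.
          tsum (tensor K (at_ob M Y) C) (\<psi> Y X (pure K C (Hom D Y X) m1 f)) (\<lambda>f' c'.
            pure K (at_ob M Y) C (act M Y X f' m0) c'))"

definition entwined_morphisms ::
  "('k, 'r) ring_scheme \<Rightarrow> ('k, 'o, 'm, 'd) linear_category_scheme \<Rightarrow>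
   ('k, 'c, 'e) coalgebra_scheme \<Rightarrow>
   ('k, 'o, 'm, 'u, 'c) entwined_module \<Rightarrow> ('k, 'o, 'm, 'u, 'c) entwined_module \<Rightarrow>
   ('o \<Rightarrow> 'u \<Rightarrow> 'u) set" where
  "entwined_morphisms K D C M N =
     {\<alpha> \<in> module_morphisms K D M N.
        \<forall>X\<in>Ob D. \<forall>m\<in>carrier (at_ob M X).
          coact N X (\<alpha> X m) =
          tsum (tensor K (at_ob N X) C) (coact M X m) (\<lambda>m0 m1. pure K (at_ob N X) C (\<alpha> X m0) m1)}"

definition entwined_category ::
  "('k, 'r) ring_scheme \<Rightarrow> ('k, 'o, 'm, 'd) linear_category_scheme \<Rightarrow>
   ('k, 'c, 'e) coalgebra_scheme \<Rightarrow> ('o, 'm, 'c) entwining \<Rightarrow>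
   (('k, 'o, 'm, 'u, 'c) entwined_module, 'o \<Rightarrow> 'u \<Rightarrow> 'u) category" where
  "entwined_category K D C \<psi> =
     \<lparr>Ob = {M. entwined_module K D C \<psi> M},
      Arr = entwined_morphisms K D C,
      Ident = identity_morphism D,
      Comp = \<lambda>M N P. compose_morphisms D M\<rparr>"


section \<open>The forgetful functor and its right adjoint\<close>

definition forgetful ::
  "(('k, 'o, 'm, 'u, 'c) entwined_module, 'o \<Rightarrow> 'u \<Rightarrow> 'u,
    ('k, 'o, 'm, 'u) right_module, 'o \<Rightarrow> 'u \<Rightarrow> 'u) cat_functor" where
  "forgetful = \<lparr>on_ob = right_module.truncate, on_arr = \<lambda>M N \<alpha>. \<alpha>\<rparr>"

text \<open>
  The elements of \<open>N(X) \<otimes> C\<close> are cosets, not elements of \<open>'u\<close>, so the space is moved into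
  \<open>'u\<close> along an injection \<open>encode\<close>, with inverse \<open>decode\<close>.  An injection exists if \<open>'u\<close>
  is infinite and there is an injection from the carrier of \<open>C\<close> into \<open>'u\<close>.
\<close>

definition encode :: "('k, 'a) module \<Rightarrow> 'a \<Rightarrow> 'u" where
  "encode T = (SOME i. inj_on i (carrier T))"

definition decode :: "('k, 'a) module \<Rightarrow> 'u \<Rightarrow> 'a" where
  "decode T = inv_into (carrier T) (encode T)"

definition transport :: "('k, 'a) module \<Rightarrow> ('k, 'u) module" where
  "transport T =
     \<lparr>carrier = encode T ` carrier T, mult = undefined, one = undefined,
      zero = encode T \<zero>\<^bsub>T\<^esub>,
      add = \<lambda>x y. encode T (decode T x \<oplus>\<^bsub>T\<^esub> decode T y),
      smult = \<lambda>a x. encode T (a \<odot>\<^bsub>T\<^esub> decode T x)\<rparr>"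

definition tensor_coalgebra_ob ::
  "('k, 'r) ring_scheme \<Rightarrow> ('k, 'o, 'm, 'd) linear_category_scheme \<Rightarrow>
   ('k, 'c, 'e) coalgebra_scheme \<Rightarrow> ('o, 'm, 'c) entwining \<Rightarrow>
   ('k, 'o, 'm, 'u) right_module \<Rightarrow> ('k, 'o, 'm, 'u, 'c) entwined_module" where
  "tensor_coalgebra_ob K D C \<psi> N =
     (let T = \<lambda>X. tensor K (at_ob N X) C in
      \<lparr>at_ob = \<lambda>X. transport (T X),
       act = \<lambda>Y X f t. encode (T Y)
         (tsum (T Y) (decode (T X) t) (\<lambda>n c.
            tsum (T Y) (\<psi> Y X (pure K C (Hom D Y X) c f)) (\<lambda>f' c'.
              pure K (at_ob N Y) C (act N Y X f' n) c'))),
       coact = \<lambda>X t.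
         tsum (tensor K (transport (T X)) C) (decode (T X) t) (\<lambda>n c.
           tsum (tensor K (transport (T X)) C) (comult C c) (\<lambda>c1 c2.
             pure K (transport (T X)) C (encode (T X) (pure K (at_ob N X) C n c1)) c2))\<rparr>)"

definition tensor_coalgebra ::
  "('k, 'r) ring_scheme \<Rightarrow> ('k, 'o, 'm, 'd) linear_category_scheme \<Rightarrow>
   ('k, 'c, 'e) coalgebra_scheme \<Rightarrow> ('o, 'm, 'c) entwining \<Rightarrow>
   (('k, 'o, 'm, 'u) right_module, 'o \<Rightarrow> 'u \<Rightarrow> 'u,
    ('k, 'o, 'm, 'u, 'c) entwined_module, 'o \<Rightarrow> 'u \<Rightarrow> 'u) cat_functor" where
  "tensor_coalgebra K D C \<psi> =
     \<lparr>on_ob = tensor_coalgebra_ob K D C \<psi>,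
      on_arr = \<lambda>N P \<alpha>. \<lambda>X\<in>Ob D. \<lambda>t\<in>carrier (transport (tensor K (at_ob N X) C)).
        encode (tensor K (at_ob P X) C)
          (tsum (tensor K (at_ob P X) C) (decode (tensor K (at_ob N X) C) t) (\<lambda>n c.
             pure K (at_ob P X) C (\<alpha> X n) c))\<rparr>"


section \<open>The spaces \<open>V\<^sub>1\<close> and \<open>W\<^sub>1\<close>\<close>

definition V1 ::
  "('k, 'r) ring_scheme \<Rightarrow> ('k, 'o, 'm, 'd) linear_category_scheme \<Rightarrow>
   ('k, 'c, 'e) coalgebra_scheme \<Rightarrow> ('o, 'm, 'c) entwining \<Rightarrow>
   ('o \<Rightarrow> ('c, 'c) tensor \<Rightarrow> 'm) set" where
  "V1 K D C \<psi> = {\<theta>.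
     (\<forall>X\<in>Ob D. \<theta> X \<in> linear_maps K (tensor K C C) (Hom D X X)) \<and>
     (\<forall>X\<in>Ob D. \<forall>Y\<in>Ob D. \<forall>f\<in>Arr D Y X. \<forall>c\<in>carrier C. \<forall>d\<in>carrier C.
        Comp D Y X X (\<theta> X (pure K C C c d)) f =
        tsum (Hom D Y X) (\<psi> Y X (pure K C (Hom D Y X) d f)) (\<lambda>f' d'.
          tsum (Hom D Y X) (\<psi> Y X (pure K C (Hom D Y X) c f')) (\<lambda>f'' c'.
            Comp D Y Y X f'' (\<theta> Y (pure K C C c' d'))))) \<and>
     (\<forall>X\<in>Ob D. \<forall>c\<in>carrier C. \<forall>d\<in>carrier C.
        tsum (tensor K (Hom D X X) C) (comult C d) (\<lambda>d1 d2.
          pure K (Hom D X X) C (\<theta> X (pure K C C c d1)) d2) =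
        tsum (tensor K (Hom D X X) C) (comult C c) (\<lambda>c1 c2.
          \<psi> X X (pure K C (Hom D X X) c1 (\<theta> X (pure K C C c2 d)))))}"

text \<open>
  An arrow \<open>(X, Y) \<rightarrow> (X', Y')\<close> of \<open>D\<^sup>o\<^sup>p \<otimes> D\<close> is an element of \<open>Hom(X', X) \<otimes> Hom(Y, Y')\<close>.
\<close>

definition h_map ::
  "('k, 'o, 'm, 'd) linear_category_scheme \<Rightarrow> 'o \<Rightarrow> 'o \<Rightarrow> 'o \<Rightarrow> 'o \<Rightarrow>
   ('m, 'm) tensor \<Rightarrow> 'm \<Rightarrow> 'm" where
  "h_map D X Y X' Y' \<phi> f =
     tsum (Hom D X' Y') \<phi> (\<lambda>\<phi>' \<phi>''. Comp D X' Y Y' \<phi>'' (Comp D X' X Y f \<phi>'))"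

definition hC_map ::
  "('k, 'r) ring_scheme \<Rightarrow> ('k, 'o, 'm, 'd) linear_category_scheme \<Rightarrow>
   ('k, 'c, 'e) coalgebra_scheme \<Rightarrow> ('o, 'm, 'c) entwining \<Rightarrow> 'o \<Rightarrow> 'o \<Rightarrow> 'o \<Rightarrow> 'o \<Rightarrow>
   ('m, 'm) tensor \<Rightarrow> ('m, 'c) tensor \<Rightarrow> ('m, 'c) tensor" where
  "hC_map K D C \<psi> X Y X' Y' \<phi> t =
     tsum (tensor K (Hom D X' Y') C) \<phi> (\<lambda>\<phi>' \<phi>''.
       tsum (tensor K (Hom D X' Y') C) t (\<lambda>f c.
         tsum (tensor K (Hom D X' Y') C) (\<psi> X' X (pure K C (Hom D X' X) c \<phi>')) (\<lambda>p c'.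
           pure K (Hom D X' Y') C (Comp D X' Y Y' \<phi>'' (Comp D X' X Y f p)) c')))"

definition W1 ::
  "('k, 'r) ring_scheme \<Rightarrow> ('k, 'o, 'm, 'd) linear_category_scheme \<Rightarrow>
   ('k, 'c, 'e) coalgebra_scheme \<Rightarrow> ('o, 'm, 'c) entwining \<Rightarrow>
   ('o \<Rightarrow> 'o \<Rightarrow> 'm \<Rightarrow> ('m, 'c) tensor) set" where
  "W1 K D C \<psi> = {\<eta>.
     (\<forall>X\<in>Ob D. \<forall>Y\<in>Ob D. \<eta> X Y \<in> linear_maps K (Hom D X Y) (tensor K (Hom D X Y) C)) \<and>
     (\<forall>X\<in>Ob D. \<forall>Y\<in>Ob D. \<forall>X'\<in>Ob D. \<forall>Y'\<in>Ob D.
        \<forall>\<phi>\<in>carrier (tensor K (Hom D X' X) (Hom D Y Y')). \<forall>f\<in>Arr D X Y.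
          \<eta> X' Y' (h_map D X Y X' Y' \<phi> f) = hC_map K D C \<psi> X Y X' Y' \<phi> (\<eta> X Y f))}"

end

theory Submission
  imports Defs
begin

text \<open>
  Let \<open>\<F>\<close> be the forgetful functor and \<open>\<G> = - \<otimes> C\<close>.  The adjunction with \<open>\<F>\<close> on the left always exists:
  its unit is the coaction \<open>M \<rightarrow> \<G>\<F>M\<close> and its counit is \<open>id \<otimes> \<epsilon>\<close> (\<open>forgetful_left_adjoint\<close>).  An
  adjunction with \<open>\<G>\<close> on the left amounts to natural transformations \<open>\<omega> : 1 \<Rightarrow> \<F>\<G>\<close> and
  \<open>\<upsilon> : \<G>\<F> \<Rightarrow> 1\<close> with the two triangle identities.  The theorem holds because \<open>\<omega>\<close> is the same thing
  as an element \<open>\<eta>\<close> of \<open>W\<^sub>1\<close>, \<open>\<upsilon>\<close> is the same thing as an element \<open>\<theta>\<close> of \<open>V\<^sub>1\<close>, and the triangle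
  identities are then the two equations.

  Both translations come from the Yoneda lemma.  An element \<open>n\<close> of \<open>N(X)\<close> is the image of \<open>id\<^sub>X\<close> under a
  morphism from the representable module \<open>h\<^sub>X\<close>, so \<open>\<omega>\<close> is determined by its values at the identities:
  \<open>\<omega>\<^sub>N(n) = \<Sum> N(e)(n) \<otimes> c\<close>, where \<open>\<eta>(X, X)(id\<^sub>X) = \<Sum> e \<otimes> c\<close> (\<open>\<omega>_value\<close>).  For \<open>\<upsilon>\<close> there is one step
  more.  An entwined module \<open>M\<close> embeds into \<open>\<G>\<F>M\<close> by its coaction, and \<open>id \<otimes> \<epsilon>\<close> is a left inverse.
  Naturality along the coaction thus determines \<open>\<upsilon>\<^sub>M\<close> from \<open>\<upsilon>\<close> at the cofree module \<open>\<G>\<F>M\<close>, and naturality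
  along the images of Yoneda morphisms under \<open>\<G>\<close> reduces that to the values of \<open>\<upsilon>\<close> at
  \<open>\<G>(h\<^sub>X)\<close> on \<open>id\<^sub>X \<otimes> c \<otimes> d\<close>.  If \<open>\<theta>\<^sub>X(c \<otimes> d)\<close> is the image of such a value under \<open>id \<otimes> \<epsilon>\<close>, the result is
  \<open>\<upsilon>\<^sub>M(m \<otimes> d) = M(\<theta>\<^sub>X(m\<^sub>1 \<otimes> d))(m\<^sub>0)\<close> (\<open>\<upsilon>_value\<close>).  At \<open>\<G>(h\<^sub>X)\<close>, \<open>D\<close>-linearity and colinearity of \<open>\<upsilon>\<close> become the
  two conditions that define \<open>V\<^sub>1\<close> (\<open>\<theta>_V1\<close>); naturality and \<open>D\<close>-linearity of \<open>\<omega>\<close> become naturality of \<open>\<eta>\<close>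
  in its two arguments (\<open>\<eta>_W1\<close>).  The triangle for \<open>\<G>(h\<^sub>Y)\<close> gives the first equation (\<open>\<eta>_\<theta>\<close>).  The other triangle
  gives the second equation at \<open>id\<^sub>X\<close>, and multiplicativity of \<open>\<psi>\<close> extends it to all arrows (\<open>\<eta>_\<psi>_\<theta>\<close>).

  Conversely, the same two formulas define \<open>\<upsilon>\<close> and \<open>\<omega>\<close> from given \<open>\<theta>\<close> and \<open>\<eta>\<close>.  The conditions of \<open>V\<^sub>1\<close> make
  \<open>\<upsilon>\<close> a morphism of entwined modules (\<open>gf_counit_entwined\<close>), those of \<open>W\<^sub>1\<close> make \<open>\<omega>\<close> a morphism of modules
  (\<open>fg_unit_morphism\<close>), and the equations give the triangles (\<open>triangle_cofree\<close>, \<open>triangle_forget\<close>).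

  The computations are in Sweedler notation.  A sum \<open>\<Sum> E a b\<close> over \<open>t = \<Sum> a \<otimes> b\<close> is evaluated on one chosen
  representative of \<open>t\<close>; so for every \<open>E\<close> it commutes with linear maps and with other such sums, and
  bilinearity of \<open>E\<close> enters only where a sum is to depend linearly on \<open>t\<close>, or is to be evaluated on
  a given representative.  With membership and linearity left to the simplifier, each
  identity is checked by expanding both sides to iterated sums over the same tensors.
\<close>

section \<open>Sums over a representative of a tensor\<close>

text \<open>
  The homomorphism from the free abelian group to \<open>T\<close> that extends \<open>e\<close>.  It is spelled as a sum over the
  keys because \<open>tsum\<close> is.
\<close>

definition frag_eval :: "('k, 't, 'e) module_scheme \<Rightarrow> ('p \<Rightarrow> 't) \<Rightarrow> ('p \<Rightarrow>\<^sub>0 int) \<Rightarrow> 't" where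
  "frag_eval T e x = (\<Oplus>\<^bsub>T\<^esub> p \<in> Poly_Mapping.keys x. add_pow T (Poly_Mapping.lookup x p) (e p))"

text \<open>
  Restricting the summand to the carriers makes the congruence rule \<open>sweedler_cong\<close> hold for every \<open>t\<close>,
  even one that is not a tensor.  The spaces \<open>V\<close> and \<open>W\<close> are arguments so that a term tells over which
  carriers its bound variables range.
\<close>

definition sweedler ::
  "('k, 'v, 'e) module_scheme \<Rightarrow> ('k, 'w, 'f) module_scheme \<Rightarrow> ('k, 't, 'g) module_scheme \<Rightarrow>
   ('v, 'w) tensor \<Rightarrow> ('v \<Rightarrow> 'w \<Rightarrow> 't) \<Rightarrow> 't" where
  "sweedler V W T t E =
     frag_eval T (\<lambda>p \<in> carrier V \<times> carrier W. E (fst p) (snd p)) (SOME x. x \<in> t)"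

lemma (in abelian_group) eq_diffI:
  "a \<oplus> c = b \<Longrightarrow> a \<in> carrier G \<Longrightarrow> c \<in> carrier G \<Longrightarrow> a = b \<ominus> c"
  by (auto simp: minus_eq a_assoc r_neg)

lemma (in abelian_group) diff_zeroD:
  assumes "a \<ominus> b = \<zero>" "a \<in> carrier G" "b \<in> carrier G" shows "a = b"
proof -
  have "a = (a \<ominus> b) \<oplus> b" using assms(2,3) by (simp add: minus_eq a_assoc l_neg)
  with assms show ?thesis by simp
qed

lemma add_pow_int_zero: "add_pow T (0 :: int) x = \<zero>\<^bsub>T\<^esub>"
  by (simp add: add_pow_def int_pow_def)

text \<open>
  Two formal sums can be added term by term only over a common index set, which is larger than
  the keys of either.
\<close>

lemma frag_eval_superset:
  assumes T: "abelian_group T" and e: "\<And>p. p \<in> S \<Longrightarrow> e p \<in> carrier T"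
    and A: "finite A" "Poly_Mapping.keys x \<subseteq> A" "A \<subseteq> S"
  shows "frag_eval T e x = (\<Oplus>\<^bsub>T\<^esub> p\<in>A. add_pow T (Poly_Mapping.lookup x p) (e p))"
proof -
  interpret abelian_group T by fact
  show ?thesis unfolding frag_eval_def
    by (rule add.finprod_mono_neutral_cong_left) (use A e in \<open>auto simp: in_keys_iff add_pow_int_zero\<close>)
qed

lemma frag_eval_closed:
  assumes "abelian_group T" "\<And>p. p \<in> S \<Longrightarrow> e p \<in> carrier T" "Poly_Mapping.keys x \<subseteq> S"
  shows "frag_eval T e x \<in> carrier T"
proof -
  interpret abelian_group T by fact
  show ?thesis unfolding frag_eval_def by (rule finsum_closed) (use assms in auto)
qed

lemma frag_eval_cong:
  assumes "\<And>p. p \<in> S \<Longrightarrow> e p = e' p" "Poly_Mapping.keys x \<subseteq> S" 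
  shows "abelian_group T \<Longrightarrow> (\<And>p. p \<in> S \<Longrightarrow> e' p \<in> carrier T) \<Longrightarrow> frag_eval T e x = frag_eval T e' x"
proof -
  assume T: "abelian_group T" and c: "\<And>p. p \<in> S \<Longrightarrow> e' p \<in> carrier T"
  interpret abelian_group T by fact
  show ?thesis unfolding frag_eval_def 
    by (rule finsum_cong') (use assms c in \<open>auto\<close>)
qed

lemma frag_eval_add:
  assumes T: "abelian_group T" and e: "\<And>p. p \<in> S \<Longrightarrow> e p \<in> carrier T"
    and x: "Poly_Mapping.keys x \<subseteq> S" and y: "Poly_Mapping.keys y \<subseteq> S"
  shows "frag_eval T e (x + y) = frag_eval T e x \<oplus>\<^bsub>T\<^esub> frag_eval T e y"
proof -
  interpret abelian_group T by fact
  let ?A = "Poly_Mapping.keys x \<union> Poly_Mapping.keys y"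
  have e': "e p \<in> carrier T" if "p \<in> ?A" for p using that e x y by blast
  have "frag_eval T e (x + y) = (\<Oplus>\<^bsub>T\<^esub> p\<in>?A. add_pow T (Poly_Mapping.lookup (x + y) p) (e p))"
    by (rule frag_eval_superset[OF T e]) (use x y keys_add[of x y] in auto)
  also have "\<dots> = (\<Oplus>\<^bsub>T\<^esub> p\<in>?A. add_pow T (Poly_Mapping.lookup x p) (e p) \<oplus>\<^bsub>T\<^esub> add_pow T (Poly_Mapping.lookup y p) (e p))"
    by (rule finsum_cong') (use e' in \<open>auto simp: lookup_add add.int_pow_mult\<close>)
  also have "\<dots> = (\<Oplus>\<^bsub>T\<^esub> p\<in>?A. add_pow T (Poly_Mapping.lookup x p) (e p)) \<oplus>\<^bsub>T\<^esub> (\<Oplus>\<^bsub>T\<^esub> p\<in>?A. add_pow T (Poly_Mapping.lookup y p) (e p))"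
    by (rule finsum_addf) (use e' in auto)
  also have "\<dots> = frag_eval T e x \<oplus>\<^bsub>T\<^esub> frag_eval T e y"
    using frag_eval_superset[where S=S and e=e and x=x and A="?A", OF T e] frag_eval_superset[where S=S and e=e and x=y and A="?A", OF T e] x y by simp
  finally show ?thesis .
qed

lemma frag_eval_diff:
  assumes T: "abelian_group T" and e: "\<And>p. p \<in> S \<Longrightarrow> e p \<in> carrier T"
    and x: "Poly_Mapping.keys x \<subseteq> S" and y: "Poly_Mapping.keys y \<subseteq> S"
  shows "frag_eval T e (x - y) = frag_eval T e x \<ominus>\<^bsub>T\<^esub> frag_eval T e y"
proof -
  interpret abelian_group T by fact
  have k: "Poly_Mapping.keys (x - y) \<subseteq> S" using x y keys_diff[of x y] by blast
  have "frag_eval T e (x - y) \<oplus>\<^bsub>T\<^esub> frag_eval T e y = frag_eval T e x"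
    using frag_eval_add[OF T e k y] by simp
  moreover have "frag_eval T e x \<in> carrier T" "frag_eval T e y \<in> carrier T" "frag_eval T e (x - y) \<in> carrier T"
    using frag_eval_closed[where S=S and e=e, OF T e] x y k by auto
  ultimately show ?thesis by (intro eq_diffI)
qed

lemma frag_eval_frag_of:
  assumes "abelian_group T" "e p \<in> carrier T"
  shows "frag_eval T e (frag_of p) = e p"
proof -
  interpret abelian_group T by fact
  show ?thesis using assms by (simp add: frag_eval_def)
qed

lemma frag_eval_hom:
  assumes T: "abelian_group T" and T': "abelian_group T'"
    and h: "\<And>a. a \<in> carrier T \<Longrightarrow> h a \<in> carrier T'"
       "\<And>a b. a \<in> carrier T \<Longrightarrow> b \<in> carrier T \<Longrightarrow> h (a \<oplus>\<^bsub>T\<^esub> b) = h a \<oplus>\<^bsub>T'\<^esub> h b"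
    and e: "\<And>p. p \<in> S \<Longrightarrow> e p \<in> carrier T"
    and x: "Poly_Mapping.keys x \<subseteq> S"
  shows "h (frag_eval T e x) = frag_eval T' (\<lambda>p. h (e p)) x"
  using x
proof (induction x rule: free_Abelian_group_induct[consumes 1, case_names zero diff one])
  interpret T: abelian_group T by fact
  interpret T': abelian_group T' by fact
  have h_minus: "h (a \<ominus>\<^bsub>T\<^esub> b) = h a \<ominus>\<^bsub>T'\<^esub> h b" if "a \<in> carrier T" "b \<in> carrier T" for a b
  proof -
    have "h (a \<ominus>\<^bsub>T\<^esub> b) \<oplus>\<^bsub>T'\<^esub> h b = h a"
      using that h(2)[of "a \<ominus>\<^bsub>T\<^esub> b" b] by (simp add: T.minus_eq T.a_assoc T.l_neg)
    then show ?thesis using that h(1) by (intro T'.eq_diffI) auto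
  qed
  case zero
  have "h \<zero>\<^bsub>T\<^esub> = \<zero>\<^bsub>T'\<^esub>" using h_minus[of "\<zero>\<^bsub>T\<^esub>" "\<zero>\<^bsub>T\<^esub>"] h(1)[of "\<zero>\<^bsub>T\<^esub>"]
    by (simp add: T.minus_eq T'.minus_eq T'.r_neg T.r_neg)
  then show ?case by (simp add: frag_eval_def)
  case (diff x y)
  have c': "\<And>p. p \<in> S \<Longrightarrow> h (e p) \<in> carrier T'" using h e by blast
  show ?case using diff
    by (simp add: frag_eval_diff[where S=S and e=e, OF T e] frag_eval_diff[where S=S and e="\<lambda>p. h (e p)", OF T' c'] h_minus
        frag_eval_closed[where S=S and e=e, OF T e])
next
  case (one a)
  then show ?case using e h by (simp add: frag_eval_frag_of T T')
qed

section \<open>Linear maps\<close>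

lemma linear_mapsI:
  assumes "\<And>x. x \<in> carrier V \<Longrightarrow> f x \<in> carrier W"
    "\<And>x y. x \<in> carrier V \<Longrightarrow> y \<in> carrier V \<Longrightarrow> f (x \<oplus>\<^bsub>V\<^esub> y) = f x \<oplus>\<^bsub>W\<^esub> f y"
    "\<And>a x. a \<in> carrier K \<Longrightarrow> x \<in> carrier V \<Longrightarrow> f (a \<odot>\<^bsub>V\<^esub> x) = a \<odot>\<^bsub>W\<^esub> f x"
  shows "f \<in> linear_maps K V W"
  using assms by (auto simp: linear_maps_def)

lemma linear_maps_closed: "f \<in> linear_maps K V W \<Longrightarrow> x \<in> carrier V \<Longrightarrow> f x \<in> carrier W"
  by (auto simp: linear_maps_def)

lemma linear_maps_add:
  "f \<in> linear_maps K V W \<Longrightarrow> x \<in> carrier V \<Longrightarrow> y \<in> carrier V \<Longrightarrow> f (x \<oplus>\<^bsub>V\<^esub> y) = f x \<oplus>\<^bsub>W\<^esub> f y"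
  by (auto simp: linear_maps_def)

lemma linear_maps_smult:
  "f \<in> linear_maps K V W \<Longrightarrow> a \<in> carrier K \<Longrightarrow> x \<in> carrier V \<Longrightarrow> f (a \<odot>\<^bsub>V\<^esub> x) = a \<odot>\<^bsub>W\<^esub> f x"
  by (auto simp: linear_maps_def)

lemma linear_maps_comp:
  assumes "f \<in> linear_maps K V W" "g \<in> linear_maps K U V"
  shows "(\<lambda>x. f (g x)) \<in> linear_maps K U W"
  using assms by (auto simp: linear_maps_def Pi_iff)

lemma linear_maps_ident: "(\<lambda>x. x) \<in> linear_maps K V V"
  by (simp add: linear_maps_def)

lemma linear_maps_cong:
  assumes "module K V" "\<And>x. x \<in> carrier V \<Longrightarrow> f x = g x"
  shows "f \<in> linear_maps K V W \<longleftrightarrow> g \<in> linear_maps K V W"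
proof -
  interpret V: module K V by fact
  have "f \<in> linear_maps K V W \<Longrightarrow> g \<in> linear_maps K V W" if "\<And>x. x \<in> carrier V \<Longrightarrow> f x = g x" for f g
  proof (rule linear_mapsI)
    assume f: "f \<in> linear_maps K V W"
    show "g x \<in> carrier W" if "x \<in> carrier V" for x
      using linear_maps_closed[OF f that] that \<open>\<And>x. x \<in> carrier V \<Longrightarrow> f x = g x\<close> by simp
    show "g (x \<oplus>\<^bsub>V\<^esub> y) = g x \<oplus>\<^bsub>W\<^esub> g y" if "x \<in> carrier V" "y \<in> carrier V" for x y
      using linear_maps_add[OF f] that \<open>\<And>x. x \<in> carrier V \<Longrightarrow> f x = g x\<close> by (metis V.a_closed)
    show "g (a \<odot>\<^bsub>V\<^esub> x) = a \<odot>\<^bsub>W\<^esub> g x" if "a \<in> carrier K" "x \<in> carrier V" for a x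
      using linear_maps_smult[OF f] that \<open>\<And>x. x \<in> carrier V \<Longrightarrow> f x = g x\<close> by (metis V.smult_closed)
  qed
  with assms(2) show ?thesis by metis
qed

section \<open>The tensor product as a module\<close>

lemma tensor_relatorsE:
  assumes "x \<in> tensor_relators K V W"
  obtains (left) v v' w where "x = frag_of (v \<oplus>\<^bsub>V\<^esub> v', w) - frag_of (v, w) - frag_of (v', w)"
      "v \<in> carrier V" "v' \<in> carrier V" "w \<in> carrier W"
    | (right) v w w' where "x = frag_of (v, w \<oplus>\<^bsub>W\<^esub> w') - frag_of (v, w) - frag_of (v, w')"
      "v \<in> carrier V" "w \<in> carrier W" "w' \<in> carrier W"
    | (scalar) b v w where "x = frag_of (b \<odot>\<^bsub>V\<^esub> v, w) - frag_of (v, b \<odot>\<^bsub>W\<^esub> w)"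
      "b \<in> carrier K" "v \<in> carrier V" "w \<in> carrier W"
  using assms unfolding tensor_relators_def by blast

definition tensor_class ::
  "('k, 'r) ring_scheme \<Rightarrow> ('k, 'v, 'e) module_scheme \<Rightarrow> ('k, 'w, 'f) module_scheme \<Rightarrow>
   ('v \<times> 'w \<Rightarrow>\<^sub>0 int) \<Rightarrow> ('v, 'w) tensor" where
  "tensor_class K V W x = tensor_null K V W #>\<^bsub>free_Abelian_group (carrier V \<times> carrier W)\<^esub> x"

text \<open>
  The action of a scalar on formal sums, of which the scalar multiplication of \<open>tensor K V W\<close> is the quotient.
\<close>

definition tensor_scale :: "('k, 'v, 'e) module_scheme \<Rightarrow> 'k \<Rightarrow> ('v \<times> 'w \<Rightarrow>\<^sub>0 int) \<Rightarrow> ('v \<times> 'w \<Rightarrow>\<^sub>0 int)" where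
  "tensor_scale V a = frag_extend (\<lambda>(v, w). frag_of (a \<odot>\<^bsub>V\<^esub> v, w))"

context
  fixes K :: "('k, 'r) ring_scheme" and V :: "('k, 'v, 'e) module_scheme"
    and W :: "('k, 'w, 'f) module_scheme"
  assumes V: "module K V" and W: "module K W"
begin

interpretation V: module K V by (fact V)
interpretation W: module K W by (fact W)

private abbreviation (input) "S \<equiv> carrier V \<times> carrier W"
private abbreviation (input) "G \<equiv> free_Abelian_group S"
private abbreviation (input) "N \<equiv> tensor_null K V W"
private abbreviation (input) "cls \<equiv> tensor_class K V W"

lemma relators_closed: "x \<in> tensor_relators K V W \<Longrightarrow> Poly_Mapping.keys x \<subseteq> S"
  unfolding tensor_relators_def
  by (auto dest!: subsetD[OF keys_diff] split: if_splits)

lemma null_normal: "N \<lhd> G"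
proof -
  interpret comm_group G by (rule abelian_free_Abelian_group)
  show ?thesis unfolding tensor_null_def
    using relators_closed
    by (intro subgroup_imp_normal generate_is_subgroup) (auto simp: carrier_free_Abelian_group_iff)
qed

lemma null_closed: "x \<in> N \<Longrightarrow> Poly_Mapping.keys x \<subseteq> S"
  using null_normal normal_imp_subgroup subgroup.subset by fastforce

lemma null_add: "x \<in> N \<Longrightarrow> y \<in> N \<Longrightarrow> x + y \<in> N"
  using subgroup.m_closed[OF normal_imp_subgroup[OF null_normal]] by fastforce

lemma null_minus: "x \<in> N \<Longrightarrow> - x \<in> N"
  using subgroup.m_inv_closed[OF normal_imp_subgroup[OF null_normal], of x] null_closed[of x] by simp

lemma null_0: "0 \<in> N"
  using subgroup.one_closed[OF normal_imp_subgroup[OF null_normal]] by simp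

lemma null_relator: "x \<in> tensor_relators K V W \<Longrightarrow> x \<in> N"
  unfolding tensor_null_def by (rule generate.incl)

lemma mem_cls: "Poly_Mapping.keys x \<subseteq> S \<Longrightarrow> y \<in> cls x \<longleftrightarrow> y - x \<in> N"
  unfolding tensor_class_def r_coset_def by (auto intro!: bexI[of _ "y - x"])

lemma cls_self: "Poly_Mapping.keys x \<subseteq> S \<Longrightarrow> x \<in> cls x"
  by (simp add: mem_cls null_0)

lemma cls_eq_iff: 
  assumes x: "Poly_Mapping.keys x \<subseteq> S" and y: "Poly_Mapping.keys y \<subseteq> S"
  shows "cls x = cls y \<longleftrightarrow> x - y \<in> N"
proof
  assume "cls x = cls y" then show "x - y \<in> N" using mem_cls[OF y, of x] cls_self[OF x] by auto
next
  assume N: "x - y \<in> N"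
  have "z - x \<in> N \<longleftrightarrow> z - y \<in> N" for z
    using null_add[OF N, of "z - x"] null_add[OF null_minus[OF N], of "z - y"] by (auto simp: algebra_simps)
  then show "cls x = cls y" using mem_cls[OF x] mem_cls[OF y] by blast
qed

lemma carrier_tensor: "carrier (tensor K V W) = cls ` {x. Poly_Mapping.keys x \<subseteq> S}"
  unfolding tensor_def tensor_class_def by (auto simp: Let_def FactGroup_def RCOSETS_def carrier_free_Abelian_group_iff)

lemma tensor_cases:
  assumes "t \<in> carrier (tensor K V W)"
  obtains x where "Poly_Mapping.keys x \<subseteq> S" "t = cls x"
  using assms unfolding carrier_tensor by auto

lemma mem_tensor_keys:
  assumes "t \<in> carrier (tensor K V W)" "x \<in> t"
  shows "Poly_Mapping.keys x \<subseteq> S" "t = cls x"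
proof -
  obtain y where y: "Poly_Mapping.keys y \<subseteq> S" "t = cls y" using tensor_cases[OF assms(1)] by blast
  then have N: "x - y \<in> N" using assms mem_cls by simp
  have "x = (x - y) + y" by simp
  then show k: "Poly_Mapping.keys x \<subseteq> S" using null_closed[OF N] y(1) keys_add[of "x - y" y] by auto
  show "t = cls x" using cls_eq_iff[OF k y(1)] N y by simp
qed

lemma cls_add: "Poly_Mapping.keys x \<subseteq> S \<Longrightarrow> Poly_Mapping.keys y \<subseteq> S \<Longrightarrow>
   cls x \<oplus>\<^bsub>tensor K V W\<^esub> cls y = cls (x + y)"
  using normal.rcos_sum[OF null_normal, of x y]
  unfolding tensor_def tensor_class_def by (simp add: Let_def FactGroup_def)

lemma cls_zero: "\<zero>\<^bsub>tensor K V W\<^esub> = cls 0"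
  using subgroup.subset[OF normal_imp_subgroup[OF null_normal]]
  unfolding tensor_def tensor_class_def by (simp add: Let_def FactGroup_def r_coset_def)

lemma cls_closed: "Poly_Mapping.keys x \<subseteq> S \<Longrightarrow> cls x \<in> carrier (tensor K V W)"
  unfolding carrier_tensor by auto

lemma scale_keys: "a \<in> carrier K \<Longrightarrow> Poly_Mapping.keys x \<subseteq> S \<Longrightarrow> Poly_Mapping.keys (tensor_scale V a x) \<subseteq> S"
  unfolding tensor_scale_def using keys_frag_extend[of "\<lambda>(v, w). frag_of (a \<odot>\<^bsub>V\<^esub> v, w)" x]
  by (auto split: prod.splits if_splits; fastforce)

lemma scale_diff: "tensor_scale V a (x - y) = tensor_scale V a x - tensor_scale V a y"
  unfolding tensor_scale_def by (rule frag_extend_diff)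
lemma scale_add: "tensor_scale V a (x + y) = tensor_scale V a x + tensor_scale V a y"
  unfolding tensor_scale_def by (rule frag_extend_add)
lemma scale_minus: "tensor_scale V a (- y) = - tensor_scale V a y"
  unfolding tensor_scale_def by (rule frag_extend_minus)
lemma scale_0: "tensor_scale V a 0 = 0"
  unfolding tensor_scale_def by simp
lemma scale_frag_of: "tensor_scale V a (frag_of (v, w)) = frag_of (a \<odot>\<^bsub>V\<^esub> v, w)"
  unfolding tensor_scale_def by simp

text \<open>
  This makes the action of a scalar descend to classes.  Relators of the third kind go to relators of
  the third kind because \<open>K\<close> is commutative.
\<close>

lemma scale_relator:
  assumes a: "a \<in> carrier K" and x: "x \<in> tensor_relators K V W"
  shows "tensor_scale V a x \<in> tensor_relators K V W"
  using x
proof (cases rule: tensor_relatorsE)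
  case (left v v' w)
  then have "tensor_scale V a x = frag_of (a \<odot>\<^bsub>V\<^esub> v \<oplus>\<^bsub>V\<^esub> a \<odot>\<^bsub>V\<^esub> v', w) - frag_of (a \<odot>\<^bsub>V\<^esub> v, w) - frag_of (a \<odot>\<^bsub>V\<^esub> v', w)"
    using a by (simp add: scale_diff scale_frag_of V.smult_r_distr)
  with left a show ?thesis unfolding tensor_relators_def by blast
next
  case (right v w w')
  then have "tensor_scale V a x = frag_of (a \<odot>\<^bsub>V\<^esub> v, w \<oplus>\<^bsub>W\<^esub> w') - frag_of (a \<odot>\<^bsub>V\<^esub> v, w) - frag_of (a \<odot>\<^bsub>V\<^esub> v, w')"
    by (simp add: scale_diff scale_frag_of)
  with right a show ?thesis unfolding tensor_relators_def by blast
next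
  case (scalar b v w)
  have "a \<odot>\<^bsub>V\<^esub> (b \<odot>\<^bsub>V\<^esub> v) = b \<odot>\<^bsub>V\<^esub> (a \<odot>\<^bsub>V\<^esub> v)"
    using scalar a by (simp add: V.R.m_comm flip: V.smult_assoc1)
  with scalar have "tensor_scale V a x = frag_of (b \<odot>\<^bsub>V\<^esub> (a \<odot>\<^bsub>V\<^esub> v), w) - frag_of (a \<odot>\<^bsub>V\<^esub> v, b \<odot>\<^bsub>W\<^esub> w)"
    by (simp add: scale_diff scale_frag_of)
  with scalar a show ?thesis unfolding tensor_relators_def by blast
qed

lemma scale_null:
  assumes a: "a \<in> carrier K" and x: "x \<in> N"
  shows "tensor_scale V a x \<in> N"
  using x unfolding tensor_null_def
proof (induction rule: generate.induct)
  case one then show ?case using generate.one[of G] by (simp add: scale_0)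
next
  case (incl h) show ?case by (rule generate.incl[OF scale_relator[OF a incl]])
next
  case (inv h)
  then have "inv\<^bsub>G\<^esub> (tensor_scale V a h) \<in> generate G (tensor_relators K V W)"
    by (intro generate.inv scale_relator[OF a])
  with inv show ?case using relators_closed scale_relator[OF a] by (simp add: scale_minus)
next
  case (eng h1 h2)
  then show ?case using generate.eng[of "tensor_scale V a h1" G _ "tensor_scale V a h2"] by (simp add: scale_add)
qed

lemma cls_smult:
  assumes a: "a \<in> carrier K" and x: "Poly_Mapping.keys x \<subseteq> S"
  shows "a \<odot>\<^bsub>tensor K V W\<^esub> cls x = cls (tensor_scale V a x)"
proof -
  have "(\<lambda>y. cls (tensor_scale V a y)) ` cls x = {cls (tensor_scale V a x)}"
  proof -
    have "cls (tensor_scale V a y) = cls (tensor_scale V a x)" if "y \<in> cls x" for y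
    proof -
      have k: "Poly_Mapping.keys y \<subseteq> S" using mem_tensor_keys[OF cls_closed[OF x] that] by blast
      show ?thesis
        using scale_null[OF a] that mem_cls[OF x] cls_eq_iff[OF scale_keys[OF a k] scale_keys[OF a x]]
        by (simp flip: scale_diff)
    qed
    then show ?thesis using cls_self[OF x] by blast
  qed
  then have "the_elem ((\<lambda>y. cls (tensor_scale V a y)) ` cls x) = cls (tensor_scale V a x)" by simp
  then show ?thesis unfolding tensor_def by (simp add: tensor_class_def tensor_scale_def Let_def)
qed

text \<open>
  Distributivity over the sum of two scalars fails for formal sums; on a generator the difference of
  the two sides is a biadditivity relator.
\<close>

lemma scale_sum_null:
  assumes a: "a \<in> carrier K" "b \<in> carrier K" and x: "Poly_Mapping.keys x \<subseteq> S"
  shows "tensor_scale V (a \<oplus>\<^bsub>K\<^esub> b) x - (tensor_scale V a x + tensor_scale V b x) \<in> N"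
  using x
proof (induction x rule: free_Abelian_group_induct[consumes 1, case_names zero diff one])
  case zero show ?case by (simp add: scale_0 null_0)
next
  case (diff x y)
  from null_add[OF diff(3) null_minus[OF diff(4)]] show ?case by (simp add: scale_diff algebra_simps)
next
  case (one p)
  obtain v w where p: "p = (v, w)" "v \<in> carrier V" "w \<in> carrier W" using one by auto
  have "frag_of (a \<odot>\<^bsub>V\<^esub> v \<oplus>\<^bsub>V\<^esub> b \<odot>\<^bsub>V\<^esub> v, w) - frag_of (a \<odot>\<^bsub>V\<^esub> v, w) - frag_of (b \<odot>\<^bsub>V\<^esub> v, w) \<in> N"
    by (rule null_relator) (use p a in \<open>unfold tensor_relators_def, blast\<close>)
  then show ?case using p a by (simp add: scale_frag_of V.smult_l_distr algebra_simps)
qed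

lemma module_tensor: "module K (tensor K V W)"
proof (rule moduleI)
  let ?T = "tensor K V W"
  show "cring K" using V by (simp add: module_def)
  have k0: "Poly_Mapping.keys (0 :: 'v \<times> 'w \<Rightarrow>\<^sub>0 int) \<subseteq> S" by simp
  have kp: "Poly_Mapping.keys (x + y) \<subseteq> S" if "Poly_Mapping.keys x \<subseteq> S" "Poly_Mapping.keys y \<subseteq> S" for x y
    using that keys_add[of x y] by blast
  show "abelian_group ?T"
  proof (rule abelian_groupI)
    fix s t u assume "s \<in> carrier ?T" "t \<in> carrier ?T" "u \<in> carrier ?T"
    then show "s \<oplus>\<^bsub>?T\<^esub> t \<oplus>\<^bsub>?T\<^esub> u = s \<oplus>\<^bsub>?T\<^esub> (t \<oplus>\<^bsub>?T\<^esub> u)"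
      by (elim tensor_cases) (simp add: cls_add kp add.assoc)
  next
    fix s t assume "s \<in> carrier ?T" "t \<in> carrier ?T"
    then show "s \<oplus>\<^bsub>?T\<^esub> t \<in> carrier ?T" "s \<oplus>\<^bsub>?T\<^esub> t = t \<oplus>\<^bsub>?T\<^esub> s"
      by (elim tensor_cases; simp add: cls_add kp cls_closed add.commute)+
  next
    show "\<zero>\<^bsub>?T\<^esub> \<in> carrier ?T" by (simp add: cls_zero cls_closed)
  next
    fix s assume "s \<in> carrier ?T"
    then obtain x where x: "Poly_Mapping.keys x \<subseteq> S" "s = cls x" by (rule tensor_cases)
    then show "\<zero>\<^bsub>?T\<^esub> \<oplus>\<^bsub>?T\<^esub> s = s" by (simp add: cls_zero cls_add)
    show "\<exists>y\<in>carrier ?T. y \<oplus>\<^bsub>?T\<^esub> s = \<zero>\<^bsub>?T\<^esub>"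
      using x by (intro bexI[of _ "cls (- x)"]) (simp_all add: cls_add cls_zero cls_closed)
  qed
next
  let ?T = "tensor K V W"
  fix a s assume a: "a \<in> carrier K" and s: "s \<in> carrier ?T"
  then show "a \<odot>\<^bsub>?T\<^esub> s \<in> carrier ?T" by (elim tensor_cases) (simp add: cls_smult cls_closed scale_keys)
next
  let ?T = "tensor K V W"
  fix a b s assume a: "a \<in> carrier K" "b \<in> carrier K" and s: "s \<in> carrier ?T"
  obtain x where x: "Poly_Mapping.keys x \<subseteq> S" "s = cls x" using s by (rule tensor_cases)
  have k: "Poly_Mapping.keys (tensor_scale V a x) \<subseteq> S" "Poly_Mapping.keys (tensor_scale V b x) \<subseteq> S"
    "Poly_Mapping.keys (tensor_scale V (a \<oplus>\<^bsub>K\<^esub> b) x) \<subseteq> S"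
    using a x by (simp_all add: scale_keys)
  moreover have "Poly_Mapping.keys (tensor_scale V a x + tensor_scale V b x) \<subseteq> S" using k(1,2) keys_add[of "tensor_scale V a x" "tensor_scale V b x"] by blast
  ultimately show "(a \<oplus>\<^bsub>K\<^esub> b) \<odot>\<^bsub>?T\<^esub> s = a \<odot>\<^bsub>?T\<^esub> s \<oplus>\<^bsub>?T\<^esub> b \<odot>\<^bsub>?T\<^esub> s"
    using scale_sum_null[OF a x(1)] a x by (simp add: cls_smult cls_add cls_eq_iff)
  have "tensor_scale V (a \<otimes>\<^bsub>K\<^esub> b) x = tensor_scale V a (tensor_scale V b x)"
    using x(1)
  proof (induction x rule: free_Abelian_group_induct[consumes 1, case_names zero diff one])
    case zero show ?case by (simp add: scale_0)
  next
    case (diff x y) then show ?case by (simp add: scale_diff)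
  next
    case (one p) then show ?case using a by (cases p) (simp add: scale_frag_of V.smult_assoc1)
  qed
  then show "(a \<otimes>\<^bsub>K\<^esub> b) \<odot>\<^bsub>?T\<^esub> s = a \<odot>\<^bsub>?T\<^esub> (b \<odot>\<^bsub>?T\<^esub> s)"
    using a x k by (simp add: cls_smult)
next
  let ?T = "tensor K V W"
  fix a s t assume a: "a \<in> carrier K" and s: "s \<in> carrier ?T" and t: "t \<in> carrier ?T"
  obtain x where x: "Poly_Mapping.keys x \<subseteq> S" "s = cls x" using s by (rule tensor_cases)
  obtain y where y: "Poly_Mapping.keys y \<subseteq> S" "t = cls y" using t by (rule tensor_cases)
  have "Poly_Mapping.keys (x + y) \<subseteq> S" using x y keys_add[of x y] by blast
  then show "a \<odot>\<^bsub>?T\<^esub> (s \<oplus>\<^bsub>?T\<^esub> t) = a \<odot>\<^bsub>?T\<^esub> s \<oplus>\<^bsub>?T\<^esub> a \<odot>\<^bsub>?T\<^esub> t"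
    using a x y by (simp add: cls_add cls_smult scale_keys scale_add)
next
  let ?T = "tensor K V W"
  fix s assume "s \<in> carrier ?T"
  then obtain x where x: "Poly_Mapping.keys x \<subseteq> S" "s = cls x" by (rule tensor_cases)
  have "tensor_scale V \<one>\<^bsub>K\<^esub> x = x"
    using x(1)
  proof (induction x rule: free_Abelian_group_induct[consumes 1, case_names zero diff one])
    case zero show ?case by (simp add: scale_0)
  next
    case (diff x y) then show ?case by (simp add: scale_diff)
  next
    case (one p) then show ?case by (cases p) (simp add: scale_frag_of)
  qed
  then show "\<one>\<^bsub>K\<^esub> \<odot>\<^bsub>?T\<^esub> s = s" using x by (simp add: cls_smult)
qed

lemma pure_cls: "pure K V W v w = cls (frag_of (v, w))"
  by (simp add: pure_def tensor_class_def)

lemma pure_closed: "v \<in> carrier V \<Longrightarrow> w \<in> carrier W \<Longrightarrow> pure K V W v w \<in> carrier (tensor K V W)"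
  by (simp add: pure_cls cls_closed)

lemma pure_linear_left:
  assumes w: "w \<in> carrier W" shows "(\<lambda>v. pure K V W v w) \<in> linear_maps K V (tensor K V W)"
proof (rule linear_mapsI)
  fix v v' assume v: "v \<in> carrier V" "v' \<in> carrier V"
  have "frag_of (v \<oplus>\<^bsub>V\<^esub> v', w) - frag_of (v, w) - frag_of (v', w) \<in> N"
    by (rule null_relator) (use v w in \<open>unfold tensor_relators_def, blast\<close>)
  moreover have "Poly_Mapping.keys (frag_of (v, w) + frag_of (v', w)) \<subseteq> S" 
    using v w keys_add[of "frag_of (v, w)" "frag_of (v', w)"] by auto
  ultimately show "pure K V W (v \<oplus>\<^bsub>V\<^esub> v') w = pure K V W v w \<oplus>\<^bsub>tensor K V W\<^esub> pure K V W v' w"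
    using v w by (simp add: pure_cls cls_add cls_eq_iff algebra_simps)
qed (use w in \<open>simp_all add: pure_closed pure_cls cls_smult scale_frag_of cls_closed\<close>)

lemma pure_linear_right:
  assumes v: "v \<in> carrier V" shows "pure K V W v \<in> linear_maps K W (tensor K V W)"
proof (rule linear_mapsI)
  fix w w' assume w: "w \<in> carrier W" "w' \<in> carrier W"
  have "frag_of (v, w \<oplus>\<^bsub>W\<^esub> w') - frag_of (v, w) - frag_of (v, w') \<in> N"
    by (rule null_relator) (use v w in \<open>unfold tensor_relators_def, blast\<close>)
  moreover have "Poly_Mapping.keys (frag_of (v, w) + frag_of (v, w')) \<subseteq> S" 
    using v w keys_add[of "frag_of (v, w)" "frag_of (v, w')"] by auto
  ultimately show "pure K V W v (w \<oplus>\<^bsub>W\<^esub> w') = pure K V W v w \<oplus>\<^bsub>tensor K V W\<^esub> pure K V W v w'"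
    using v w by (simp add: pure_cls cls_add cls_eq_iff algebra_simps)
next
  fix a w assume a: "a \<in> carrier K" and w: "w \<in> carrier W"
  have "frag_of (a \<odot>\<^bsub>V\<^esub> v, w) - frag_of (v, a \<odot>\<^bsub>W\<^esub> w) \<in> N"
    by (rule null_relator) (use v w a in \<open>unfold tensor_relators_def, blast\<close>)
  then have "cls (frag_of (a \<odot>\<^bsub>V\<^esub> v, w)) = cls (frag_of (v, a \<odot>\<^bsub>W\<^esub> w))"
    using v w a by (simp add: cls_eq_iff)
  then show "pure K V W v (a \<odot>\<^bsub>W\<^esub> w) = a \<odot>\<^bsub>tensor K V W\<^esub> pure K V W v w"
    using v w a by (simp add: pure_cls cls_smult scale_frag_of)
qed (use v in \<open>simp add: pure_closed\<close>)

end

section \<open>Sweedler sums\<close>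

lemma frag_eval_addf:
  assumes T: "abelian_group T" and e: "\<And>p. p \<in> S \<Longrightarrow> e p \<in> carrier T" "\<And>p. p \<in> S \<Longrightarrow> e' p \<in> carrier T"
    and x: "Poly_Mapping.keys x \<subseteq> S"
  shows "frag_eval T (\<lambda>p. e p \<oplus>\<^bsub>T\<^esub> e' p) x = frag_eval T e x \<oplus>\<^bsub>T\<^esub> frag_eval T e' x"
proof -
  interpret abelian_group T by fact
  have "frag_eval T (\<lambda>p. e p \<oplus>\<^bsub>T\<^esub> e' p) x =
    (\<Oplus>\<^bsub>T\<^esub> p\<in>Poly_Mapping.keys x. add_pow T (Poly_Mapping.lookup x p) (e p) \<oplus>\<^bsub>T\<^esub> add_pow T (Poly_Mapping.lookup x p) (e' p))"
    unfolding frag_eval_def by (rule finsum_cong') (use e x in \<open>auto simp: add.int_pow_distrib subset_iff\<close>)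
  also have "\<dots> = frag_eval T e x \<oplus>\<^bsub>T\<^esub> frag_eval T e' x"
    unfolding frag_eval_def by (rule finsum_addf) (use e x in auto)
  finally show ?thesis .
qed

lemma frag_eval_swap:
  assumes T: "abelian_group T" and e: "\<And>p q. p \<in> S \<Longrightarrow> q \<in> S' \<Longrightarrow> e p q \<in> carrier T"
    and x: "Poly_Mapping.keys x \<subseteq> S" and y: "Poly_Mapping.keys y \<subseteq> S'"
  shows "frag_eval T (\<lambda>p. frag_eval T (e p) y) x = frag_eval T (\<lambda>q. frag_eval T (\<lambda>p. e p q) x) y"
  using x
proof (induction x rule: free_Abelian_group_induct[consumes 1, case_names zero diff one])
  interpret abelian_group T by fact
  have cy: "frag_eval T (e p) y \<in> carrier T" if "p \<in> S" for p
    by (rule frag_eval_closed[OF T _ y]) (use e that in blast)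
  have cx: "frag_eval T (\<lambda>p. e p q) x \<in> carrier T" if "q \<in> S'" "Poly_Mapping.keys x \<subseteq> S" for q x
    by (rule frag_eval_closed[OF T _ that(2)]) (use e that in blast)
  {
    case zero
    show ?case by (simp add: frag_eval_def)
  next
    case (diff x x')
    have kd: "Poly_Mapping.keys (x - x') \<subseteq> S" using diff(1,2) keys_diff[of x x'] by blast
    have "frag_eval T (\<lambda>q. frag_eval T (\<lambda>p. e p q) (x - x')) y =
        frag_eval T (\<lambda>q. frag_eval T (\<lambda>p. e p q) x \<ominus>\<^bsub>T\<^esub> frag_eval T (\<lambda>p. e p q) x') y"
      by (rule frag_eval_cong[OF _ y T])
        (use diff e cx in \<open>auto simp: frag_eval_diff[where S=S and e="\<lambda>p. e p q" for q, OF T]\<close>)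
    also have "frag_eval T (\<lambda>q. frag_eval T (\<lambda>p. e p q) x \<ominus>\<^bsub>T\<^esub> frag_eval T (\<lambda>p. e p q) x') y \<oplus>\<^bsub>T\<^esub>
          frag_eval T (\<lambda>q. frag_eval T (\<lambda>p. e p q) x') y =
        frag_eval T (\<lambda>q. frag_eval T (\<lambda>p. e p q) x \<ominus>\<^bsub>T\<^esub> frag_eval T (\<lambda>p. e p q) x' \<oplus>\<^bsub>T\<^esub> frag_eval T (\<lambda>p. e p q) x') y"
      by (rule frag_eval_addf[OF T _ _ y, symmetric]) (use diff cx in auto)
    also have "\<dots> = frag_eval T (\<lambda>q. frag_eval T (\<lambda>p. e p q) x) y"
      by (rule frag_eval_cong[OF _ y T]) (use diff cx in \<open>auto simp: minus_eq a_assoc l_neg\<close>)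
    finally have "frag_eval T (\<lambda>q. frag_eval T (\<lambda>p. e p q) (x - x')) y =
        frag_eval T (\<lambda>q. frag_eval T (\<lambda>p. e p q) x) y \<ominus>\<^bsub>T\<^esub> frag_eval T (\<lambda>q. frag_eval T (\<lambda>p. e p q) x') y"
      using diff cx cx[OF _ kd] y T by (intro eq_diffI) (auto intro!: frag_eval_closed[where S=S'])
    then show ?case
      using diff by (simp add: frag_eval_diff[where S=S, OF T cy])
  next
    case (one p)
    have "frag_eval T (\<lambda>q. frag_eval T (\<lambda>p. e p q) (frag_of p)) y = frag_eval T (e p) y"
      by (rule frag_eval_cong[OF _ y T]) (use one e in \<open>auto simp: frag_eval_frag_of[OF T]\<close>)
    then show ?case using one cy by (simp add: frag_eval_frag_of[OF T])
  }
qed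

definition bilinear ::
  "('k, 'r) ring_scheme \<Rightarrow> ('k, 'v, 'e) module_scheme \<Rightarrow> ('k, 'w, 'f) module_scheme \<Rightarrow>
   ('k, 't, 'g) module_scheme \<Rightarrow> ('v \<Rightarrow> 'w \<Rightarrow> 't) \<Rightarrow> bool" where
  "bilinear K V W T E \<longleftrightarrow> (\<forall>v\<in>carrier V. E v \<in> linear_maps K W T) \<and>
     (\<forall>w\<in>carrier W. (\<lambda>v. E v w) \<in> linear_maps K V T)"

lemma bilinear_closed: "bilinear K V W T E \<Longrightarrow> v \<in> carrier V \<Longrightarrow> w \<in> carrier W \<Longrightarrow> E v w \<in> carrier T"
  unfolding bilinear_def by (blast intro: linear_maps_closed)

lemma module_abelian: "module K T \<Longrightarrow> abelian_group T"
  by (simp add: module_def)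

text \<open>
  The universal property of the tensor product: evaluation at a bilinear \<open>E\<close> kills the relators, hence
  the subgroup they generate.
\<close>

lemma frag_eval_coset:
  assumes V: "module K V" and W: "module K W" and T: "module K T" and E: "bilinear K V W T E"
    and t: "t \<in> carrier (tensor K V W)" and x: "x \<in> t" and y: "y \<in> t"
  shows "frag_eval T (\<lambda>p. E (fst p) (snd p)) x = frag_eval T (\<lambda>p. E (fst p) (snd p)) y"
proof -
  interpret V: module K V by fact
  interpret W: module K W by fact
  interpret T: module K T by fact
  let ?S = "carrier V \<times> carrier W" and ?ev = "frag_eval T (\<lambda>p. E (fst p) (snd p))"
  note T' = module_abelian[OF T]
  have E': "E (fst p) (snd p) \<in> carrier T" if "p \<in> ?S" for p using bilinear_closed[OF E] that by auto
  have E'': "E v w \<in> carrier T" if "v \<in> carrier V" "w \<in> carrier W" for v w using bilinear_closed[OF E] that by auto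
  note diff = frag_eval_diff[where S="?S" and e="\<lambda>p. E (fst p) (snd p)", OF T' E']
  note add = frag_eval_add[where S="?S" and e="\<lambda>p. E (fst p) (snd p)", OF T' E']
  note cl = frag_eval_closed[where S="?S" and e="\<lambda>p. E (fst p) (snd p)", OF T' E']
  have of: "?ev (frag_of (v, w)) = E v w" if "v \<in> carrier V" "w \<in> carrier W" for v w
    using frag_eval_frag_of[OF T', of "\<lambda>p. E (fst p) (snd p)" "(v, w)"] E'' that by simp
  have k2: "Poly_Mapping.keys (frag_of p - frag_of q) \<subseteq> ?S" if "p \<in> ?S" "q \<in> ?S" for p q
    using that keys_diff[of "frag_of p" "frag_of q"] by auto
  have rel: "?ev z = \<zero>\<^bsub>T\<^esub>" if "z \<in> tensor_relators K V W" for z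
    using that
  proof (cases rule: tensor_relatorsE)
    case (left v v' w)
    have "E (v \<oplus>\<^bsub>V\<^esub> v') w = E v w \<oplus>\<^bsub>T\<^esub> E v' w"
      using linear_maps_add[of "\<lambda>v. E v w" K V T v v'] E left unfolding bilinear_def by auto
    then show ?thesis using left E''
      by (simp add: diff k2 of) (simp add: T.minus_eq T.a_ac T.r_neg T.r_neg1 T.r_neg2)
  next
    case (right v w w')
    have "E v (w \<oplus>\<^bsub>W\<^esub> w') = E v w \<oplus>\<^bsub>T\<^esub> E v w'"
      using linear_maps_add[of "E v" K W T w w'] E right unfolding bilinear_def by auto
    then show ?thesis using right E''
      by (simp add: diff k2 of) (simp add: T.minus_eq T.a_ac T.r_neg T.r_neg1 T.r_neg2)
  next
    case (scalar b v w)
    have "E (b \<odot>\<^bsub>V\<^esub> v) w = b \<odot>\<^bsub>T\<^esub> E v w" "E v (b \<odot>\<^bsub>W\<^esub> w) = b \<odot>\<^bsub>T\<^esub> E v w"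
      using linear_maps_smult[of "\<lambda>v. E v w" K V T b v] linear_maps_smult[of "E v" K W T b w] E scalar
      unfolding bilinear_def by auto
    then show ?thesis using scalar E''
      by (simp add: diff k2 of) (simp add: T.minus_eq T.r_neg)
  qed
  have null: "?ev z = \<zero>\<^bsub>T\<^esub>" if "z \<in> tensor_null K V W" for z
    using that unfolding tensor_null_def
  proof (induction rule: generate.induct)
    case one then show ?case by (simp add: frag_eval_def)
  next
    case (incl h) then show ?case by (rule rel)
  next
    case (inv h)
    have k: "Poly_Mapping.keys h \<subseteq> ?S" using relators_closed[OF V W inv] .
    have "?ev 0 = \<zero>\<^bsub>T\<^esub>" by (simp add: frag_eval_def)
    moreover have "?ev (0 - h) = ?ev 0 \<ominus>\<^bsub>T\<^esub> ?ev h" by (rule diff) (use k in auto)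
    ultimately have "?ev (0 - h) = \<zero>\<^bsub>T\<^esub>" using rel[OF inv] by (simp add: T.minus_eq T.r_neg)
    then show ?case using k by simp
  next
    case (eng h1 h2)
    have "Poly_Mapping.keys h1 \<subseteq> ?S" "Poly_Mapping.keys h2 \<subseteq> ?S"
      using eng(1,2) null_closed[OF V W] unfolding tensor_null_def by blast+
    then show ?case using eng by (simp add: add)
  qed
  have kx: "Poly_Mapping.keys x \<subseteq> ?S" and ky: "Poly_Mapping.keys y \<subseteq> ?S" and "x - y \<in> tensor_null K V W"
    using mem_tensor_keys[OF V W t x] mem_tensor_keys[OF V W t y] x mem_cls[OF V W] by auto
  then have "?ev x \<ominus>\<^bsub>T\<^esub> ?ev y = \<zero>\<^bsub>T\<^esub>" using null[of "x - y"] diff[OF _ kx ky] by simp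
  then show ?thesis using cl[OF _ kx] cl[OF _ ky] by (rule T.diff_zeroD) auto
qed

text \<open>
  As a congruence rule this hands the simplifier the memberships of the bound variables.  The spaces
  are rewritten too, so that these memberships arrive in normal form.
\<close>

lemma sweedler_cong [cong]:
  assumes "V = V'" "W = W'" "T = T'" "t = t'"
    "\<And>v w. v \<in> carrier V' \<Longrightarrow> w \<in> carrier W' \<Longrightarrow> E v w = E' v w"
  shows "sweedler V W T t E = sweedler V' W' T' t' E'"
proof -
  have "(\<lambda>p \<in> carrier V' \<times> carrier W'. E (fst p) (snd p)) = (\<lambda>p \<in> carrier V' \<times> carrier W'. E' (fst p) (snd p))"
    using assms(5) by (auto simp: restrict_def)
  then show ?thesis unfolding sweedler_def using assms(1-4) by simp
qed

context cring
begin

lemma some_representative: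
  assumes "module R V" "module R W" "t \<in> carrier (tensor R V W)"
  shows "(SOME x. x \<in> t) \<in> t"
  using tensor_cases[OF assms] cls_self[OF assms(1,2)] by (metis someI)

lemma some_representative_keys:
  assumes "module R V" "module R W" "t \<in> carrier (tensor R V W)"
  shows "Poly_Mapping.keys (SOME x. x \<in> t) \<subseteq> carrier V \<times> carrier W"
  using mem_tensor_keys(1)[OF assms some_representative[OF assms]] .

lemma sweedler_unrestricted:
  assumes V: "module R V" and W: "module R W" and T: "module R T" and t: "t \<in> carrier (tensor R V W)"
    and E: "\<And>v w. v \<in> carrier V \<Longrightarrow> w \<in> carrier W \<Longrightarrow> E v w \<in> carrier T"
  shows "sweedler V W T t E = frag_eval T (\<lambda>p. E (fst p) (snd p)) (SOME x. x \<in> t)"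
  unfolding sweedler_def
  by (rule frag_eval_cong[OF _ some_representative_keys[OF V W t] module_abelian[OF T]]) (auto intro: E)

lemma sweedler_closed:
  assumes V: "module R V" and W: "module R W" and T: "module R T" and t: "t \<in> carrier (tensor R V W)"
    and E: "\<And>v w. v \<in> carrier V \<Longrightarrow> w \<in> carrier W \<Longrightarrow> E v w \<in> carrier T"
  shows "sweedler V W T t E \<in> carrier T"
proof -
  have "sweedler V W T t E = frag_eval T (\<lambda>p. E (fst p) (snd p)) (SOME x. x \<in> t)"
    by (rule sweedler_unrestricted[OF V W T t]) (rule E)
  also have "\<dots> \<in> carrier T"
    by (rule frag_eval_closed[OF module_abelian[OF T] _ some_representative_keys[OF V W t]]) (use E in auto)
  finally show ?thesis .
qed

text \<open>
  The sum runs over one fixed representative, so \<open>h\<close> passes into it term by term.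
\<close>

lemma linear_sweedler:
  assumes h: "h \<in> linear_maps R T T'" and T': "module R T'"
    and V: "module R V" and W: "module R W" and T: "module R T" and t: "t \<in> carrier (tensor R V W)"
    and E: "\<And>v w. v \<in> carrier V \<Longrightarrow> w \<in> carrier W \<Longrightarrow> E v w \<in> carrier T"
  shows "h (sweedler V W T t E) = sweedler V W T' t (\<lambda>v w. h (E v w))"
proof -
  have E': "h (E v w) \<in> carrier T'" if "v \<in> carrier V" "w \<in> carrier W" for v w
    using linear_maps_closed[OF h E] that by blast
  have "sweedler V W T t E = frag_eval T (\<lambda>p. E (fst p) (snd p)) (SOME x. x \<in> t)"
    by (rule sweedler_unrestricted[OF V W T t]) (rule E)
  moreover have "sweedler V W T' t (\<lambda>v w. h (E v w)) = frag_eval T' (\<lambda>p. h (E (fst p) (snd p))) (SOME x. x \<in> t)"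
    by (rule sweedler_unrestricted[OF V W T' t]) (rule E')
  moreover have "h (frag_eval T (\<lambda>p. E (fst p) (snd p)) (SOME x. x \<in> t)) = frag_eval T' (\<lambda>p. h (E (fst p) (snd p))) (SOME x. x \<in> t)"
    by (rule frag_eval_hom[OF module_abelian[OF T] module_abelian[OF T'] _ _ _ some_representative_keys[OF V W t]])
      (use linear_maps_closed[OF h] linear_maps_add[OF h] E in auto)
  ultimately show ?thesis by simp
qed

lemma sweedler_linear_body:
  assumes V: "module R V" and W: "module R W" and T: "module R T" and t: "t \<in> carrier (tensor R V W)"
    and U: "module R U"
    and E: "\<And>v w. v \<in> carrier V \<Longrightarrow> w \<in> carrier W \<Longrightarrow> (\<lambda>x. E x v w) \<in> linear_maps R U T"
  shows "(\<lambda>x. sweedler V W T t (E x)) \<in> linear_maps R U T"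
proof (rule linear_mapsI)
  interpret U: module R U by fact
  interpret T: module R T by fact
  let ?x = "SOME x. x \<in> t"
  note k = some_representative_keys[OF V W t]
  have E': "E x v w \<in> carrier T" if "v \<in> carrier V" "w \<in> carrier W" "x \<in> carrier U" for x v w
    using linear_maps_closed[OF E that(3)] that by blast
  have ev: "sweedler V W T t (E x) = frag_eval T (\<lambda>p. E x (fst p) (snd p)) ?x" if "x \<in> carrier U" for x
    by (rule sweedler_unrestricted[OF V W T t]) (use E' that in blast)
  show "sweedler V W T t (E x) \<in> carrier T" if "x \<in> carrier U" for x
    by (rule sweedler_closed[OF V W T t]) (use E' that in blast)
  show "sweedler V W T t (E (x \<oplus>\<^bsub>U\<^esub> y)) = sweedler V W T t (E x) \<oplus>\<^bsub>T\<^esub> sweedler V W T t (E y)"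
    if x: "x \<in> carrier U" and y: "y \<in> carrier U" for x y
  proof -
    have "sweedler V W T t (E (x \<oplus>\<^bsub>U\<^esub> y)) = sweedler V W T t (\<lambda>v w. E x v w \<oplus>\<^bsub>T\<^esub> E y v w)"
      by (rule sweedler_cong[OF refl refl refl refl]) (use linear_maps_add[OF E] x y in auto)
    also have "\<dots> = frag_eval T (\<lambda>p. E x (fst p) (snd p) \<oplus>\<^bsub>T\<^esub> E y (fst p) (snd p)) ?x"
      by (rule sweedler_unrestricted[OF V W T t]) (use E' x y in auto)
    also have "\<dots> = sweedler V W T t (E x) \<oplus>\<^bsub>T\<^esub> sweedler V W T t (E y)"
      using ev[OF x] ev[OF y] frag_eval_addf[OF module_abelian[OF T] _ _ k, of "\<lambda>p. E x (fst p) (snd p)" "\<lambda>p. E y (fst p) (snd p)"] E' x y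
      by (simp add: mem_Times_iff)
    finally show ?thesis .
  qed
  show "sweedler V W T t (E (a \<odot>\<^bsub>U\<^esub> x)) = a \<odot>\<^bsub>T\<^esub> sweedler V W T t (E x)"
    if a: "a \<in> carrier R" and x: "x \<in> carrier U" for a x
  proof -
    have "sweedler V W T t (E (a \<odot>\<^bsub>U\<^esub> x)) = sweedler V W T t (\<lambda>v w. a \<odot>\<^bsub>T\<^esub> E x v w)"
      by (rule sweedler_cong[OF refl refl refl refl]) (use linear_maps_smult[OF E] x a in auto)
    also have "\<dots> = a \<odot>\<^bsub>T\<^esub> sweedler V W T t (E x)"
      by (rule linear_sweedler[where h="\<lambda>z. a \<odot>\<^bsub>T\<^esub> z" and T=T and T'=T, OF _ T V W T t, symmetric])
       (use E' x a in \<open>auto intro!: linear_mapsI simp: T.smult_r_distr m_comm simp flip: T.smult_assoc1\<close>)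
    finally show ?thesis .
  qed
qed

text \<open>
  For bilinear \<open>E\<close> the choice in the definition of \<open>sweedler\<close> becomes immaterial.
\<close>

lemma sweedler_eval:
  assumes V: "module R V" and W: "module R W" and T: "module R T" and E: "bilinear R V W T E"
    and t: "t \<in> carrier (tensor R V W)" and x: "x \<in> t"
  shows "sweedler V W T t E = frag_eval T (\<lambda>p. E (fst p) (snd p)) x"
  using sweedler_unrestricted[OF V W T t bilinear_closed[OF E]]
    frag_eval_coset[OF V W T E t some_representative[OF V W t] x] by simp

lemma sweedler_pure:
  assumes V: "module R V" and W: "module R W" and T: "module R T" and E: "bilinear R V W T E"
    and v: "v \<in> carrier V" and w: "w \<in> carrier W"
  shows "sweedler V W T (pure R V W v w) E = E v w"
proof -
  have "frag_of (v, w) \<in> pure R V W v w"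
    unfolding pure_cls[OF V W] using cls_self[OF V W, of "frag_of (v, w)"] v w by simp
  then show ?thesis
    using sweedler_eval[OF V W T E pure_closed[OF V W v w]]
      frag_eval_frag_of[OF module_abelian[OF T], of "\<lambda>p. E (fst p) (snd p)" "(v, w)"] bilinear_closed[OF E v w] by simp
qed

text \<open>
  The linear map on the tensor product that a bilinear map induces.
\<close>

lemma sweedler_linear:
  assumes V: "module R V" and W: "module R W" and T: "module R T" and E: "bilinear R V W T E"
  shows "(\<lambda>t. sweedler V W T t E) \<in> linear_maps R (tensor R V W) T"
proof (rule linear_mapsI)
  interpret T: module R T by fact
  note cls = cls_add[OF V W] cls_closed[OF V W] cls_smult[OF V W]
  have E': "E v w \<in> carrier T" if "v \<in> carrier V" "w \<in> carrier W" for v w using bilinear_closed[OF E] that by auto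
  have E'': "\<And>p. p \<in> carrier V \<times> carrier W \<Longrightarrow> E (fst p) (snd p) \<in> carrier T" using E' by auto
  note T' = module_abelian[OF T]
  show "sweedler V W T t E \<in> carrier T" if "t \<in> carrier (tensor R V W)" for t
    by (rule sweedler_closed[OF V W T that E'])
  have ev: "sweedler V W T (tensor_class R V W x) E = frag_eval T (\<lambda>p. E (fst p) (snd p)) x"
    if "Poly_Mapping.keys x \<subseteq> carrier V \<times> carrier W" for x
    by (rule sweedler_eval[OF V W T E cls_closed[OF V W that] cls_self[OF V W that]])
  show "sweedler V W T (s \<oplus>\<^bsub>tensor R V W\<^esub> t) E = sweedler V W T s E \<oplus>\<^bsub>T\<^esub> sweedler V W T t E"
    if s: "s \<in> carrier (tensor R V W)" and t: "t \<in> carrier (tensor R V W)" for s t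
  proof -
    obtain x where x: "Poly_Mapping.keys x \<subseteq> carrier V \<times> carrier W" "s = tensor_class R V W x"
      using tensor_cases[OF V W s] .
    obtain y where y: "Poly_Mapping.keys y \<subseteq> carrier V \<times> carrier W" "t = tensor_class R V W y"
      using tensor_cases[OF V W t] .
    have "Poly_Mapping.keys (x + y) \<subseteq> carrier V \<times> carrier W" using x y keys_add[of x y] by blast
    then show ?thesis using x y
      by (simp add: cls ev frag_eval_add[OF T' _ x(1) y(1), of "\<lambda>p. E (fst p) (snd p)"] E'')
  qed
  show "sweedler V W T (a \<odot>\<^bsub>tensor R V W\<^esub> t) E = a \<odot>\<^bsub>T\<^esub> sweedler V W T t E"
    if a: "a \<in> carrier R" and t: "t \<in> carrier (tensor R V W)" for a t
  proof -
    obtain x where x: "Poly_Mapping.keys x \<subseteq> carrier V \<times> carrier W" "t = tensor_class R V W x"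
      using tensor_cases[OF V W t] .
    have "frag_eval T (\<lambda>p. E (fst p) (snd p)) (tensor_scale V a x) = a \<odot>\<^bsub>T\<^esub> frag_eval T (\<lambda>p. E (fst p) (snd p)) x"
      using x(1)
    proof (induction x rule: free_Abelian_group_induct[consumes 1, case_names zero diff one])
      case zero show ?case using T.smult_r_null[OF a] by (simp add: frag_eval_def scale_0[OF V W])
    next
      case (diff x y)
      note k = scale_keys[OF V W a diff(1)] scale_keys[OF V W a diff(2)]
      have [simp]: "frag_eval T (\<lambda>p. E (fst p) (snd p)) x \<in> carrier T" "frag_eval T (\<lambda>p. E (fst p) (snd p)) y \<in> carrier T"
        using frag_eval_closed[where S="carrier V \<times> carrier W" and e="\<lambda>p. E (fst p) (snd p)", OF T' E''] diff by auto
      have "a \<odot>\<^bsub>T\<^esub> (p \<ominus>\<^bsub>T\<^esub> q) = a \<odot>\<^bsub>T\<^esub> p \<ominus>\<^bsub>T\<^esub> a \<odot>\<^bsub>T\<^esub> q" if "p \<in> carrier T" "q \<in> carrier T" for p q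
        using that a by (simp add: T.minus_eq T.smult_r_distr T.smult_r_minus)
      then show ?case using diff
          frag_eval_diff[OF T' _ k, of "\<lambda>p. E (fst p) (snd p)"]
          frag_eval_diff[OF T' _ diff(1,2), of "\<lambda>p. E (fst p) (snd p)"] E''
        by (simp add: scale_diff[OF V W])
    next
      case (one p)
      obtain v w where p: "p = (v, w)" "v \<in> carrier V" "w \<in> carrier W" using one by auto
      interpret V: module R V by fact
      have "E (a \<odot>\<^bsub>V\<^esub> v) w = a \<odot>\<^bsub>T\<^esub> E v w"
        using linear_maps_smult[of "\<lambda>v. E v w" R V T a v] E p a unfolding bilinear_def by auto
      then show ?case using p a
          frag_eval_frag_of[OF T', of "\<lambda>p. E (fst p) (snd p)" "(v, w)"] 
          frag_eval_frag_of[OF T', of "\<lambda>p. E (fst p) (snd p)" "(a \<odot>\<^bsub>V\<^esub> v, w)"] E' 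
        by (simp add: scale_frag_of[OF V W])
    qed
    then show ?thesis using x a by (simp add: cls ev scale_keys[OF V W])
  qed
qed

lemma sweedler_swap:
  assumes V: "module R V" and W: "module R W" and T: "module R T" and t: "t \<in> carrier (tensor R V W)"
    and V': "module R V'" and W': "module R W'" and s: "s \<in> carrier (tensor R V' W')"
    and E: "\<And>v w v' w'. v \<in> carrier V \<Longrightarrow> w \<in> carrier W \<Longrightarrow> v' \<in> carrier V' \<Longrightarrow> w' \<in> carrier W' \<Longrightarrow>
      E v w v' w' \<in> carrier T"
  shows "sweedler V W T t (\<lambda>v w. sweedler V' W' T s (E v w)) =
    sweedler V' W' T s (\<lambda>v' w'. sweedler V W T t (\<lambda>v w. E v w v' w'))"
proof -
  let ?x = "SOME x. x \<in> t" and ?y = "SOME x. x \<in> s"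
  note k = some_representative_keys[OF V W t] some_representative_keys[OF V' W' s]
  let ?e = "\<lambda>p q. E (fst p) (snd p) (fst q) (snd q)"
  have e: "?e p q \<in> carrier T" if "p \<in> carrier V \<times> carrier W" "q \<in> carrier V' \<times> carrier W'" for p q
    using that E by auto
  have "sweedler V W T t (\<lambda>v w. sweedler V' W' T s (E v w)) = frag_eval T (\<lambda>p. frag_eval T (?e p) ?y) ?x"
  proof (subst sweedler_unrestricted[OF V W T t])
    show "sweedler V' W' T s (E v w) \<in> carrier T" if "v \<in> carrier V" "w \<in> carrier W" for v w
      by (rule sweedler_closed[OF V' W' T s]) (use E that in blast)
    show "frag_eval T (\<lambda>p. sweedler V' W' T s (E (fst p) (snd p))) ?x = frag_eval T (\<lambda>p. frag_eval T (?e p) ?y) ?x"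
      by (rule frag_eval_cong[OF _ k(1) module_abelian[OF T]])
       (use E e in \<open>auto simp: sweedler_unrestricted[OF V' W' T s] intro!: frag_eval_closed[OF module_abelian[OF T] _ k(2)]\<close>)
  qed
  also have "\<dots> = frag_eval T (\<lambda>q. frag_eval T (\<lambda>p. ?e p q) ?x) ?y"
    by (rule frag_eval_swap[OF module_abelian[OF T] e k])
  also have "\<dots> = sweedler V' W' T s (\<lambda>v' w'. sweedler V W T t (\<lambda>v w. E v w v' w'))"
  proof (subst sweedler_unrestricted[OF V' W' T s])
    show "sweedler V W T t (\<lambda>v w. E v w v' w') \<in> carrier T" if "v' \<in> carrier V'" "w' \<in> carrier W'" for v' w'
      by (rule sweedler_closed[OF V W T t]) (use E that in blast)
    show "frag_eval T (\<lambda>q. frag_eval T (\<lambda>p. ?e p q) ?x) ?y = frag_eval T (\<lambda>q. sweedler V W T t (\<lambda>v w. E v w (fst q) (snd q))) ?y"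
      by (rule frag_eval_cong[OF _ k(2) module_abelian[OF T], symmetric])
       (use E e in \<open>auto simp: sweedler_unrestricted[OF V W T t] intro!: frag_eval_closed[OF module_abelian[OF T] _ k(1)]\<close>)
  qed
  finally show ?thesis .
qed

lemma pure_bilinear:
  assumes "module R V" "module R W"
  shows "bilinear R V W (tensor R V W) (pure R V W)"
  unfolding bilinear_def using pure_linear_left[OF assms] pure_linear_right[OF assms] by blast

lemma sweedler_ident:
  assumes V: "module R V" and W: "module R W" and t: "t \<in> carrier (tensor R V W)"
  shows "sweedler V W (tensor R V W) t (pure R V W) = t"
proof -
  note T = module_tensor[OF V W]
  interpret T: module R "tensor R V W" by fact
  have "frag_eval (tensor R V W) (\<lambda>p. pure R V W (fst p) (snd p)) x = tensor_class R V W x"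
    if "Poly_Mapping.keys x \<subseteq> carrier V \<times> carrier W" for x
    using that
  proof (induction x rule: free_Abelian_group_induct[consumes 1, case_names zero diff one])
    case zero show ?case by (simp add: frag_eval_def cls_zero[OF V W])
  next
    case (diff x y)
    have k: "Poly_Mapping.keys (x - y) \<subseteq> carrier V \<times> carrier W" using diff keys_diff[of x y] by blast
    have "tensor_class R V W (x - y) = tensor_class R V W x \<ominus>\<^bsub>tensor R V W\<^esub> tensor_class R V W y"
      by (rule T.eq_diffI) (use diff k in \<open>simp_all add: cls_add[OF V W] cls_closed[OF V W]\<close>)
    with diff show ?case
      using frag_eval_diff[OF module_abelian[OF T] _ diff(1,2), of "\<lambda>p. pure R V W (fst p) (snd p)"] pure_closed[OF V W]
      by (simp add: mem_Times_iff)
  next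
    case (one p)
    then show ?case using pure_closed[OF V W] by (cases p) (simp add: frag_eval_frag_of[OF module_abelian[OF T]] pure_cls[OF V W])
  qed
  moreover obtain x where x: "Poly_Mapping.keys x \<subseteq> carrier V \<times> carrier W" "t = tensor_class R V W x"
    using tensor_cases[OF V W t] .
  ultimately show ?thesis
    using sweedler_eval[OF V W T pure_bilinear[OF V W] t, of x] cls_self[OF V W x(1)] by simp
qed

text \<open>
  The summand \<open>E'\<close> is separate from \<open>E\<close> so that nested sums are translated together: in applications
  \<open>E\<close> contains \<open>tsum\<close> and \<open>E'\<close> contains \<open>sweedler\<close>, and the premise \<open>eq\<close> is the same problem one level
  further in.
\<close>

lemma tsum_eq_sweedler:
  assumes V: "module R V" and W: "module R W" and T: "module R T" and t: "t \<in> carrier (tensor R V W)"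
    and E: "bilinear R V W T E'" and eq: "\<And>v w. v \<in> carrier V \<Longrightarrow> w \<in> carrier W \<Longrightarrow> E v w = E' v w"
  shows "tsum T t E = sweedler V W T t E'"
proof -
  let ?f = "\<lambda>E x. \<Oplus>\<^bsub>T\<^esub> p \<in> Poly_Mapping.keys x. add_pow T (Poly_Mapping.lookup x p) (E (fst p) (snd p))"
  have "?f E x = sweedler V W T t E'" if "x \<in> t" for x
  proof -
    have k: "Poly_Mapping.keys x \<subseteq> carrier V \<times> carrier W" using mem_tensor_keys[OF V W t that] by blast
    have "?f E x = frag_eval T (\<lambda>p. E (fst p) (snd p)) x" by (simp add: frag_eval_def)
    also have "\<dots> = frag_eval T (\<lambda>p. E' (fst p) (snd p)) x"
      by (rule frag_eval_cong[OF _ k module_abelian[OF T]]) (use eq bilinear_closed[OF E] in auto)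
    finally show ?thesis using sweedler_eval[OF V W T E t that] by simp
  qed
  then have "?f E ` t = {sweedler V W T t E'}" using some_representative[OF V W t] by (auto simp: image_iff)
  then show ?thesis unfolding tsum_def by (metis the_elem_eq)
qed

end

section \<open>Transport into the universe\<close>

context
  fixes T :: "('k, 'a) module" and u :: "'u itself"
  assumes inj: "inj_on (encode T :: 'a \<Rightarrow> 'u) (carrier T)"
begin

lemma decode_encode: "x \<in> carrier T \<Longrightarrow> decode T (encode T x :: 'u) = x"
  unfolding decode_def using inj by (rule inv_into_f_f)

lemma decode_closed: "(y :: 'u) \<in> carrier (transport T) \<Longrightarrow> decode T y \<in> carrier T"
  unfolding decode_def transport_def by (auto intro: inv_into_into)

lemma encode_decode: "(y :: 'u) \<in> carrier (transport T) \<Longrightarrow> encode T (decode T y) = y"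
  unfolding decode_def transport_def by (auto simp: f_inv_into_f)

lemma module_transport:
  assumes T: "module K T"
  shows "module K (transport T :: ('k, 'u) module)"
proof -
  interpret T: module K T by fact
  let ?U = "transport T :: ('k, 'u) module"
  have add: "x \<oplus>\<^bsub>?U\<^esub> y = encode T (decode T x \<oplus>\<^bsub>T\<^esub> decode T y)" for x y by (simp add: transport_def)
  have smult: "a \<odot>\<^bsub>?U\<^esub> y = encode T (a \<odot>\<^bsub>T\<^esub> decode T y)" for a y by (simp add: transport_def)
  have zero: "\<zero>\<^bsub>?U\<^esub> = encode T \<zero>\<^bsub>T\<^esub>" by (simp add: transport_def)
  have closed: "x \<in> carrier T \<Longrightarrow> encode T x \<in> carrier ?U" for x by (simp add: transport_def)
  note [simp] = decode_encode closed decode_closed add smult zero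
  show ?thesis
  proof (rule moduleI)
    show "abelian_group ?U"
    proof (rule abelian_groupI)
      fix x assume x: "x \<in> carrier ?U"
      show "\<zero>\<^bsub>?U\<^esub> \<oplus>\<^bsub>?U\<^esub> x = x" using x by (simp add: encode_decode)
      show "\<exists>y\<in>carrier ?U. y \<oplus>\<^bsub>?U\<^esub> x = \<zero>\<^bsub>?U\<^esub>"
        using x by (intro bexI[of _ "encode T (\<ominus>\<^bsub>T\<^esub> decode T x)"]) (simp_all add: T.l_neg)
    qed (simp_all add: T.a_ac)
  qed (simp_all add: T.smult_l_distr T.smult_r_distr T.smult_assoc1 encode_decode T.R.is_cring)
qed

lemma encode_linear:
  assumes T: "module K T"
  shows "encode T \<in> linear_maps K T (transport T :: ('k, 'u) module)"
proof -
  interpret T: module K T by fact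
  show ?thesis by (rule linear_mapsI) (simp_all add: transport_def decode_encode)
qed

lemma decode_linear:
  assumes T: "module K T"
  shows "decode T \<in> linear_maps K (transport T :: ('k, 'u) module) T"
proof -
  interpret T: module K T by fact
  show ?thesis
    by (rule linear_mapsI) (simp_all add: decode_closed, simp_all add: transport_def decode_encode decode_closed[unfolded transport_def, simplified])
qed

end

lemma encode_closed: "x \<in> carrier T \<Longrightarrow> encode T x \<in> carrier (transport T)"
  by (simp add: transport_def)

lemma inj_on_encode:
  assumes "carrier T \<lesssim> (UNIV :: 'u set)"
  shows "inj_on (encode T :: 'a \<Rightarrow> 'u) (carrier T)"
proof -
  have "\<exists>i :: 'a \<Rightarrow> 'u. inj_on i (carrier T)" using assms unfolding lepoll_def by blast
  then show ?thesis unfolding encode_def by (rule someI_ex)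
qed

text \<open>
  A tensor is the class of a formal sum over \<open>V \<times> W\<close>, and the free abelian group on an infinite set has
  the cardinality of the set.
\<close>

lemma tensor_lepoll:
  fixes V :: "('k, 'u, 'e) module_scheme" and W :: "('k, 'w, 'f) module_scheme"
  assumes V: "module K V" and W: "module K W"
    and inf: "infinite (UNIV :: 'u set)" and le: "carrier W \<lesssim> (UNIV :: 'u set)"
  shows "carrier (tensor K V W) \<lesssim> (UNIV :: 'u set)"
proof -
  interpret W: module K W by fact
  let ?A = "(UNIV :: 'u set) \<times> carrier W"
  have W0: "carrier W \<noteq> {}" using W.zero_closed by blast
  then have A: "infinite ?A" using inf by (simp add: finite_cartesian_product_iff)
  have "carrier (tensor K V W) \<lesssim> {x :: 'u \<times> 'w \<Rightarrow>\<^sub>0 int. Poly_Mapping.keys x \<subseteq> carrier V \<times> carrier W}"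
    unfolding carrier_tensor[OF V W] by (rule image_lepoll)
  also have "\<dots> \<lesssim> carrier (free_Abelian_group ?A)"
    by (rule subset_imp_lepoll) auto
  also have "\<dots> \<approx> ?A" by (rule eqpoll_free_Abelian_group_infinite[OF A])
  also have "?A \<lesssim> (UNIV :: 'u set) \<times> (UNIV :: 'u set)" by (rule times_lepoll_mono) (use le in auto)
  also have "\<dots> \<approx> (UNIV :: 'u set)"
    using card_of_Times_same_infinite[OF inf] by (simp only: eqpoll_iff_card_of_ordIso)
  finally show ?thesis .
qed

section \<open>Adjunctions through unit and counit\<close>

text \<open>
  The bijection of hom-sets sends \<open>g\<close> to \<open>G(g) \<circ> u\<close>; its inverse sends \<open>h\<close> to \<open>e \<circ> F(h)\<close>.
\<close>

lemma left_adjoint_of_unit_counit: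
  assumes F: "cat_functor A B F" and G: "cat_functor B A G"
    and u: "\<And>X. X \<in> Ob A \<Longrightarrow> u X \<in> Arr A X (on_ob G (on_ob F X))"
    and e: "\<And>Y. Y \<in> Ob B \<Longrightarrow> e Y \<in> Arr B (on_ob F (on_ob G Y)) Y"
    and u_nat: "\<And>X X' f. \<lbrakk>X \<in> Ob A; X' \<in> Ob A; f \<in> Arr A X X'\<rbrakk> \<Longrightarrow>
      Comp A X X' (on_ob G (on_ob F X')) (u X') f =
      Comp A X (on_ob G (on_ob F X)) (on_ob G (on_ob F X')) (on_arr G (on_ob F X) (on_ob F X') (on_arr F X X' f)) (u X)"
    and e_nat: "\<And>Y Y' g. \<lbrakk>Y \<in> Ob B; Y' \<in> Ob B; g \<in> Arr B Y Y'\<rbrakk> \<Longrightarrow>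
      Comp B (on_ob F (on_ob G Y)) (on_ob F (on_ob G Y')) Y' (e Y') (on_arr F (on_ob G Y) (on_ob G Y') (on_arr G Y Y' g)) =
      Comp B (on_ob F (on_ob G Y)) Y Y' g (e Y)"
    and FuF: "\<And>X. X \<in> Ob A \<Longrightarrow>
      Comp B (on_ob F X) (on_ob F (on_ob G (on_ob F X))) (on_ob F X) (e (on_ob F X)) (on_arr F X (on_ob G (on_ob F X)) (u X)) =
      Ident B (on_ob F X)"
    and uGe: "\<And>Y. Y \<in> Ob B \<Longrightarrow>
      Comp A (on_ob G Y) (on_ob G (on_ob F (on_ob G Y))) (on_ob G Y) (on_arr G (on_ob F (on_ob G Y)) Y (e Y)) (u (on_ob G Y)) =
      Ident A (on_ob G Y)"
  shows "left_adjoint A B F G"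
proof -
  interpret F: cat_functor A B F by fact
  interpret G: cat_functor B A G by fact
  note [simp] = F.on_ob_Ob G.on_ob_Ob F.on_arr_Arr G.on_arr_Arr u e F.source.Comp_Arr F.target.Comp_Arr
    F.on_arr_Comp G.on_arr_Comp F.source.Ident_Arr F.target.Ident_Arr
    F.target.Comp_Ident_left F.source.Comp_Ident_left F.target.Comp_Ident_right F.source.Comp_Ident_right
  define \<Phi> where "\<Phi> X Y g = Comp A X (on_ob G (on_ob F X)) (on_ob G Y) (on_arr G (on_ob F X) Y g) (u X)" for X Y g
  define \<Psi> where "\<Psi> X Y h = Comp B (on_ob F X) (on_ob F (on_ob G Y)) Y (e Y) (on_arr F X (on_ob G Y) h)" for X Y h
  have "bij_betw (\<Phi> X Y) (Arr B (on_ob F X) Y) (Arr A X (on_ob G Y))" if X: "X \<in> Ob A" and Y: "Y \<in> Ob B" for X Y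
  proof (rule bij_betw_byWitness[where f' = "\<Psi> X Y"])
    show "\<forall>g\<in>Arr B (on_ob F X) Y. \<Psi> X Y (\<Phi> X Y g) = g"
    proof
      fix g assume g: "g \<in> Arr B (on_ob F X) Y"
      have "\<Psi> X Y (\<Phi> X Y g) =
        Comp B (on_ob F X) (on_ob F (on_ob G (on_ob F X))) Y
          (Comp B (on_ob F (on_ob G (on_ob F X))) (on_ob F (on_ob G Y)) Y (e Y)
            (on_arr F (on_ob G (on_ob F X)) (on_ob G Y) (on_arr G (on_ob F X) Y g)))
          (on_arr F X (on_ob G (on_ob F X)) (u X))"
        unfolding \<Phi>_def \<Psi>_def using X Y g by (simp add: F.target.Comp_assoc)
      also have "\<dots> = Comp B (on_ob F X) (on_ob F X) Y g
         (Comp B (on_ob F X) (on_ob F (on_ob G (on_ob F X))) (on_ob F X) (e (on_ob F X)) (on_arr F X (on_ob G (on_ob F X)) (u X)))"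
        using X Y g by (simp only: e_nat[OF F.on_ob_Ob[OF X] Y g]) (simp add: F.target.Comp_assoc)
      also have "\<dots> = g" using X Y g by (simp add: FuF)
      finally show "\<Psi> X Y (\<Phi> X Y g) = g" .
    qed
    show "\<forall>h\<in>Arr A X (on_ob G Y). \<Phi> X Y (\<Psi> X Y h) = h"
    proof
      fix h assume h: "h \<in> Arr A X (on_ob G Y)"
      have "\<Phi> X Y (\<Psi> X Y h) =
        Comp A X (on_ob G (on_ob F (on_ob G Y))) (on_ob G Y) (on_arr G (on_ob F (on_ob G Y)) Y (e Y))
          (Comp A X (on_ob G (on_ob F X)) (on_ob G (on_ob F (on_ob G Y)))
            (on_arr G (on_ob F X) (on_ob F (on_ob G Y)) (on_arr F X (on_ob G Y) h)) (u X))"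
        unfolding \<Phi>_def \<Psi>_def using X Y h by (simp add: F.source.Comp_assoc)
      also have "\<dots> = Comp A X (on_ob G Y) (on_ob G Y) 
         (Comp A (on_ob G Y) (on_ob G (on_ob F (on_ob G Y))) (on_ob G Y) (on_arr G (on_ob F (on_ob G Y)) Y (e Y)) (u (on_ob G Y))) h"
        using X Y h by (simp only: u_nat[OF X G.on_ob_Ob[OF Y] h, symmetric]) (simp add: F.source.Comp_assoc)
      also have "\<dots> = h" using X Y h by (simp add: uGe)
      finally show "\<Phi> X Y (\<Psi> X Y h) = h" .
    qed
    show "\<Phi> X Y ` Arr B (on_ob F X) Y \<subseteq> Arr A X (on_ob G Y)" unfolding \<Phi>_def using X Y by auto
    show "\<Psi> X Y ` Arr A X (on_ob G Y) \<subseteq> Arr B (on_ob F X) Y" unfolding \<Psi>_def using X Y by auto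
  qed
  moreover have "\<Phi> X' Y' (Comp B (on_ob F X') Y Y' v (Comp B (on_ob F X') (on_ob F X) Y g (on_arr F X' X f))) =
      Comp A X' (on_ob G Y) (on_ob G Y') (on_arr G Y Y' v) (Comp A X' X (on_ob G Y) (\<Phi> X Y g) f)"
    if "X \<in> Ob A" "X' \<in> Ob A" "Y \<in> Ob B" "Y' \<in> Ob B" "f \<in> Arr A X' X" "v \<in> Arr B Y Y'" "g \<in> Arr B (on_ob F X) Y"
    for X X' Y Y' f v g
  proof -
    have "Comp A X' X (on_ob G Y) (\<Phi> X Y g) f = Comp A X' (on_ob G (on_ob F X)) (on_ob G Y) (on_arr G (on_ob F X) Y g)
      (Comp A X' X (on_ob G (on_ob F X)) (u X) f)"
      unfolding \<Phi>_def using that by (simp add: F.source.Comp_assoc)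
    then show ?thesis unfolding \<Phi>_def using that by (simp add: u_nat) (simp add: F.source.Comp_assoc)
  qed
  ultimately show ?thesis unfolding left_adjoint_def using F G by blast
qed

text \<open>
  The unit and the counit correspond to identity arrows under the bijection of hom-sets; each required
  equation between arrows out of some \<open>F(X)\<close> is proved by applying that bijection to both sides.
\<close>

lemma unit_counit_of_left_adjoint:
  assumes "left_adjoint A B F G"
  obtains u e where
    "\<And>X. X \<in> Ob A \<Longrightarrow> u X \<in> Arr A X (on_ob G (on_ob F X))"
    "\<And>Y. Y \<in> Ob B \<Longrightarrow> e Y \<in> Arr B (on_ob F (on_ob G Y)) Y"
    "\<And>X X' f. \<lbrakk>X \<in> Ob A; X' \<in> Ob A; f \<in> Arr A X X'\<rbrakk> \<Longrightarrow>
      Comp A X X' (on_ob G (on_ob F X')) (u X') f =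
      Comp A X (on_ob G (on_ob F X)) (on_ob G (on_ob F X')) (on_arr G (on_ob F X) (on_ob F X') (on_arr F X X' f)) (u X)"
    "\<And>Y Y' g. \<lbrakk>Y \<in> Ob B; Y' \<in> Ob B; g \<in> Arr B Y Y'\<rbrakk> \<Longrightarrow>
      Comp B (on_ob F (on_ob G Y)) (on_ob F (on_ob G Y')) Y' (e Y') (on_arr F (on_ob G Y) (on_ob G Y') (on_arr G Y Y' g)) =
      Comp B (on_ob F (on_ob G Y)) Y Y' g (e Y)"
    "\<And>X. X \<in> Ob A \<Longrightarrow>
      Comp B (on_ob F X) (on_ob F (on_ob G (on_ob F X))) (on_ob F X) (e (on_ob F X)) (on_arr F X (on_ob G (on_ob F X)) (u X)) =
      Ident B (on_ob F X)"
    "\<And>Y. Y \<in> Ob B \<Longrightarrow>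
      Comp A (on_ob G Y) (on_ob G (on_ob F (on_ob G Y))) (on_ob G Y) (on_arr G (on_ob F (on_ob G Y)) Y (e Y)) (u (on_ob G Y)) =
      Ident A (on_ob G Y)"
proof -
  from assms obtain \<Phi> where F: "cat_functor A B F" and G: "cat_functor B A G"
    and bij: "\<And>X Y. \<lbrakk>X \<in> Ob A; Y \<in> Ob B\<rbrakk> \<Longrightarrow> bij_betw (\<Phi> X Y) (Arr B (on_ob F X) Y) (Arr A X (on_ob G Y))"
    and nat: "\<And>X X' Y Y' f v g. \<lbrakk>X \<in> Ob A; X' \<in> Ob A; Y \<in> Ob B; Y' \<in> Ob B; f \<in> Arr A X' X; v \<in> Arr B Y Y'; g \<in> Arr B (on_ob F X) Y\<rbrakk> \<Longrightarrow>
      \<Phi> X' Y' (Comp B (on_ob F X') Y Y' v (Comp B (on_ob F X') (on_ob F X) Y g (on_arr F X' X f))) =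
      Comp A X' (on_ob G Y) (on_ob G Y') (on_arr G Y Y' v) (Comp A X' X (on_ob G Y) (\<Phi> X Y g) f)"
    unfolding left_adjoint_def by blast
  interpret F: cat_functor A B F by fact
  interpret G: cat_functor B A G by fact
  have \<Phi>_Arr: "\<Phi> X Y g \<in> Arr A X (on_ob G Y)" if "X \<in> Ob A" "Y \<in> Ob B" "g \<in> Arr B (on_ob F X) Y" for X Y g
    using bij_betwE[OF bij[OF that(1,2)]] that(3) by blast
  have \<Phi>_inj: "g = g'" if "\<Phi> X Y g = \<Phi> X Y g'" "X \<in> Ob A" "Y \<in> Ob B" "g \<in> Arr B (on_ob F X) Y" "g' \<in> Arr B (on_ob F X) Y" for X Y g g'
    using bij_betw_imp_inj_on[OF bij[OF that(2,3)]] that by (auto dest: inj_onD)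
  note [simp] = F.on_ob_Ob G.on_ob_Ob F.on_arr_Arr G.on_arr_Arr F.source.Comp_Arr F.target.Comp_Arr
    F.on_arr_Comp G.on_arr_Comp F.source.Ident_Arr F.target.Ident_Arr \<Phi>_Arr F.on_arr_Ident G.on_arr_Ident
    F.target.Comp_Ident_left F.source.Comp_Ident_left F.target.Comp_Ident_right F.source.Comp_Ident_right
  \<comment> \<open>naturality of the bijection in each variable alone\<close>
  have pre: "\<Phi> X' Y (Comp B (on_ob F X') (on_ob F X) Y g (on_arr F X' X f)) = Comp A X' X (on_ob G Y) (\<Phi> X Y g) f"
    if "X \<in> Ob A" "X' \<in> Ob A" "Y \<in> Ob B" "f \<in> Arr A X' X" "g \<in> Arr B (on_ob F X) Y" for X X' Y f g
    using nat[OF that(1,2,3,3,4) F.target.Ident_Arr[OF that(3)] that(5)] that by simp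
  have post: "\<Phi> X Y' (Comp B (on_ob F X) Y Y' v g) = Comp A X (on_ob G Y) (on_ob G Y') (on_arr G Y Y' v) (\<Phi> X Y g)"
    if "X \<in> Ob A" "Y \<in> Ob B" "Y' \<in> Ob B" "v \<in> Arr B Y Y'" "g \<in> Arr B (on_ob F X) Y" for X Y Y' v g
    using nat[OF that(1,1,2,3) F.source.Ident_Arr[OF that(1)] that(4,5)] that by simp
  define u where "u X = \<Phi> X (on_ob F X) (Ident B (on_ob F X))" for X
  define e where "e Y = inv_into (Arr B (on_ob F (on_ob G Y)) Y) (\<Phi> (on_ob G Y) Y) (Ident A (on_ob G Y))" for Y
  have u: "u X \<in> Arr A X (on_ob G (on_ob F X))" if "X \<in> Ob A" for X
    unfolding u_def using that by simp
  have e: "e Y \<in> Arr B (on_ob F (on_ob G Y)) Y" "\<Phi> (on_ob G Y) Y (e Y) = Ident A (on_ob G Y)" if "Y \<in> Ob B" for Y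
  proof -
    have "Ident A (on_ob G Y) \<in> \<Phi> (on_ob G Y) Y ` Arr B (on_ob F (on_ob G Y)) Y"
      using bij_betw_imp_surj_on[OF bij[of "on_ob G Y" Y]] that by simp
    then show "e Y \<in> Arr B (on_ob F (on_ob G Y)) Y" "\<Phi> (on_ob G Y) Y (e Y) = Ident A (on_ob G Y)"
      unfolding e_def by (rule inv_into_into, rule f_inv_into_f)
  qed
  note [simp] = u e
  have \<Phi>_u: "Comp A X (on_ob G (on_ob F X)) (on_ob G Y) (on_arr G (on_ob F X) Y g) (u X) = \<Phi> X Y g"
    if "X \<in> Ob A" "Y \<in> Ob B" "g \<in> Arr B (on_ob F X) Y" for X Y g
    unfolding u_def using post[of X "on_ob F X" Y g "Ident B (on_ob F X)"] that by simp
  show thesis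
  proof
    show "u X \<in> Arr A X (on_ob G (on_ob F X))" if "X \<in> Ob A" for X using that by (rule u)
    show "e Y \<in> Arr B (on_ob F (on_ob G Y)) Y" if "Y \<in> Ob B" for Y using that by (rule e)
    show "Comp A X X' (on_ob G (on_ob F X')) (u X') f =
      Comp A X (on_ob G (on_ob F X)) (on_ob G (on_ob F X')) (on_arr G (on_ob F X) (on_ob F X') (on_arr F X X' f)) (u X)"
      if "X \<in> Ob A" "X' \<in> Ob A" "f \<in> Arr A X X'" for X X' f
      using pre[of X' X "on_ob F X'" f "Ident B (on_ob F X')"] that by (simp add: \<Phi>_u) (simp add: u_def)
    show "Comp B (on_ob F (on_ob G Y)) (on_ob F (on_ob G Y')) Y' (e Y') (on_arr F (on_ob G Y) (on_ob G Y') (on_arr G Y Y' g)) =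
      Comp B (on_ob F (on_ob G Y)) Y Y' g (e Y)" if "Y \<in> Ob B" "Y' \<in> Ob B" "g \<in> Arr B Y Y'" for Y Y' g
      by (rule \<Phi>_inj[of "on_ob G Y" Y']) (use that pre[of "on_ob G Y'" "on_ob G Y" Y' "on_arr G Y Y' g" "e Y'"] in \<open>simp_all add: post\<close>)
    show "Comp B (on_ob F X) (on_ob F (on_ob G (on_ob F X))) (on_ob F X) (e (on_ob F X)) (on_arr F X (on_ob G (on_ob F X)) (u X)) =
      Ident B (on_ob F X)" if "X \<in> Ob A" for X
      by (rule \<Phi>_inj[of X "on_ob F X"]) (use that in \<open>simp_all add: pre\<close>, simp add: u_def)
    show "Comp A (on_ob G Y) (on_ob G (on_ob F (on_ob G Y))) (on_ob G Y) (on_arr G (on_ob F (on_ob G Y)) Y (e Y)) (u (on_ob G Y)) =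
      Ident A (on_ob G Y)" if "Y \<in> Ob B" for Y
      using that by (simp add: \<Phi>_u)
  qed
qed

section \<open>A calculus of Sweedler sums\<close>

definition trilinear ::
  "('k, 'r) ring_scheme \<Rightarrow> ('k, 'a, 'e) module_scheme \<Rightarrow> ('k, 'b, 'f) module_scheme \<Rightarrow>
   ('k, 'c, 'g) module_scheme \<Rightarrow> ('k, 't, 'h) module_scheme \<Rightarrow> ('a \<Rightarrow> 'b \<Rightarrow> 'c \<Rightarrow> 't) \<Rightarrow> bool" where
  "trilinear K A B B' T E \<longleftrightarrow> (\<forall>a\<in>carrier A. bilinear K B B' T (E a)) \<and>
     (\<forall>b\<in>carrier B. \<forall>b'\<in>carrier B'. (\<lambda>a. E a b b') \<in> linear_maps K A T)"

lemma bilinearD: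
  assumes "bilinear K V W T E"
  shows "v \<in> carrier V \<Longrightarrow> E v \<in> linear_maps K W T"
    and "w \<in> carrier W \<Longrightarrow> (\<lambda>v. E v w) \<in> linear_maps K V T"
    and "v \<in> carrier V \<Longrightarrow> w \<in> carrier W \<Longrightarrow> E v w \<in> carrier T"
  using assms bilinear_closed[OF assms] by (auto simp: bilinear_def)

lemma trilinearD:
  assumes "trilinear K A B B' T E"
  shows "a \<in> carrier A \<Longrightarrow> b \<in> carrier B \<Longrightarrow> E a b \<in> linear_maps K B' T"
    and "a \<in> carrier A \<Longrightarrow> b' \<in> carrier B' \<Longrightarrow> (\<lambda>b. E a b b') \<in> linear_maps K B T"
    and "b \<in> carrier B \<Longrightarrow> b' \<in> carrier B' \<Longrightarrow> (\<lambda>a. E a b b') \<in> linear_maps K A T"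
    and "a \<in> carrier A \<Longrightarrow> b \<in> carrier B \<Longrightarrow> b' \<in> carrier B' \<Longrightarrow> E a b b' \<in> carrier T"
  using assms bilinear_closed unfolding trilinear_def bilinear_def by (blast, blast, blast, meson linear_maps_closed)

context cring
begin

lemma linear_smult_right:
  assumes T: "module R T" and a: "a \<in> carrier R" and g: "g \<in> linear_maps R S T"
  shows "(\<lambda>x. a \<odot>\<^bsub>T\<^esub> g x) \<in> linear_maps R S T"
proof -
  interpret T: module R T by fact
  have "(\<lambda>x. a \<odot>\<^bsub>T\<^esub> x) \<in> linear_maps R T T"
    using a by (auto intro!: linear_mapsI simp: T.smult_r_distr m_comm simp flip: T.smult_assoc1)
  from linear_maps_comp[OF this g] show ?thesis .
qed

end

text \<open>
  The type \<open>'u\<close> of the elements of modules occurs in none of the data, so a type token fixes it.  The two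
  bounds on cardinalities make \<open>encode\<close> injective on the spaces that are moved into \<open>'u\<close>: the tensor
  products with \<open>C\<close> and the hom-spaces.
\<close>

locale entwined_universe = entwining_structure K D C \<psi>
  for K :: "'k ring" and D :: "('k, 'o, 'm) linear_category" and C :: "('k, 'c) coalgebra"
    and \<psi> :: "('o, 'm, 'c) entwining" +
  fixes universe :: "'u itself"
  assumes universe_infinite: "infinite (UNIV :: 'u set)"
    and C_lepoll: "carrier C \<lesssim> (UNIV :: 'u set)"
    and Arr_lepoll: "\<lbrakk>X \<in> Ob D; Y \<in> Ob D\<rbrakk> \<Longrightarrow> Arr D X Y \<lesssim> (UNIV :: 'u set)"
begin

abbreviation entwine :: "'o \<Rightarrow> 'o \<Rightarrow> 'c \<Rightarrow> 'm \<Rightarrow> ('m, 'c) tensor" where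
  "entwine X Y c f \<equiv> \<psi> X Y (pure K C (Hom D X Y) c f)"

abbreviation entwine_sum ::
  "'o \<Rightarrow> 'o \<Rightarrow> ('k, 't, 'e) module_scheme \<Rightarrow> 'c \<Rightarrow> 'm \<Rightarrow> ('m \<Rightarrow> 'c \<Rightarrow> 't) \<Rightarrow> 't" where
  "entwine_sum X Y T c f E \<equiv> sweedler (Hom D X Y) C T (entwine X Y c f) E"

abbreviation comult_sum :: "('k, 't, 'e) module_scheme \<Rightarrow> 'c \<Rightarrow> ('c \<Rightarrow> 'c \<Rightarrow> 't) \<Rightarrow> 't" where
  "comult_sum T c E \<equiv> sweedler C C T (comult C c) E"

abbreviation coact_sum ::
  "('k, 'o, 'm, 'x, 'c, 'f) entwined_module_scheme \<Rightarrow> 'o \<Rightarrow> ('k, 't, 'e) module_scheme \<Rightarrow> 'x \<Rightarrow>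
   ('x \<Rightarrow> 'c \<Rightarrow> 't) \<Rightarrow> 't" where
  "coact_sum M X T m E \<equiv> sweedler (at_ob M X) C T (coact M X m) E"

subsection \<open>Membership, linearity, and sums through linear maps\<close>

text \<open>
  What the simplifier has to know about a function symbol: that its values are members, that it
  preserves linearity of its argument, and that it passes into sums.
\<close>

lemma linear_map_rules:
  assumes h: "h \<in> linear_maps K V T" and V: "module K V" and T: "module K T"
  shows "x \<in> carrier V \<Longrightarrow> h x \<in> carrier T"
    and "g \<in> linear_maps K S V \<Longrightarrow> (\<lambda>x. h (g x)) \<in> linear_maps K S T"
    and "\<lbrakk>module K A; module K B; t \<in> carrier (tensor K A B);
      \<And>v w. \<lbrakk>v \<in> carrier A; w \<in> carrier B\<rbrakk> \<Longrightarrow> E v w \<in> carrier V\<rbrakk> \<Longrightarrow>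
      h (sweedler A B V t E) = sweedler A B T t (\<lambda>v w. h (E v w))"
  using linear_maps_closed[OF h] linear_maps_comp[OF h] linear_sweedler[OF h T _ _ V] by blast+

text \<open>
  The congruence rule for sums supplies membership of a bound arrow in the carrier of a hom-space, so
  carriers are the normal form.
\<close>

lemma Arr_eq_carrier [simp]: "\<lbrakk>X \<in> Ob D; Y \<in> Ob D\<rbrakk> \<Longrightarrow> Arr D X Y = carrier (Hom D X Y)"
  by (simp add: carrier_Hom)

lemma Ident_closed [simp]: "X \<in> Ob D \<Longrightarrow> Ident D X \<in> carrier (Hom D X X)"
  using Ident_Arr by (simp add: carrier_Hom del: Arr_eq_carrier)

lemma module_C [simp]: "module K C" by (rule module_axioms)

lemma counit_mem [simp]: "c \<in> carrier C \<Longrightarrow> counit C c \<in> carrier K"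
  using counit_closed by blast

lemma module_at_ob [simp]: "right_module K D M \<Longrightarrow> X \<in> Ob D \<Longrightarrow> module K (at_ob M X)"
  by (rule right_module.at_ob_module)

lemma entwined_module_right_module [simp]: "entwined_module K D C \<psi> M \<Longrightarrow> right_module K D M"
  by (simp add: entwined_module_def)

lemma coact_linear: "\<lbrakk>entwined_module K D C \<psi> M; X \<in> Ob D\<rbrakk> \<Longrightarrow>
    coact M X \<in> linear_maps K (at_ob M X) (tensor K (at_ob M X) C)"
  by (rule comodule.coaction_linear[OF entwined_module.coact_comodule])

lemma smult_mem [simp]: "module K T \<Longrightarrow> a \<in> carrier K \<Longrightarrow> x \<in> carrier T \<Longrightarrow> a \<odot>\<^bsub>T\<^esub> x \<in> carrier T"
  by (rule module.smult_closed)

lemma counit_smult_linear: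
  assumes T: "module K T" and y: "y \<in> carrier T"
  shows "(\<lambda>c. counit C c \<odot>\<^bsub>T\<^esub> y) \<in> linear_maps K C T"
proof -
  interpret T: module K T by fact
  show ?thesis by (rule linear_mapsI) (simp_all add: y counit_mem counit_add counit_smult T.smult_l_distr T.smult_assoc1)
qed

lemma inj_encode_tensor [simp]:
  fixes V :: "('k, 'u) module"
  shows "module K V \<Longrightarrow> inj_on (encode (tensor K V C) :: _ \<Rightarrow> 'u) (carrier (tensor K V C))"
  by (intro inj_on_encode tensor_lepoll universe_infinite C_lepoll) simp_all

lemma inj_encode_Hom [simp]:
  "X \<in> Ob D \<Longrightarrow> Y \<in> Ob D \<Longrightarrow> inj_on (encode (Hom D X Y) :: _ \<Rightarrow> 'u) (carrier (Hom D X Y))"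
  by (intro inj_on_encode) (simp add: Arr_lepoll carrier_Hom del: Arr_eq_carrier)

text \<open>
  With these rules membership and multilinearity are proved by following the structure of a term, and
  linear maps and sums over sums move inwards until only iterated sums of elementary terms remain.
  The exception is \<open>encode\<close>, which stays outside of sums, where \<open>decode\<close> cancels it; \<open>encode_sweedler\<close>
  moves it inside on demand.
\<close>

lemmas [simp] = Hom_module module_tensor module_transport
  pure_closed sweedler_closed encode_closed decode_closed decode_encode encode_decode
  bilinear_def trilinear_def linear_maps_ident sweedler_linear_body linear_smult_right
  sweedler_pure sweedler_ident

lemmas [simp] = comult_linear \<psi>_linear Comp_linear_left Comp_linear_right right_module.act_linear[of K D]
  right_module.act_linear_Hom[of K D] coact_linear pure_linear_left pure_linear_right encode_linear decode_linear

lemmas [simp] = linear_map_rules[OF comult_linear] linear_map_rules[OF \<psi>_linear] linear_map_rules[OF Comp_linear_left]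
  linear_map_rules[OF Comp_linear_right] linear_map_rules[OF right_module.act_linear[of K D]]
  linear_map_rules[OF right_module.act_linear_Hom[of K D]] linear_map_rules[OF coact_linear]
  linear_map_rules(2,3)[OF pure_linear_left] linear_map_rules(2,3)[OF pure_linear_right]
  linear_map_rules(2,3)[OF sweedler_linear] linear_map_rules(2)[OF encode_linear] linear_map_rules(2,3)[OF decode_linear]
  linear_map_rules(2)[OF counit_smult_linear]

lemmas encode_sweedler = linear_map_rules(3)[OF encode_linear]

subsection \<open>The axioms, applied to multilinear maps\<close>

text \<open>
  Axioms with three tensor factors are equations in \<open>A \<otimes> (B \<otimes> B')\<close>; applying the linear map that
  \<open>E\<close> induces turns them into equations that can be used for an arbitrary trilinear expression.
\<close>

lemma apply_threefold:
  assumes "module K A" "module K B" "module K B'" "module K T" "trilinear K A B B' T E"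
    and "s = s'"
  shows "sweedler A (tensor K B B') T s (\<lambda>a u. sweedler B B' T u (E a)) =
    sweedler A (tensor K B B') T s' (\<lambda>a u. sweedler B B' T u (E a))"
  using assms by simp

lemma coassoc_sweedler:
  assumes c: "c \<in> carrier C" and T: "module K T" and E: "trilinear K C C C T E"
  shows "comult_sum T c (\<lambda>c1 c2. comult_sum T c1 (\<lambda>c11 c12. E c11 c12 c2)) =
    comult_sum T c (\<lambda>c1 c2. comult_sum T c2 (\<lambda>c21 c22. E c1 c21 c22))"
proof -
  let ?U = "tensor K C (tensor K C C)"
  have "comult_sum ?U c (\<lambda>c1 c2. comult_sum ?U c1 (\<lambda>c11 c12. pure K C (tensor K C C) c11 (pure K C C c12 c2))) =
    comult_sum ?U c (\<lambda>c1 c2. comult_sum ?U c2 (\<lambda>c21 c22. pure K C (tensor K C C) c1 (pure K C C c21 c22)))"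
    by (rule box_equals[OF coassoc[OF c]]; intro tsum_eq_sweedler) (use c in simp_all)
  from apply_threefold[OF _ _ _ T E this] show ?thesis using c by (simp add: T trilinearD[OF E])
qed

lemma counit_left_sweedler:
  assumes c: "c \<in> carrier C" and T: "module K T" and h: "h \<in> linear_maps K C T"
  shows "comult_sum T c (\<lambda>c1 c2. counit C c1 \<odot>\<^bsub>T\<^esub> h c2) = h c"
proof -
  have hc: "h x \<in> carrier T" if "x \<in> carrier C" for x using linear_maps_closed[OF h that] .
  have "comult_sum C c (\<lambda>c1 c2. counit C c1 \<odot>\<^bsub>C\<^esub> c2) = c"
    by (rule box_equals[OF counit_left[OF c]]; (rule refl | intro tsum_eq_sweedler)) (use c in simp_all)
  then have "h c = h (comult_sum C c (\<lambda>c1 c2. counit C c1 \<odot>\<^bsub>C\<^esub> c2))" by simp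
  also have "\<dots> = comult_sum T c (\<lambda>c1 c2. h (counit C c1 \<odot>\<^bsub>C\<^esub> c2))"
    by (rule linear_sweedler[OF h T]) (use c in simp_all)
  also have "\<dots> = comult_sum T c (\<lambda>c1 c2. counit C c1 \<odot>\<^bsub>T\<^esub> h c2)"
    by (simp add: linear_maps_smult[OF h])
  finally show ?thesis by simp
qed

lemma counit_right_sweedler:
  assumes c: "c \<in> carrier C" and T: "module K T" and h: "h \<in> linear_maps K C T"
  shows "comult_sum T c (\<lambda>c1 c2. counit C c2 \<odot>\<^bsub>T\<^esub> h c1) = h c"
proof -
  have "comult_sum C c (\<lambda>c1 c2. counit C c2 \<odot>\<^bsub>C\<^esub> c1) = c"
    by (rule box_equals[OF counit_right[OF c]]; (rule refl | intro tsum_eq_sweedler)) (use c in simp_all)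
  then have "h c = h (comult_sum C c (\<lambda>c1 c2. counit C c2 \<odot>\<^bsub>C\<^esub> c1))" by simp
  also have "\<dots> = comult_sum T c (\<lambda>c1 c2. h (counit C c2 \<odot>\<^bsub>C\<^esub> c1))"
    by (rule linear_sweedler[OF h T]) (use c in simp_all)
  also have "\<dots> = comult_sum T c (\<lambda>c1 c2. counit C c2 \<odot>\<^bsub>T\<^esub> h c1)"
    by (simp add: linear_maps_smult[OF h])
  finally show ?thesis by simp
qed

lemma \<psi>_Comp_sweedler:
  assumes X: "X \<in> Ob D" "Y \<in> Ob D" "Z \<in> Ob D" and f: "f \<in> Arr D X Y" "g \<in> Arr D Y Z" and c: "c \<in> carrier C"
    and T: "module K T" and E: "bilinear K (Hom D X Z) C T E"
  shows "entwine_sum X Z T c (Comp D X Y Z g f) E =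
    entwine_sum Y Z T c g (\<lambda>g' c'.
      entwine_sum X Y T c' f (\<lambda>f' c''. E (Comp D X Y Z g' f') c''))"
proof -
  let ?U = "tensor K (Hom D X Z) C"
  have *: "entwine X Z c (Comp D X Y Z g f) =
    entwine_sum Y Z ?U c g (\<lambda>g' c'.
      entwine_sum X Y ?U c' f (\<lambda>f' c''. pure K (Hom D X Z) C (Comp D X Y Z g' f') c''))"
    unfolding \<psi>_Comp[OF X f c] by (intro tsum_eq_sweedler) (use X f c in simp_all)
  show ?thesis unfolding * using X f c by (simp add: T bilinearD[OF E])
qed

lemma \<psi>_counit_sweedler:
  assumes X: "X \<in> Ob D" "Y \<in> Ob D" and f: "f \<in> Arr D X Y" and c: "c \<in> carrier C"
    and T: "module K T" and h: "h \<in> linear_maps K (Hom D X Y) T"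
  shows "entwine_sum X Y T c f (\<lambda>f' c'. counit C c' \<odot>\<^bsub>T\<^esub> h f') =
    counit C c \<odot>\<^bsub>T\<^esub> h f"
proof -
  let ?t = "entwine X Y c f"
  have f': "f \<in> carrier (Hom D X Y)" using X f by simp
  have "sweedler (Hom D X Y) C (Hom D X Y) ?t (\<lambda>f' c'. counit C c' \<odot>\<^bsub>Hom D X Y\<^esub> f') = counit C c \<odot>\<^bsub>Hom D X Y\<^esub> f"
    by (rule box_equals[OF \<psi>_counit[OF X f c]]; (rule refl | intro tsum_eq_sweedler)) (use X f c in simp_all)
  then have "counit C c \<odot>\<^bsub>T\<^esub> h f = h (sweedler (Hom D X Y) C (Hom D X Y) ?t (\<lambda>f' c'. counit C c' \<odot>\<^bsub>Hom D X Y\<^esub> f'))"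
    using linear_maps_smult[OF h _ f'] c by simp
  also have "\<dots> = sweedler (Hom D X Y) C T ?t (\<lambda>f' c'. h (counit C c' \<odot>\<^bsub>Hom D X Y\<^esub> f'))"
    by (rule linear_sweedler[OF h T]) (use X f c smult_mem[of "Hom D X Y"] in simp_all)
  also have "\<dots> = sweedler (Hom D X Y) C T ?t (\<lambda>f' c'. counit C c' \<odot>\<^bsub>T\<^esub> h f')"
    by (simp add: linear_maps_smult[OF h])
  finally show ?thesis by simp
qed

lemma \<psi>_comult_sweedler:
  assumes X: "X \<in> Ob D" "Y \<in> Ob D" and f: "f \<in> Arr D X Y" and c: "c \<in> carrier C"
    and T: "module K T" and E: "trilinear K (Hom D X Y) C C T E"
  shows "entwine_sum X Y T c f (\<lambda>f' c'. comult_sum T c' (E f')) =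
    comult_sum T c (\<lambda>c1 c2.
      entwine_sum X Y T c2 f (\<lambda>f' c2'.
        entwine_sum X Y T c1 f' (\<lambda>f'' c1'. E f'' c1' c2')))"
proof -
  let ?U = "tensor K (Hom D X Y) (tensor K C C)"
  have "entwine_sum X Y ?U c f (\<lambda>f' c'. comult_sum ?U c' (\<lambda>c1 c2. pure K (Hom D X Y) (tensor K C C) f' (pure K C C c1 c2))) =
    comult_sum ?U c (\<lambda>c1 c2.
      entwine_sum X Y ?U c2 f (\<lambda>f' c2'.
        entwine_sum X Y ?U c1 f' (\<lambda>f'' c1'. pure K (Hom D X Y) (tensor K C C) f'' (pure K C C c1' c2'))))"
    by (rule box_equals[OF \<psi>_comult[OF X f c]]; intro tsum_eq_sweedler) (use X f c in simp_all)
  from apply_threefold[OF _ _ _ T E this] show ?thesis by (simp add: T trilinearD[OF E] X f[simplified X Arr_eq_carrier] c)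
qed

lemma \<psi>_Ident_pure [simp]: "\<lbrakk>X \<in> Ob D; c \<in> carrier C\<rbrakk> \<Longrightarrow>
    entwine X X c (Ident D X) = pure K (Hom D X X) C (Ident D X) c"
  by (rule \<psi>_Ident)

lemma coact_coassoc_sweedler:
  assumes M: "entwined_module K D C \<psi> M" and X: "X \<in> Ob D" and m: "m \<in> carrier (at_ob M X)"
    and T: "module K T" and E: "trilinear K (at_ob M X) C C T E"
  shows "coact_sum M X T m (\<lambda>m0 m1. coact_sum M X T m0 (\<lambda>m00 m01. E m00 m01 m1)) =
    coact_sum M X T m (\<lambda>m0 m1. comult_sum T m1 (\<lambda>c1 c2. E m0 c1 c2))"
proof -
  let ?V = "at_ob M X"
  let ?U = "tensor K ?V (tensor K C C)"
  note com = entwined_module.coact_comodule[OF M X]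
  have "coact_sum M X ?U m (\<lambda>m0 m1. coact_sum M X ?U m0 (\<lambda>m00 m01. pure K ?V (tensor K C C) m00 (pure K C C m01 m1))) =
    coact_sum M X ?U m (\<lambda>m0 m1. comult_sum ?U m1 (\<lambda>c1 c2. pure K ?V (tensor K C C) m0 (pure K C C c1 c2)))"
    by (rule box_equals[OF comodule.coaction_coassoc[OF com m]]; intro tsum_eq_sweedler) (use M X m in simp_all)
  from apply_threefold[OF _ _ _ T E this] show ?thesis by (simp add: T trilinearD[OF E] M X m)
qed

lemma coact_counit_sweedler:
  assumes M: "entwined_module K D C \<psi> M" and X: "X \<in> Ob D" and m: "m \<in> carrier (at_ob M X)"
    and T: "module K T" and h: "h \<in> linear_maps K (at_ob M X) T"
  shows "coact_sum M X T m (\<lambda>m0 m1. counit C m1 \<odot>\<^bsub>T\<^esub> h m0) = h m"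
proof -
  let ?V = "at_ob M X"
  note com = entwined_module.coact_comodule[OF M X]
  have "coact_sum M X ?V m (\<lambda>m0 m1. counit C m1 \<odot>\<^bsub>?V\<^esub> m0) = m"
    by (rule box_equals[OF comodule.coaction_counit[OF com m]]; (rule refl | intro tsum_eq_sweedler)) (use M X m in simp_all)
  then have "h m = h (coact_sum M X ?V m (\<lambda>m0 m1. counit C m1 \<odot>\<^bsub>?V\<^esub> m0))" by simp
  also have "\<dots> = coact_sum M X T m (\<lambda>m0 m1. h (counit C m1 \<odot>\<^bsub>?V\<^esub> m0))"
    by (rule linear_sweedler[OF h T]) (use M X m in simp_all)
  also have "\<dots> = coact_sum M X T m (\<lambda>m0 m1. counit C m1 \<odot>\<^bsub>T\<^esub> h m0)"
    by (simp add: linear_maps_smult[OF h])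
  finally show ?thesis by simp
qed

lemma coact_act_sweedler:
  assumes M: "entwined_module K D C \<psi> M" and X: "X \<in> Ob D" "Y \<in> Ob D" and f: "f \<in> Arr D Y X"
    and m: "m \<in> carrier (at_ob M X)"
  shows "coact M Y (act M Y X f m) =
    coact_sum M X (tensor K (at_ob M Y) C) m (\<lambda>m0 m1.
      entwine_sum Y X (tensor K (at_ob M Y) C) m1 f (\<lambda>f' c'.
        pure K (at_ob M Y) C (act M Y X f' m0) c'))"
  unfolding entwined_module.coact_act[OF M X f m] by (intro tsum_eq_sweedler) (use M X f m in simp_all)

subsection \<open>The cofree entwined module\<close>

lemma comoduleI:
  assumes V: "module K V" and lin: "\<rho> \<in> linear_maps K V (tensor K V C)"
    and coassoc: "\<And>m. m \<in> carrier V \<Longrightarrow>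
        sweedler V C (tensor K V (tensor K C C)) (\<rho> m) (\<lambda>m0 m1.
          sweedler V C (tensor K V (tensor K C C)) (\<rho> m0) (\<lambda>m00 m01.
            pure K V (tensor K C C) m00 (pure K C C m01 m1))) =
        sweedler V C (tensor K V (tensor K C C)) (\<rho> m) (\<lambda>m0 m1.
          comult_sum (tensor K V (tensor K C C)) m1 (\<lambda>c1 c2.
            pure K V (tensor K C C) m0 (pure K C C c1 c2)))"
    and counit: "\<And>m. m \<in> carrier V \<Longrightarrow> sweedler V C V (\<rho> m) (\<lambda>m0 m1. counit C m1 \<odot>\<^bsub>V\<^esub> m0) = m"
  shows "comodule K C V \<rho>"
proof -
  interpret V: module K V by fact
  note [simp] = linear_map_rules(1,2)[OF lin V module_tensor[OF V module_C]] V
  show ?thesis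
  proof unfold_locales
    show "\<rho> \<in> linear_maps K V (tensor K V C)" by (rule lin)
    fix m assume m: "m \<in> carrier V"
    show "tsum (tensor K V (tensor K C C)) (\<rho> m) (\<lambda>m0 m1.
          tsum (tensor K V (tensor K C C)) (\<rho> m0) (\<lambda>m00 m01.
            pure K V (tensor K C C) m00 (pure K C C m01 m1))) =
        tsum (tensor K V (tensor K C C)) (\<rho> m) (\<lambda>m0 m1.
          tsum (tensor K V (tensor K C C)) (comult C m1) (\<lambda>c1 c2.
            pure K V (tensor K C C) m0 (pure K C C c1 c2)))"
      by (rule box_equals[OF coassoc[OF m]]; rule sym; intro tsum_eq_sweedler) (simp_all add: m lin)
    show "tsum V (\<rho> m) (\<lambda>m0 m1. counit C m1 \<odot>\<^bsub>V\<^esub> m0) = m"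
      by (rule box_equals[OF counit[OF m]]; (rule refl | (rule sym, intro tsum_eq_sweedler))) (simp_all add: m lin)
  qed
qed

lemma entwined_moduleI:
  assumes M: "right_module K D M" and com: "\<And>X. X \<in> Ob D \<Longrightarrow> comodule K C (at_ob M X) (coact M X)"
    and act: "\<And>X Y f m. \<lbrakk>X \<in> Ob D; Y \<in> Ob D; f \<in> carrier (Hom D Y X); m \<in> carrier (at_ob M X)\<rbrakk> \<Longrightarrow>
        coact M Y (act M Y X f m) =
        coact_sum M X (tensor K (at_ob M Y) C) m (\<lambda>m0 m1.
          entwine_sum Y X (tensor K (at_ob M Y) C) m1 f (\<lambda>f' c'.
            pure K (at_ob M Y) C (act M Y X f' m0) c'))"
  shows "entwined_module K D C \<psi> M"
proof -
  have co: "coact M X m \<in> carrier (tensor K (at_ob M X) C)" if "X \<in> Ob D" "m \<in> carrier (at_ob M X)" for X m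
    by (rule linear_maps_closed[OF comodule.coaction_linear[OF com]]) (use that in auto)
  have "coact M Y (act M Y X f m) =
        tsum (tensor K (at_ob M Y) C) (coact M X m) (\<lambda>m0 m1.
          tsum (tensor K (at_ob M Y) C) (entwine Y X m1 f) (\<lambda>f' c'.
            pure K (at_ob M Y) C (act M Y X f' m0) c'))"
    if X: "X \<in> Ob D" "Y \<in> Ob D" and f: "f \<in> Arr D Y X" and m: "m \<in> carrier (at_ob M X)" for X Y f m
    unfolding act[OF X f[simplified X Arr_eq_carrier] m]
    by (rule sym, intro tsum_eq_sweedler) (use f in \<open>simp_all add: X m M co\<close>)
  then show ?thesis
    using M com entwining_structure_axioms
    by (simp add: entwined_module_def entwined_module_axioms_def)
qed

abbreviation at_tensor :: "('k, 'o, 'm, 'u) right_module \<Rightarrow> 'o \<Rightarrow> ('k, ('u, 'c) tensor) module" where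
  "at_tensor N X \<equiv> tensor K (at_ob N X) C"

abbreviation cofree :: "('k, 'o, 'm, 'u) right_module \<Rightarrow> ('k, 'o, 'm, 'u, 'c) entwined_module" where
  "cofree \<equiv> tensor_coalgebra_ob K D C \<psi>"

lemma at_ob_cofree [simp]: "at_ob (cofree N) X = transport (at_tensor N X)"
  by (simp add: tensor_coalgebra_ob_def Let_def)

lemma act_cofree:
  assumes "right_module K D N" "X \<in> Ob D" "Y \<in> Ob D" "f \<in> carrier (Hom D Y X)"
    and "t \<in> carrier (transport (at_tensor N X))"
  shows "act (cofree N) Y X f t = encode (at_tensor N Y)
    (sweedler (at_ob N X) C (at_tensor N Y) (decode (at_tensor N X) t) (\<lambda>n c.
      entwine_sum Y X (at_tensor N Y) c f (\<lambda>f' c'.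
        pure K (at_ob N Y) C (act N Y X f' n) c')))"
proof -
  have *: "tsum (at_tensor N Y) (decode (at_tensor N X) t) (\<lambda>n c.
      tsum (at_tensor N Y) (entwine Y X c f) (\<lambda>f' c'.
        pure K (at_ob N Y) C (act N Y X f' n) c')) =
    sweedler (at_ob N X) C (at_tensor N Y) (decode (at_tensor N X) t) (\<lambda>n c.
      entwine_sum Y X (at_tensor N Y) c f (\<lambda>f' c'.
        pure K (at_ob N Y) C (act N Y X f' n) c'))"
    by (intro tsum_eq_sweedler) (simp_all add: assms)
  show ?thesis by (simp only: * tensor_coalgebra_ob_def Let_def right_module.simps entwined_module.simps)
qed

lemma coact_cofree:
  assumes "right_module K D N" "X \<in> Ob D" "t \<in> carrier (transport (at_tensor N X))"
  shows "coact (cofree N) X t =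
    sweedler (at_ob N X) C (tensor K (transport (at_tensor N X)) C) (decode (at_tensor N X) t) (\<lambda>n c.
      comult_sum (tensor K (transport (at_tensor N X)) C) c (\<lambda>c1 c2.
        pure K (transport (at_tensor N X)) C (encode (at_tensor N X) (pure K (at_ob N X) C n c1)) c2))"
proof -
  have *: "tsum (tensor K (transport (at_tensor N X) :: ('k, 'u) module) C) (decode (at_tensor N X) t) (\<lambda>n c.
      tsum (tensor K (transport (at_tensor N X)) C) (comult C c) (\<lambda>c1 c2.
        pure K (transport (at_tensor N X)) C (encode (at_tensor N X) (pure K (at_ob N X) C n c1)) c2)) =
    sweedler (at_ob N X) C (tensor K (transport (at_tensor N X)) C) (decode (at_tensor N X) t) (\<lambda>n c.
      comult_sum (tensor K (transport (at_tensor N X)) C) c (\<lambda>c1 c2.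
        pure K (transport (at_tensor N X)) C (encode (at_tensor N X) (pure K (at_ob N X) C n c1)) c2))"
    by (intro tsum_eq_sweedler) (simp_all add: assms)
  show ?thesis by (simp only: * tensor_coalgebra_ob_def Let_def right_module.simps entwined_module.simps)
qed

text \<open>
  Functoriality of the action on \<open>N \<otimes> C\<close> is multiplicativity of \<open>\<psi>\<close>, together with \<open>\<psi>(c \<otimes> id) = id \<otimes> c\<close>.
\<close>

lemma right_module_cofree [simp]:
  assumes N: "right_module K D N"
  shows "right_module K D (cofree N)"
proof -
  interpret N: right_module K D N by fact
  note [simp] = N act_cofree[OF N]
  show ?thesis
  proof (intro right_module.intro right_module_axioms.intro)
    show "linear_category K D" by (rule linear_category_axioms)
    fix X assume X [simp]: "X \<in> Ob D"
    show "module K (at_ob (cofree N) X)" by simp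
    fix t assume "t \<in> carrier (at_ob (cofree N) X)"
    then have t [simp]: "t \<in> carrier (transport (at_tensor N X))" by simp
    show "act (cofree N) X X (Ident D X) t = t" by (simp add: N.act_Ident)
    fix Y assume Y [simp]: "Y \<in> Ob D"
    show "(\<lambda>f. act (cofree N) Y X f t) \<in> linear_maps K (Hom D Y X) (at_ob (cofree N) Y)"
      by (subst linear_maps_cong[OF _ act_cofree[OF N]]) simp_all
  next
    fix X Y f assume X [simp]: "X \<in> Ob D" "Y \<in> Ob D" and "f \<in> Arr D Y X"
    then have f [simp]: "f \<in> carrier (Hom D Y X)" by simp
    show "act (cofree N) Y X f \<in> linear_maps K (at_ob (cofree N) X) (at_ob (cofree N) Y)"
      by (subst linear_maps_cong[OF _ act_cofree[OF N]]) simp_all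
  next
    fix X Y Z f g t assume X [simp]: "X \<in> Ob D" "Y \<in> Ob D" "Z \<in> Ob D" and "f \<in> Arr D X Y" "g \<in> Arr D Y Z"
      and "t \<in> carrier (at_ob (cofree N) Z)"
    then have f [simp]: "f \<in> carrier (Hom D X Y)" "g \<in> carrier (Hom D Y Z)" "t \<in> carrier (transport (at_tensor N Z))" by simp_all
    show "act (cofree N) X Z (Comp D X Y Z g f) t = act (cofree N) X Y f (act (cofree N) Y Z g t)"
      by (simp add: \<psi>_Comp_sweedler N.act_Comp)
  qed
qed

text \<open>
  The comodule axioms are those of \<open>C\<close>.  Compatibility of action and coaction is the axiom that relates
  \<open>\<psi>\<close> to the comultiplication.
\<close>

lemma entwined_module_cofree [simp]:
  assumes N: "right_module K D N"
  shows "entwined_module K D C \<psi> (cofree N)"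
proof (rule entwined_moduleI)
  note [simp] = N act_cofree[OF N] coact_cofree[OF N]
  show "right_module K D (cofree N)" using N by simp
  fix X assume X [simp]: "X \<in> Ob D"
  have lin: "coact (cofree N) X \<in> linear_maps K (at_ob (cofree N) X) (tensor K (at_ob (cofree N) X) C)"
    by (subst linear_maps_cong[OF _ coact_cofree[OF N]]) simp_all
  show "comodule K C (at_ob (cofree N) X) (coact (cofree N) X)"
  proof (rule comoduleI[OF _ lin])
    fix t assume "t \<in> carrier (at_ob (cofree N) X)"
    then have [simp]: "t \<in> carrier (transport (at_tensor N X))" by simp
    show "coact_sum (cofree N) X (tensor K (at_ob (cofree N) X) (tensor K C C)) t
     (\<lambda>m0 m1. coact_sum (cofree N) X (tensor K (at_ob (cofree N) X) (tensor K C C)) m0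
       (\<lambda>m00 m01. pure K (at_ob (cofree N) X) (tensor K C C) m00 (pure K C C m01 m1))) =
     coact_sum (cofree N) X (tensor K (at_ob (cofree N) X) (tensor K C C)) t
     (\<lambda>m0 m1. comult_sum (tensor K (at_ob (cofree N) X) (tensor K C C)) m1
       (\<lambda>c1 c2. pure K (at_ob (cofree N) X) (tensor K C C) m0 (pure K C C c1 c2)))"
      by (simp add: coassoc_sweedler)
    show "coact_sum (cofree N) X (at_ob (cofree N) X) t
      (\<lambda>m0 m1. counit C m1 \<odot>\<^bsub>at_ob (cofree N) X\<^esub> m0) = t"
      by (simp add: counit_right_sweedler flip: encode_sweedler)
  qed simp
next
  note [simp] = N act_cofree[OF N] coact_cofree[OF N]
  fix X Y f t assume [simp]: "X \<in> Ob D" "Y \<in> Ob D" and f [simp]: "f \<in> carrier (Hom D Y X)"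
    and "t \<in> carrier (at_ob (cofree N) X)"
  then have [simp]: "t \<in> carrier (transport (at_tensor N X))" by simp
  show "coact (cofree N) Y (act (cofree N) Y X f t) =
     coact_sum (cofree N) X (tensor K (at_ob (cofree N) Y) C) t
     (\<lambda>m0 m1. entwine_sum Y X (tensor K (at_ob (cofree N) Y) C) m1 f
       (\<lambda>f' c'. pure K (at_ob (cofree N) Y) C (act (cofree N) Y X f' m0) c'))"
    by (simp add: \<psi>_comult_sweedler encode_sweedler)
qed

subsection \<open>The categories\<close>

lemma module_morphismsD:
  assumes "\<alpha> \<in> module_morphisms K D M N"
  shows "X \<in> Ob D \<Longrightarrow> \<alpha> X \<in> linear_maps K (at_ob M X) (at_ob N X)"
    and "\<lbrakk>X \<in> Ob D; Y \<in> Ob D; f \<in> carrier (Hom D Y X); m \<in> carrier (at_ob M X)\<rbrakk> \<Longrightarrow>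
      \<alpha> Y (act M Y X f m) = act N Y X f (\<alpha> X m)"
  using assms by (auto simp: module_morphisms_def)

lemma module_morphismsI:
  assumes M: "right_module K D M"
    and "\<And>X. X \<in> Ob D \<Longrightarrow> a X \<in> linear_maps K (at_ob M X) (at_ob N X)"
    and "\<And>X Y f m. \<lbrakk>X \<in> Ob D; Y \<in> Ob D; f \<in> carrier (Hom D Y X); m \<in> carrier (at_ob M X)\<rbrakk> \<Longrightarrow>
      a Y (act M Y X f m) = act N Y X f (a X m)"
  shows "(\<lambda>X\<in>Ob D. \<lambda>m\<in>carrier (at_ob M X). a X m) \<in> module_morphisms K D M N"
proof -
  have "(\<lambda>m\<in>carrier (at_ob M X). a X m) \<in> linear_maps K (at_ob M X) (at_ob N X)" if "X \<in> Ob D" for X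
    using assms(2)[OF that] by (subst linear_maps_cong[where g="a X"]) (simp_all add: M that)
  then show ?thesis using assms(3) M by (auto simp: module_morphisms_def)
qed

lemma module_morphism_eqI:
  assumes "\<alpha> \<in> module_morphisms K D M N" "\<beta> \<in> module_morphisms K D M N"
    and "\<And>X m. X \<in> Ob D \<Longrightarrow> m \<in> carrier (at_ob M X) \<Longrightarrow> \<alpha> X m = \<beta> X m"
  shows "\<alpha> = \<beta>"
proof (rule PiE_ext)
  show "\<alpha> \<in> (\<Pi>\<^sub>E X\<in>Ob D. extensional (carrier (at_ob M X)))" "\<beta> \<in> (\<Pi>\<^sub>E X\<in>Ob D. extensional (carrier (at_ob M X)))"
    using assms(1,2) by (auto simp: module_morphisms_def PiE_def)
  then show "\<alpha> X = \<beta> X" if "X \<in> Ob D" for X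
    using assms(3) that by (intro extensionalityI[of _ "carrier (at_ob M X)"]) (auto simp: PiE_def)
qed

lemma compose_morphisms_eq:
  "compose_morphisms D M \<beta> \<alpha> = (\<lambda>X\<in>Ob D. \<lambda>m\<in>carrier (at_ob M X). \<beta> X (\<alpha> X m))"
  by (simp add: compose_morphisms_def compose_def)

lemma compose_module_morphisms:
  assumes M: "right_module K D M" and N: "right_module K D N" and P: "right_module K D P"
    and a: "\<alpha> \<in> module_morphisms K D M N" and b: "\<beta> \<in> module_morphisms K D N P"
  shows "compose_morphisms D M \<beta> \<alpha> \<in> module_morphisms K D M P"
  unfolding compose_morphisms_eq
  by (rule module_morphismsI[OF M])
    (simp_all add: linear_maps_comp[OF module_morphismsD(1)[OF b] module_morphismsD(1)[OF a]] M N P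
      module_morphismsD(2)[OF a] module_morphismsD(2)[OF b] linear_maps_closed[OF module_morphismsD(1)[OF a]])

lemma identity_module_morphism:
  assumes M: "right_module K D M"
  shows "identity_morphism D M \<in> module_morphisms K D M M"
  unfolding identity_morphism_def by (rule module_morphismsI[OF M]) simp_all

lemma compose_identity_morphism:
  assumes M: "right_module K D M" and N: "right_module K D N" and f: "f \<in> module_morphisms K D M N"
  shows "compose_morphisms D M (identity_morphism D N) f = f"
    and "compose_morphisms D M f (identity_morphism D M) = f"
proof -
  note cl = linear_maps_closed[OF module_morphismsD(1)[OF f]]
  show "compose_morphisms D M (identity_morphism D N) f = f"
    by (rule module_morphism_eqI[OF compose_module_morphisms[OF M N N f identity_module_morphism[OF N]] f])
      (simp add: compose_morphisms_eq identity_morphism_def cl)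
  show "compose_morphisms D M f (identity_morphism D M) = f"
    by (rule module_morphism_eqI[OF compose_module_morphisms[OF M M N identity_module_morphism[OF M] f] f])
      (simp add: compose_morphisms_eq identity_morphism_def)
qed

lemma compose_morphisms_assoc:
  assumes "f \<in> module_morphisms K D L M"
  shows "compose_morphisms D L (compose_morphisms D M h g) f = compose_morphisms D L h (compose_morphisms D L g f)"
  by (simp add: compose_morphisms_eq linear_maps_closed[OF module_morphismsD(1)[OF assms]] cong: restrict_cong)

abbreviation module_cat :: "(('k, 'o, 'm, 'u) right_module, 'o \<Rightarrow> 'u \<Rightarrow> 'u) category" where
  "module_cat \<equiv> module_category K D"

abbreviation entwined_cat :: "(('k, 'o, 'm, 'u, 'c) entwined_module, 'o \<Rightarrow> 'u \<Rightarrow> 'u) category" where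
  "entwined_cat \<equiv> entwined_category K D C \<psi>"

lemma module_cat_simps [simp]:
  "N \<in> Ob module_cat \<longleftrightarrow> right_module K D N"
  "Arr module_cat N N' = module_morphisms K D N N'"
  "Ident module_cat N = identity_morphism D N"
  "Comp module_cat N N' N'' \<beta> \<alpha> = compose_morphisms D N \<beta> \<alpha>"
  by (simp_all add: module_category_def)

lemma entwined_cat_simps [simp]:
  "M \<in> Ob entwined_cat \<longleftrightarrow> entwined_module K D C \<psi> M"
  "Arr entwined_cat M M' = entwined_morphisms K D C M M'"
  "Ident entwined_cat M = identity_morphism D M"
  "Comp entwined_cat M M' M'' \<beta> \<alpha> = compose_morphisms D M \<beta> \<alpha>"
  by (simp_all add: entwined_category_def)

lemma category_modules: "category module_cat"
  by unfold_locales
    (simp_all add: identity_module_morphism compose_module_morphisms compose_identity_morphism compose_morphisms_assoc)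

lemma entwined_morphism_module_morphism: "\<alpha> \<in> entwined_morphisms K D C M N \<Longrightarrow> \<alpha> \<in> module_morphisms K D M N"
  by (simp add: entwined_morphisms_def)

lemma entwined_morphismsD:
  assumes M: "entwined_module K D C \<psi> M" and N: "entwined_module K D C \<psi> N" and a: "\<alpha> \<in> entwined_morphisms K D C M N"
  shows "\<alpha> \<in> module_morphisms K D M N"
    and "X \<in> Ob D \<Longrightarrow> m \<in> carrier (at_ob M X) \<Longrightarrow>
      coact N X (\<alpha> X m) = coact_sum M X (tensor K (at_ob N X) C) m (\<lambda>m0 m1. pure K (at_ob N X) C (\<alpha> X m0) m1)"
proof -
  show \<alpha>: "\<alpha> \<in> module_morphisms K D M N" using a by (simp add: entwined_morphisms_def)
  assume X: "X \<in> Ob D" and m: "m \<in> carrier (at_ob M X)"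
  note [simp] = linear_map_rules(1,2)[OF module_morphismsD(1)[OF \<alpha> X], simplified M N X entwined_module_right_module module_at_ob simp_thms]
     module_morphismsD(1)[OF \<alpha> X]
  have "coact N X (\<alpha> X m) = tsum (tensor K (at_ob N X) C) (coact M X m) (\<lambda>m0 m1. pure K (at_ob N X) C (\<alpha> X m0) m1)"
    using a X m by (simp add: entwined_morphisms_def)
  also have "\<dots> = coact_sum M X (tensor K (at_ob N X) C) m (\<lambda>m0 m1. pure K (at_ob N X) C (\<alpha> X m0) m1)"
    by (intro tsum_eq_sweedler) (simp_all add: M N X m)
  finally show "coact N X (\<alpha> X m) = coact_sum M X (tensor K (at_ob N X) C) m (\<lambda>m0 m1. pure K (at_ob N X) C (\<alpha> X m0) m1)" .
qed

lemma entwined_morphismsI: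
  assumes M: "entwined_module K D C \<psi> M" and N: "entwined_module K D C \<psi> N" and \<alpha>: "\<alpha> \<in> module_morphisms K D M N"
    and co: "\<And>X m. X \<in> Ob D \<Longrightarrow> m \<in> carrier (at_ob M X) \<Longrightarrow>
      coact N X (\<alpha> X m) = coact_sum M X (tensor K (at_ob N X) C) m (\<lambda>m0 m1. pure K (at_ob N X) C (\<alpha> X m0) m1)"
  shows "\<alpha> \<in> entwined_morphisms K D C M N"
proof -
  have "coact N X (\<alpha> X m) = tsum (tensor K (at_ob N X) C) (coact M X m) (\<lambda>m0 m1. pure K (at_ob N X) C (\<alpha> X m0) m1)"
    if X: "X \<in> Ob D" and m: "m \<in> carrier (at_ob M X)" for X m
  proof -
    note [simp] = linear_map_rules(1,2)[OF module_morphismsD(1)[OF \<alpha> X], simplified M N X entwined_module_right_module module_at_ob simp_thms]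
       module_morphismsD(1)[OF \<alpha> X]
    show ?thesis unfolding co[OF X m] by (rule sym, intro tsum_eq_sweedler) (simp_all add: M N X m)
  qed
  with \<alpha> show ?thesis by (simp add: entwined_morphisms_def)
qed

lemma compose_entwined_morphisms:
  assumes M: "entwined_module K D C \<psi> M" and N: "entwined_module K D C \<psi> N" and P: "entwined_module K D C \<psi> P"
    and a: "\<alpha> \<in> entwined_morphisms K D C M N" and b: "\<beta> \<in> entwined_morphisms K D C N P"
  shows "compose_morphisms D M \<beta> \<alpha> \<in> entwined_morphisms K D C M P"
proof (rule entwined_morphismsI[OF M P])
  note \<alpha> = entwined_morphismsD[OF M N a] and \<beta> = entwined_morphismsD[OF N P b]
  show "compose_morphisms D M \<beta> \<alpha> \<in> module_morphisms K D M P"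
    by (rule compose_module_morphisms[OF _ _ _ \<alpha>(1) \<beta>(1)]) (simp_all add: M N P)
  fix X m assume X: "X \<in> Ob D" and m: "m \<in> carrier (at_ob M X)"
  note l = linear_map_rules[OF module_morphismsD(1)[OF \<alpha>(1) X], simplified M N P X entwined_module_right_module module_at_ob simp_thms]
    linear_map_rules[OF module_morphismsD(1)[OF \<beta>(1) X], simplified M N P X entwined_module_right_module module_at_ob simp_thms]
    module_morphismsD(1)[OF \<alpha>(1) X] module_morphismsD(1)[OF \<beta>(1) X]
  show "coact P X (compose_morphisms D M \<beta> \<alpha> X m) =
    coact_sum M X (tensor K (at_ob P X) C) m (\<lambda>m0 m1. pure K (at_ob P X) C (compose_morphisms D M \<beta> \<alpha> X m0) m1)"
    by (simp add: compose_morphisms_eq X m \<alpha>(2) \<beta>(2) l M N P)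
qed

lemma identity_entwined_morphism:
  assumes M: "entwined_module K D C \<psi> M"
  shows "identity_morphism D M \<in> entwined_morphisms K D C M M"
  by (rule entwined_morphismsI[OF M M])
    (simp_all add: identity_module_morphism M, simp add: identity_morphism_def M)

lemma category_entwined: "category entwined_cat"
proof unfold_locales
  note mm = entwined_morphism_module_morphism
  show "Comp entwined_cat M N N (Ident entwined_cat N) f = f" "Comp entwined_cat M M N f (Ident entwined_cat M) = f"
    if "M \<in> Ob entwined_cat" "N \<in> Ob entwined_cat" "f \<in> Arr entwined_cat M N" for M N f
    using that by (simp_all add: compose_identity_morphism[of M N f] mm)
  show "Comp entwined_cat L N P h (Comp entwined_cat L M N g f) = Comp entwined_cat L M P (Comp entwined_cat M N P h g) f"
    if "f \<in> Arr entwined_cat L M" for L M N P f g h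
    using that by (simp add: compose_morphisms_assoc mm)
qed (auto simp: identity_entwined_morphism intro: compose_entwined_morphisms)

subsection \<open>The functors\<close>

abbreviation forget :: "('k, 'o, 'm, 'u, 'c) entwined_module \<Rightarrow> ('k, 'o, 'm, 'u) right_module" where
  "forget \<equiv> right_module.truncate"

lemma at_ob_forget [simp]: "at_ob (forget M) = at_ob M" and act_forget [simp]: "act (forget M) = act M"
  by (simp_all add: right_module.truncate_def)

lemma right_module_forget [simp]: "right_module K D (forget M) \<longleftrightarrow> right_module K D M"
  unfolding right_module_def right_module_axioms_def at_ob_forget act_forget ..

lemma module_morphisms_forget [simp]:
  "module_morphisms K D (forget M) N = module_morphisms K D M N"
  "module_morphisms K D N' (forget M) = module_morphisms K D N' M"
  by (simp_all add: module_morphisms_def)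

lemma identity_morphism_forget: "identity_morphism D (forget M) = identity_morphism D M"
  and compose_morphisms_forget: "compose_morphisms D (forget M) = compose_morphisms D M"
  by (simp_all add: identity_morphism_def compose_morphisms_def fun_eq_iff)

abbreviation forget_functor ::
  "(('k, 'o, 'm, 'u, 'c) entwined_module, 'o \<Rightarrow> 'u \<Rightarrow> 'u, ('k, 'o, 'm, 'u) right_module, 'o \<Rightarrow> 'u \<Rightarrow> 'u) cat_functor" where
  "forget_functor \<equiv> forgetful"

abbreviation cofree_functor ::
  "(('k, 'o, 'm, 'u) right_module, 'o \<Rightarrow> 'u \<Rightarrow> 'u, ('k, 'o, 'm, 'u, 'c) entwined_module, 'o \<Rightarrow> 'u \<Rightarrow> 'u) cat_functor" where
  "cofree_functor \<equiv> tensor_coalgebra K D C \<psi>"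

lemma functor_simps [simp]:
  "on_ob forget_functor = forget" "on_arr forget_functor M M' \<alpha> = \<alpha>" "on_ob cofree_functor = cofree"
  by (simp_all add: forgetful_def tensor_coalgebra_def)

lemma functor_forgetful: "cat_functor entwined_cat module_cat forget_functor"
  by (intro cat_functor.intro category_entwined category_modules cat_functor_axioms.intro)
    (simp_all add: identity_morphism_forget compose_morphisms_forget entwined_morphism_module_morphism)

text \<open>
  The functor \<open>\<G>\<close> on arrows, with its \<open>tsum\<close> replaced by a Sweedler sum.
\<close>

definition cofree_map :: "('k, 'o, 'm, 'u) right_module \<Rightarrow> ('k, 'o, 'm, 'u) right_module \<Rightarrow>
    ('o \<Rightarrow> 'u \<Rightarrow> 'u) \<Rightarrow> 'o \<Rightarrow> 'u \<Rightarrow> 'u" where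
  "cofree_map N P \<alpha> = (\<lambda>X\<in>Ob D. \<lambda>t\<in>carrier (transport (at_tensor N X)).
     encode (at_tensor P X) (sweedler (at_ob N X) C (at_tensor P X) (decode (at_tensor N X) t)
       (\<lambda>n c. pure K (at_ob P X) C (\<alpha> X n) c)))"

lemma tensor_coalgebra_arr:
  assumes N: "right_module K D N" and P: "right_module K D P" and \<alpha>: "\<alpha> \<in> module_morphisms K D N P"
  shows "on_arr cofree_functor N P \<alpha> = cofree_map N P \<alpha>"
proof -
  have "tsum (at_tensor P X) (decode (at_tensor N X) t) (\<lambda>n c. pure K (at_ob P X) C (\<alpha> X n) c) =
     sweedler (at_ob N X) C (at_tensor P X) (decode (at_tensor N X) t) (\<lambda>n c. pure K (at_ob P X) C (\<alpha> X n) c)"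
    if X: "X \<in> Ob D" and t: "t \<in> carrier (transport (at_tensor N X))" for X and t :: 'u
  proof -
    note [simp] = linear_map_rules(1,2)[OF module_morphismsD(1)[OF \<alpha> X], simplified N P X module_at_ob simp_thms] module_morphismsD(1)[OF \<alpha> X]
    show ?thesis by (intro tsum_eq_sweedler) (simp_all add: N P X t)
  qed
  then show ?thesis by (simp add: tensor_coalgebra_def cofree_map_def cong: restrict_cong)
qed

lemma cofree_map_entwined:
  assumes N: "right_module K D N" and P: "right_module K D P" and \<alpha>: "\<alpha> \<in> module_morphisms K D N P"
  shows "cofree_map N P \<alpha> \<in> entwined_morphisms K D C (cofree N) (cofree P)"
proof (rule entwined_morphismsI)
  note l [simp] = linear_map_rules[OF module_morphismsD(1)[OF \<alpha>], simplified N P module_at_ob] module_morphismsD(1)[OF \<alpha>]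
    N P act_cofree[OF N] act_cofree[OF P] coact_cofree[OF N] coact_cofree[OF P]
  have "(\<lambda>X\<in>Ob D. \<lambda>t\<in>carrier (at_ob (cofree N) X).
     encode (at_tensor P X) (sweedler (at_ob N X) C (at_tensor P X) (decode (at_tensor N X) t)
       (\<lambda>n c. pure K (at_ob P X) C (\<alpha> X n) c))) \<in> module_morphisms K D (cofree N) (cofree P)"
    by (rule module_morphismsI) (simp_all add: module_morphismsD(2)[OF \<alpha>])
  then show "cofree_map N P \<alpha> \<in> module_morphisms K D (cofree N) (cofree P)" by (simp add: cofree_map_def)
  fix X t assume X [simp]: "X \<in> Ob D" and "t \<in> carrier (at_ob (cofree N) X)"
  then have [simp]: "t \<in> carrier (transport (at_tensor N X))" by simp
  show "coact (cofree P) X (cofree_map N P \<alpha> X t) =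
    coact_sum (cofree N) X (tensor K (at_ob (cofree P) X) C) t
     (\<lambda>m0 m1. pure K (at_ob (cofree P) X) C (cofree_map N P \<alpha> X m0) m1)"
    by (simp add: cofree_map_def)
qed (simp_all add: N P)

lemma functor_cofree: "cat_functor module_cat entwined_cat cofree_functor"
proof (intro cat_functor.intro category_entwined category_modules cat_functor_axioms.intro)
  note mm = entwined_morphism_module_morphism
  show "on_ob cofree_functor N \<in> Ob entwined_cat" if "N \<in> Ob module_cat" for N
    using that by simp
  show "on_arr cofree_functor N P f \<in> Arr entwined_cat (on_ob cofree_functor N) (on_ob cofree_functor P)"
    if "N \<in> Ob module_cat" "P \<in> Ob module_cat" "f \<in> Arr module_cat N P" for N P f
    using that by (simp add: tensor_coalgebra_arr cofree_map_entwined)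
  show "on_arr cofree_functor N N (Ident module_cat N) = Ident entwined_cat (on_ob cofree_functor N)"
    if "N \<in> Ob module_cat" for N
  proof -
    have N: "right_module K D N" using that by simp
    have "cofree_map N N (identity_morphism D N) = identity_morphism D (cofree N)"
      by (rule module_morphism_eqI[OF mm[OF cofree_map_entwined] identity_module_morphism])
        (simp_all add: N identity_module_morphism, simp add: cofree_map_def identity_morphism_def N)
    then show ?thesis by (simp add: tensor_coalgebra_arr N identity_module_morphism)
  qed
  show "on_arr cofree_functor N Q (Comp module_cat N P Q g f) =
      Comp entwined_cat (on_ob cofree_functor N) (on_ob cofree_functor P) (on_ob cofree_functor Q)
        (on_arr cofree_functor P Q g) (on_arr cofree_functor N P f)"
    if "N \<in> Ob module_cat" "P \<in> Ob module_cat" "Q \<in> Ob module_cat" "f \<in> Arr module_cat N P" "g \<in> Arr module_cat P Q"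
    for N P Q f g
  proof -
    have o: "right_module K D N" "right_module K D P" "right_module K D Q"
      and f: "f \<in> module_morphisms K D N P" and g: "g \<in> module_morphisms K D P Q" using that by simp_all
    note l = linear_map_rules[OF module_morphismsD(1)[OF f], simplified o module_at_ob] module_morphismsD(1)[OF f]
      linear_map_rules[OF module_morphismsD(1)[OF g], simplified o module_at_ob] module_morphismsD(1)[OF g]
    have "cofree_map N Q (compose_morphisms D N g f) = compose_morphisms D (cofree N) (cofree_map P Q g) (cofree_map N P f)"
      by (rule module_morphism_eqI[OF mm[OF cofree_map_entwined] mm[OF compose_entwined_morphisms[of _ "cofree P"]]])
        (simp_all add: o f g compose_module_morphisms[OF o f g] cofree_map_entwined,
         simp add: cofree_map_def compose_morphisms_eq o l)
    then show ?thesis by (simp add: tensor_coalgebra_arr o f g compose_module_morphisms[OF o f g])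
  qed
qed

subsection \<open>The forgetful functor is a left adjoint\<close>

lemma pure_smult_left:
  "\<lbrakk>module K V; module K W; a \<in> carrier K; v \<in> carrier V; w \<in> carrier W\<rbrakk> \<Longrightarrow>
    pure K V W (a \<odot>\<^bsub>V\<^esub> v) w = a \<odot>\<^bsub>tensor K V W\<^esub> pure K V W v w"
  by (rule linear_maps_smult[OF pure_linear_left])

lemma act_smult_right:
  "\<lbrakk>right_module K D M; X \<in> Ob D; Y \<in> Ob D; f \<in> carrier (Hom D Y X); m \<in> carrier (at_ob M X); a \<in> carrier K\<rbrakk> \<Longrightarrow>
    act M Y X f (a \<odot>\<^bsub>at_ob M X\<^esub> m) = a \<odot>\<^bsub>at_ob M Y\<^esub> act M Y X f m"
  by (rule linear_maps_smult) simp_all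

lemma act_smult_left:
  "\<lbrakk>right_module K D M; X \<in> Ob D; Y \<in> Ob D; f \<in> carrier (Hom D Y X); m \<in> carrier (at_ob M X); a \<in> carrier K\<rbrakk> \<Longrightarrow>
    act M Y X (a \<odot>\<^bsub>Hom D Y X\<^esub> f) m = a \<odot>\<^bsub>at_ob M Y\<^esub> act M Y X f m"
  by (rule linear_maps_smult[where f="\<lambda>f. act M Y X f m"]) simp_all

lemma decode_smult:
  "\<lbrakk>module K T; inj_on (encode T :: _ \<Rightarrow> 'u) (carrier T); a \<in> carrier K; y \<in> carrier (transport T)\<rbrakk> \<Longrightarrow>
    decode T (a \<odot>\<^bsub>transport T\<^esub> (y :: 'u)) = a \<odot>\<^bsub>T\<^esub> decode T y"
  by (rule linear_maps_smult[OF decode_linear])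

text \<open>
  The unit \<open>M \<rightarrow> \<G>\<F>M\<close> of the adjunction with \<open>\<F>\<close> on the left.
\<close>

definition coaction_map :: "('k, 'o, 'm, 'u, 'c) entwined_module \<Rightarrow> 'o \<Rightarrow> 'u \<Rightarrow> 'u" where
  "coaction_map M = (\<lambda>X\<in>Ob D. \<lambda>m\<in>carrier (at_ob M X). encode (at_tensor (forget M) X) (coact M X m))"

text \<open>
  The map \<open>id \<otimes> \<epsilon>\<close>, the counit of the adjunction with \<open>\<F>\<close> on the left.
\<close>

definition counit_map :: "('k, 'o, 'm, 'u) right_module \<Rightarrow> 'o \<Rightarrow> 'u \<Rightarrow> 'u" where
  "counit_map N = (\<lambda>X\<in>Ob D. \<lambda>t\<in>carrier (transport (at_tensor N X)).
     sweedler (at_ob N X) C (at_ob N X) (decode (at_tensor N X) t) (\<lambda>n c. counit C c \<odot>\<^bsub>at_ob N X\<^esub> n))"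

text \<open>
  The coaction is \<open>D\<close>-linear by the axiom of entwined modules, and it is colinear by coassociativity.
\<close>

lemma coaction_map_entwined:
  assumes M: "entwined_module K D C \<psi> M"
  shows "coaction_map M \<in> entwined_morphisms K D C M (cofree (forget M))"
proof (rule entwined_morphismsI)
  note [simp] = M act_cofree[where N="forget M", simplified] coact_cofree[where N="forget M", simplified]
  show "coaction_map M \<in> module_morphisms K D M (cofree (forget M))" unfolding coaction_map_def
    by (rule module_morphismsI) (simp_all add: coact_act_sweedler)
  fix X m assume X [simp]: "X \<in> Ob D" and m [simp]: "m \<in> carrier (at_ob M X)"
  show "coact (cofree (forget M)) X (coaction_map M X m) =
    coact_sum M X (tensor K (at_ob (cofree (forget M)) X) C) m
     (\<lambda>m0 m1. pure K (at_ob (cofree (forget M)) X) C (coaction_map M X m0) m1)"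
  proof -
    let ?U = "tensor K (transport (tensor K (at_ob M X) C) :: ('k, 'u) module) C"
    have "coact (cofree (forget M)) X (coaction_map M X m) =
      coact_sum M X ?U m (\<lambda>m0 m1. comult_sum ?U m1 (\<lambda>c1 c2.
        pure K (transport (tensor K (at_ob M X) C)) C (encode (tensor K (at_ob M X) C) (pure K (at_ob M X) C m0 c1)) c2))"
      by (simp add: coaction_map_def)
    also have "\<dots> = coact_sum M X ?U m (\<lambda>m0 m1. coact_sum M X ?U m0 (\<lambda>m00 m01.
        pure K (transport (tensor K (at_ob M X) C)) C (encode (tensor K (at_ob M X) C) (pure K (at_ob M X) C m00 m01)) m1))"
      by (rule coact_coassoc_sweedler[symmetric]) simp_all
    also have "\<dots> = coact_sum M X ?U m (\<lambda>m0 m1.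
        pure K (transport (tensor K (at_ob M X) C)) C (encode (tensor K (at_ob M X) C) (coact_sum M X (tensor K (at_ob M X) C) m0 (pure K (at_ob M X) C))) m1)"
      by (simp add: encode_sweedler del: sweedler_ident)
    also have "\<dots> = coact_sum M X ?U m (\<lambda>m0 m1.
        pure K (transport (tensor K (at_ob M X) C)) C (coaction_map M X m0) m1)"
      by (simp add: coaction_map_def)
    finally show ?thesis by simp
  qed
qed (simp_all add: M)

text \<open>
  \<open>D\<close>-linearity is compatibility of \<open>\<psi>\<close> with the counit of \<open>C\<close>.
\<close>

lemma counit_map_morphism:
  assumes N: "right_module K D N"
  shows "counit_map N \<in> module_morphisms K D (cofree N) N"
proof -
  note [simp] = N act_cofree[OF N]
  have "(\<lambda>X\<in>Ob D. \<lambda>t\<in>carrier (at_ob (cofree N) X).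
     sweedler (at_ob N X) C (at_ob N X) (decode (at_tensor N X) t) (\<lambda>n c. counit C c \<odot>\<^bsub>at_ob N X\<^esub> n)) \<in> module_morphisms K D (cofree N) N"
    by (rule module_morphismsI) (simp_all add: \<psi>_counit_sweedler act_smult_right)
  then show ?thesis by (simp add: counit_map_def)
qed

text \<open>
  One triangle is the counit axiom of the comodules \<open>M(X)\<close>, the other is the counit axiom of \<open>C\<close>.
\<close>

lemma forgetful_left_adjoint: "left_adjoint entwined_cat module_cat forget_functor cofree_functor"
proof (rule left_adjoint_of_unit_counit[OF functor_forgetful functor_cofree, where u=coaction_map and e=counit_map])
  show "coaction_map M \<in> Arr entwined_cat M (on_ob cofree_functor (on_ob forget_functor M))" if "M \<in> Ob entwined_cat" for M
    using that by (simp add: coaction_map_entwined)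
  show "counit_map N \<in> Arr module_cat (on_ob forget_functor (on_ob cofree_functor N)) N" if "N \<in> Ob module_cat" for N
    using that by (simp add: counit_map_morphism)
next
  fix M assume "M \<in> Ob entwined_cat"
  then have [simp]: "entwined_module K D C \<psi> M" by simp
  show "Comp module_cat (on_ob forget_functor M) (on_ob forget_functor (on_ob cofree_functor (on_ob forget_functor M)))
      (on_ob forget_functor M) (counit_map (on_ob forget_functor M))
      (on_arr forget_functor M (on_ob cofree_functor (on_ob forget_functor M)) (coaction_map M)) =
    Ident module_cat (on_ob forget_functor M)"
    by (simp add: compose_morphisms_eq identity_morphism_def coaction_map_def counit_map_def coact_counit_sweedler cong: restrict_cong)
next
  fix N assume "N \<in> Ob module_cat"
  then have N [simp]: "right_module K D N" by simp
  show "Comp entwined_cat (on_ob cofree_functor N) (on_ob cofree_functor (on_ob forget_functor (on_ob cofree_functor N)))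
      (on_ob cofree_functor N) (on_arr cofree_functor (on_ob forget_functor (on_ob cofree_functor N)) N (counit_map N))
      (coaction_map (on_ob cofree_functor N)) =
    Ident entwined_cat (on_ob cofree_functor N)"
    by (simp add: tensor_coalgebra_arr counit_map_morphism, simp add: compose_morphisms_eq identity_morphism_def coaction_map_def
      counit_map_def cofree_map_def coact_cofree[OF N] pure_smult_left counit_left_sweedler cong: restrict_cong)
next
  fix M M' f assume "M \<in> Ob entwined_cat" "M' \<in> Ob entwined_cat" "f \<in> Arr entwined_cat M M'"
  then have M [simp]: "entwined_module K D C \<psi> M" "entwined_module K D C \<psi> M'" and f: "f \<in> entwined_morphisms K D C M M'" by simp_all
  note f' = entwined_morphismsD[OF M f]
  note [simp] = linear_map_rules[OF module_morphismsD(1)[OF f'(1)], simplified M module_at_ob entwined_module_right_module] module_morphismsD(1)[OF f'(1)]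
  show "Comp entwined_cat M M' (on_ob cofree_functor (on_ob forget_functor M')) (coaction_map M') f =
    Comp entwined_cat M (on_ob cofree_functor (on_ob forget_functor M)) (on_ob cofree_functor (on_ob forget_functor M'))
      (on_arr cofree_functor (on_ob forget_functor M) (on_ob forget_functor M') (on_arr forget_functor M M' f)) (coaction_map M)"
    by (simp add: tensor_coalgebra_arr f'(1) compose_morphisms_eq coaction_map_def cofree_map_def f'(2) cong: restrict_cong)
next
  fix N N' g assume "N \<in> Ob module_cat" "N' \<in> Ob module_cat" "g \<in> Arr module_cat N N'"
  then have N [simp]: "right_module K D N" "right_module K D N'" and g: "g \<in> module_morphisms K D N N'" by simp_all
  note [simp] = linear_map_rules[OF module_morphismsD(1)[OF g], simplified N module_at_ob] module_morphismsD(1)[OF g]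
  show "Comp module_cat (on_ob forget_functor (on_ob cofree_functor N)) (on_ob forget_functor (on_ob cofree_functor N')) N' (counit_map N')
      (on_arr forget_functor (on_ob cofree_functor N) (on_ob cofree_functor N') (on_arr cofree_functor N N' g)) =
    Comp module_cat (on_ob forget_functor (on_ob cofree_functor N)) N N' g (counit_map N)"
    by (simp add: tensor_coalgebra_arr g compose_morphisms_eq counit_map_def cofree_map_def
      linear_maps_smult[OF module_morphismsD(1)[OF g]] cong: restrict_cong)
qed

subsection \<open>The spaces of natural transformations in terms of Sweedler sums\<close>

text \<open>
  Translating the remaining two conditions into Sweedler sums presupposes the linearity of \<open>\<theta>\<close>, which is
  the first of them; hence the case distinction.
\<close>

lemma V1_iff:
  "\<theta> \<in> V1 K D C \<psi> \<longleftrightarrow>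
    (\<forall>X\<in>Ob D. \<theta> X \<in> linear_maps K (tensor K C C) (Hom D X X)) \<and>
    (\<forall>X\<in>Ob D. \<forall>Y\<in>Ob D. \<forall>f\<in>carrier (Hom D Y X). \<forall>c\<in>carrier C. \<forall>d\<in>carrier C.
      Comp D Y X X (\<theta> X (pure K C C c d)) f =
      entwine_sum Y X (Hom D Y X) d f (\<lambda>f' d'.
        entwine_sum Y X (Hom D Y X) c f' (\<lambda>f'' c'. Comp D Y Y X f'' (\<theta> Y (pure K C C c' d'))))) \<and>
    (\<forall>X\<in>Ob D. \<forall>c\<in>carrier C. \<forall>d\<in>carrier C.
      comult_sum (tensor K (Hom D X X) C) d (\<lambda>d1 d2. pure K (Hom D X X) C (\<theta> X (pure K C C c d1)) d2) =
      comult_sum (tensor K (Hom D X X) C) c (\<lambda>c1 c2. entwine X X c1 (\<theta> X (pure K C C c2 d))))"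
  (is "_ \<longleftrightarrow> ?linear \<and> _")
proof (cases ?linear)
  case True
  then have lin: "X \<in> Ob D \<Longrightarrow> \<theta> X \<in> linear_maps K (tensor K C C) (Hom D X X)" for X by blast
  note [simp] = linear_map_rules(1,2)[OF lin, simplified] lin
  have natural: "tsum (Hom D Y X) (entwine Y X d f) (\<lambda>f' d'.
        tsum (Hom D Y X) (entwine Y X c f') (\<lambda>f'' c'. Comp D Y Y X f'' (\<theta> Y (pure K C C c' d')))) =
      entwine_sum Y X (Hom D Y X) d f (\<lambda>f' d'.
        entwine_sum Y X (Hom D Y X) c f' (\<lambda>f'' c'. Comp D Y Y X f'' (\<theta> Y (pure K C C c' d'))))"
    if "X \<in> Ob D" "Y \<in> Ob D" "f \<in> carrier (Hom D Y X)" "c \<in> carrier C" "d \<in> carrier C" for X Y f c d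
    by (intro tsum_eq_sweedler) (simp_all add: that)
  have colinear:
    "tsum (tensor K (Hom D X X) C) (comult C d) (\<lambda>d1 d2. pure K (Hom D X X) C (\<theta> X (pure K C C c d1)) d2) =
      comult_sum (tensor K (Hom D X X) C) d (\<lambda>d1 d2. pure K (Hom D X X) C (\<theta> X (pure K C C c d1)) d2)"
    "tsum (tensor K (Hom D X X) C) (comult C c) (\<lambda>c1 c2. entwine X X c1 (\<theta> X (pure K C C c2 d))) =
      comult_sum (tensor K (Hom D X X) C) c (\<lambda>c1 c2. entwine X X c1 (\<theta> X (pure K C C c2 d)))"
    if "X \<in> Ob D" "c \<in> carrier C" "d \<in> carrier C" for X c d
    by (intro tsum_eq_sweedler; simp add: that)+
  show ?thesis unfolding V1_def by (simp add: natural colinear)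
next
  case False
  then show ?thesis unfolding V1_def by blast
qed

lemmas V1D = V1_iff[THEN iffD1, THEN conjunct1, rule_format]
  V1_iff[THEN iffD1, THEN conjunct2, THEN conjunct1, rule_format]
  V1_iff[THEN iffD1, THEN conjunct2, THEN conjunct2, rule_format]

lemma h_map_sweedler:
  assumes "X \<in> Ob D" "Y \<in> Ob D" "X' \<in> Ob D" "Y' \<in> Ob D" "f \<in> carrier (Hom D X Y)"
    "\<phi> \<in> carrier (tensor K (Hom D X' X) (Hom D Y Y'))"
  shows "h_map D X Y X' Y' \<phi> f = sweedler (Hom D X' X) (Hom D Y Y') (Hom D X' Y') \<phi> (\<lambda>\<phi>' \<phi>''. Comp D X' Y Y' \<phi>'' (Comp D X' X Y f \<phi>'))"
  unfolding h_map_def by (intro tsum_eq_sweedler) (simp_all add: assms)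

lemma hC_map_sweedler:
  assumes "X \<in> Ob D" "Y \<in> Ob D" "X' \<in> Ob D" "Y' \<in> Ob D" "t \<in> carrier (tensor K (Hom D X Y) C)"
    "\<phi> \<in> carrier (tensor K (Hom D X' X) (Hom D Y Y'))"
  shows "hC_map K D C \<psi> X Y X' Y' \<phi> t = sweedler (Hom D X' X) (Hom D Y Y') (tensor K (Hom D X' Y') C) \<phi> (\<lambda>\<phi>' \<phi>''.
       sweedler (Hom D X Y) C (tensor K (Hom D X' Y') C) t (\<lambda>f c.
         entwine_sum X' X (tensor K (Hom D X' Y') C) c \<phi>' (\<lambda>p c'.
           pure K (Hom D X' Y') C (Comp D X' Y Y' \<phi>'' (Comp D X' X Y f p)) c')))"
  unfolding hC_map_def by (intro tsum_eq_sweedler) (simp_all add: assms)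

text \<open>
  Every arrow is the image of an identity under composition on one side.  Naturality along the pure
  tensors \<open>id \<otimes> f\<close> and \<open>f \<otimes> id\<close> therefore expresses \<open>\<eta>(X, Y)(f)\<close> in two ways by values at identities.
\<close>

lemma W1D:
  assumes W1: "\<eta> \<in> W1 K D C \<psi>"
  shows "\<lbrakk>X \<in> Ob D; Y \<in> Ob D\<rbrakk> \<Longrightarrow> \<eta> X Y \<in> linear_maps K (Hom D X Y) (tensor K (Hom D X Y) C)"
    and "\<lbrakk>X \<in> Ob D; Y \<in> Ob D; f \<in> carrier (Hom D X Y)\<rbrakk> \<Longrightarrow>
      \<eta> X Y f = sweedler (Hom D X X) C (tensor K (Hom D X Y) C) (\<eta> X X (Ident D X)) (\<lambda>e c.
        pure K (Hom D X Y) C (Comp D X X Y f e) c)"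
    and "\<lbrakk>X \<in> Ob D; Y \<in> Ob D; f \<in> carrier (Hom D X Y)\<rbrakk> \<Longrightarrow>
      \<eta> X Y f = sweedler (Hom D Y Y) C (tensor K (Hom D X Y) C) (\<eta> Y Y (Ident D Y)) (\<lambda>e c.
        entwine_sum X Y (tensor K (Hom D X Y) C) c f (\<lambda>p c'.
          pure K (Hom D X Y) C (Comp D X Y Y e p) c'))"
proof -
  show lin: "\<eta> X Y \<in> linear_maps K (Hom D X Y) (tensor K (Hom D X Y) C)" if "X \<in> Ob D" "Y \<in> Ob D" for X Y
    using W1 that unfolding W1_def by blast
  have nat: "\<eta> X' Y' (h_map D X Y X' Y' \<phi> f) = hC_map K D C \<psi> X Y X' Y' \<phi> (\<eta> X Y f)"
    if "X \<in> Ob D" "Y \<in> Ob D" "X' \<in> Ob D" "Y' \<in> Ob D" "f \<in> Arr D X Y" "\<phi> \<in> carrier (tensor K (Hom D X' X) (Hom D Y Y'))"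
    for X Y X' Y' f \<phi>
    using W1 that unfolding W1_def by blast
  note [simp] = linear_map_rules(1,2)[OF lin, simplified]
  assume X: "X \<in> Ob D" "Y \<in> Ob D" and f: "f \<in> carrier (Hom D X Y)"
  have id: "Comp D X X Y f (Ident D X) = f" "Comp D X Y Y (Ident D Y) f = f"
     "Comp D X X X (Ident D X) (Ident D X) = Ident D X"
    using Comp_Ident_left Comp_Ident_right X f Ident_Arr by (simp_all del: Arr_eq_carrier add: carrier_Hom)
  have id': "Comp D X X X e (Ident D X) = e" if "e \<in> carrier (Hom D X X)" for e
    using Comp_Ident_right X that by simp
  have id'': "Comp D X Y Y (Ident D Y) g = g" if "g \<in> carrier (Hom D X Y)" for g
    using Comp_Ident_left X that by simp
  show "\<eta> X Y f = sweedler (Hom D X X) C (tensor K (Hom D X Y) C) (\<eta> X X (Ident D X)) (\<lambda>e c.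
        pure K (Hom D X Y) C (Comp D X X Y f e) c)"
  proof -
    let ?\<phi> = "pure K (Hom D X X) (Hom D X Y) (Ident D X) f"
    have "\<eta> X Y f = \<eta> X Y (h_map D X X X Y ?\<phi> (Ident D X))" by (simp add: X f h_map_sweedler id)
    also have "\<dots> = hC_map K D C \<psi> X X X Y ?\<phi> (\<eta> X X (Ident D X))" by (rule nat) (use f in \<open>simp_all add: X\<close>)
    finally show ?thesis by (simp add: X f hC_map_sweedler id')
  qed
  show "\<eta> X Y f = sweedler (Hom D Y Y) C (tensor K (Hom D X Y) C) (\<eta> Y Y (Ident D Y)) (\<lambda>e c.
        entwine_sum X Y (tensor K (Hom D X Y) C) c f (\<lambda>p c'.
          pure K (Hom D X Y) C (Comp D X Y Y e p) c'))"
  proof -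
    let ?\<phi> = "pure K (Hom D X Y) (Hom D Y Y) f (Ident D Y)"
    have "\<eta> X Y f = \<eta> X Y (h_map D Y Y X Y ?\<phi> (Ident D Y))" by (simp add: X f h_map_sweedler id)
    also have "\<dots> = hC_map K D C \<psi> Y Y X Y ?\<phi> (\<eta> Y Y (Ident D Y))" by (rule nat) (use f in \<open>simp_all add: X\<close>)
    finally show ?thesis by (simp add: X f hC_map_sweedler id'')
  qed
qed

text \<open>
  An arrow of \<open>D\<^sup>o\<^sup>p \<otimes> D\<close> is a sum of pure tensors, and each of these is a composite of arrows that
  change one argument only.
\<close>

lemma W1I:
  assumes lin: "\<And>X Y. \<lbrakk>X \<in> Ob D; Y \<in> Ob D\<rbrakk> \<Longrightarrow> \<eta> X Y \<in> linear_maps K (Hom D X Y) (tensor K (Hom D X Y) C)"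
    and left: "\<And>X Y Y' f g. \<lbrakk>X \<in> Ob D; Y \<in> Ob D; Y' \<in> Ob D; f \<in> carrier (Hom D X Y); g \<in> carrier (Hom D Y Y')\<rbrakk> \<Longrightarrow>
      \<eta> X Y' (Comp D X Y Y' g f) = sweedler (Hom D X Y) C (tensor K (Hom D X Y') C) (\<eta> X Y f) (\<lambda>f' c.
        pure K (Hom D X Y') C (Comp D X Y Y' g f') c)"
    and right: "\<And>X X' Y f g. \<lbrakk>X \<in> Ob D; X' \<in> Ob D; Y \<in> Ob D; f \<in> carrier (Hom D X Y); g \<in> carrier (Hom D X' X)\<rbrakk> \<Longrightarrow>
      \<eta> X' Y (Comp D X' X Y f g) = sweedler (Hom D X Y) C (tensor K (Hom D X' Y) C) (\<eta> X Y f) (\<lambda>f' c.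
        entwine_sum X' X (tensor K (Hom D X' Y) C) c g (\<lambda>p c'.
          pure K (Hom D X' Y) C (Comp D X' X Y f' p) c'))"
  shows "\<eta> \<in> W1 K D C \<psi>"
  unfolding W1_def
proof (intro CollectI conjI ballI)
  show "\<eta> X Y \<in> linear_maps K (Hom D X Y) (tensor K (Hom D X Y) C)" if "X \<in> Ob D" "Y \<in> Ob D" for X Y
    using that by (rule lin)
  note [simp] = linear_map_rules[OF lin, simplified]
  fix X Y X' Y' \<phi> f assume X: "X \<in> Ob D" "Y \<in> Ob D" "X' \<in> Ob D" "Y' \<in> Ob D"
    and \<phi>: "\<phi> \<in> carrier (tensor K (Hom D X' X) (Hom D Y Y'))" and "f \<in> Arr D X Y"
  then have f: "f \<in> carrier (Hom D X Y)" by simp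
  show "\<eta> X' Y' (h_map D X Y X' Y' \<phi> f) = hC_map K D C \<psi> X Y X' Y' \<phi> (\<eta> X Y f)"
  proof -
    have "\<eta> X' Y' (Comp D X' Y Y' w (Comp D X' X Y f v)) =
      sweedler (Hom D X Y) C (tensor K (Hom D X' Y') C) (\<eta> X Y f) (\<lambda>f' c.
        entwine_sum X' X (tensor K (Hom D X' Y') C) c v (\<lambda>p c'.
          pure K (Hom D X' Y') C (Comp D X' Y Y' w (Comp D X' X Y f' p)) c'))"
      if v: "v \<in> carrier (Hom D X' X)" and w: "w \<in> carrier (Hom D Y Y')" for v w
      using left[of X' Y Y' "Comp D X' X Y f v" w] by (simp add: X f v w right)
    then show ?thesis by (simp add: h_map_sweedler hC_map_sweedler X f \<phi>)
  qed
qed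

subsection \<open>Representable modules\<close>

text \<open>
  The functor \<open>Hom(-, Y)\<close>, moved into the universe.
\<close>

definition representable :: "'o \<Rightarrow> ('k, 'o, 'm, 'u) right_module" where
  "representable Y = \<lparr>at_ob = \<lambda>X. transport (Hom D X Y),
     act = \<lambda>X' X f t. encode (Hom D X' Y) (Comp D X' X Y (decode (Hom D X Y) t) f)\<rparr>"

lemma at_ob_representable [simp]: "at_ob (representable Y) X = transport (Hom D X Y)"
  and act_representable [simp]:
    "act (representable Y) X' X f t = encode (Hom D X' Y) (Comp D X' X Y (decode (Hom D X Y) t) f)"
  by (simp_all add: representable_def)

lemma Comp_Ident_Hom [simp]:
  "\<lbrakk>X \<in> Ob D; Y \<in> Ob D; f \<in> carrier (Hom D X Y)\<rbrakk> \<Longrightarrow> Comp D X X Y f (Ident D X) = f"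
  "\<lbrakk>X \<in> Ob D; Y \<in> Ob D; f \<in> carrier (Hom D X Y)\<rbrakk> \<Longrightarrow> Comp D X Y Y (Ident D Y) f = f"
  using Comp_Ident_left Comp_Ident_right by simp_all

lemma Comp_assoc_Hom:
  "\<lbrakk>W \<in> Ob D; X \<in> Ob D; Y \<in> Ob D; Z \<in> Ob D; f \<in> carrier (Hom D W X); g \<in> carrier (Hom D X Y); h \<in> carrier (Hom D Y Z)\<rbrakk> \<Longrightarrow>
    Comp D W Y Z h (Comp D W X Y g f) = Comp D W X Z (Comp D X Y Z h g) f"
  using Comp_assoc by simp

lemma right_module_representable [simp]:
  assumes Z [simp]: "Z \<in> Ob D"
  shows "right_module K D (representable Z)"
proof (intro right_module.intro right_module_axioms.intro)
  show "linear_category K D" by (rule linear_category_axioms)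
  fix X assume X [simp]: "X \<in> Ob D"
  show "module K (at_ob (representable Z) X)" by simp
  fix t assume "t \<in> carrier (at_ob (representable Z) X)"
  then have t [simp]: "t \<in> carrier (transport (Hom D X Z))" by simp
  show "act (representable Z) X X (Ident D X) t = t" by simp
  fix Y assume Y [simp]: "Y \<in> Ob D"
  show "(\<lambda>f. act (representable Z) Y X f t) \<in> linear_maps K (Hom D Y X) (at_ob (representable Z) Y)" by simp
next
  fix X Y f assume [simp]: "X \<in> Ob D" "Y \<in> Ob D" and "f \<in> Arr D Y X"
  then have [simp]: "f \<in> carrier (Hom D Y X)" by simp
  have "(\<lambda>t. act (representable Z) Y X f t) \<in> linear_maps K (at_ob (representable Z) X) (at_ob (representable Z) Y)" 
    unfolding act_representable by simp
  then show "act (representable Z) Y X f \<in> linear_maps K (at_ob (representable Z) X) (at_ob (representable Z) Y)" by (simp only:)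
next
  fix X Y W f g t assume [simp]: "X \<in> Ob D" "Y \<in> Ob D" "W \<in> Ob D" and "f \<in> Arr D X Y" "g \<in> Arr D Y W"
    and "t \<in> carrier (at_ob (representable Z) W)"
  then have [simp]: "f \<in> carrier (Hom D X Y)" "g \<in> carrier (Hom D Y W)" "t \<in> carrier (transport (Hom D W Z))" by simp_all
  show "act (representable Z) X W (Comp D X Y W g f) t = act (representable Z) X Y f (act (representable Z) Y W g t)"
    by (simp add: Comp_assoc_Hom)
qed

text \<open>
  The morphism from \<open>representable Z\<close> that sends \<open>id\<^sub>Z\<close> to \<open>n\<close>.
\<close>

definition yoneda_map :: "('k, 'o, 'm, 'u) right_module \<Rightarrow> 'o \<Rightarrow> 'u \<Rightarrow> 'o \<Rightarrow> 'u \<Rightarrow> 'u" where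
  "yoneda_map N Z n = (\<lambda>X\<in>Ob D. \<lambda>t\<in>carrier (transport (Hom D X Z)). act N X Z (decode (Hom D X Z) t) n)"

lemma yoneda_map_morphism:
  assumes N [simp]: "right_module K D N" and [simp]: "Z \<in> Ob D" "n \<in> carrier (at_ob N Z)"
  shows "yoneda_map N Z n \<in> module_morphisms K D (representable Z) N"
proof -
  have "(\<lambda>X\<in>Ob D. \<lambda>t\<in>carrier (at_ob (representable Z) X). act N X Z (decode (Hom D X Z) t) n) \<in> module_morphisms K D (representable Z) N"
    by (rule module_morphismsI) (simp_all add: right_module.act_Comp[OF N])
  then show ?thesis by (simp add: yoneda_map_def)
qed

end

section \<open>From the two transformations to the adjunction\<close>

text \<open>
  The two equations are stated at identity arrows, which is where the triangle identities use them: the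
  unit is built from \<open>\<eta>(X, X)(id\<^sub>X)\<close>.
\<close>

locale frobenius_data = entwined_universe K D C \<psi> universe
  for K :: "'k ring" and D :: "('k, 'o, 'm) linear_category" and C :: "('k, 'c) coalgebra"
    and \<psi> :: "('o, 'm, 'c) entwining" and universe :: "'u itself" +
  fixes \<theta> :: "'o \<Rightarrow> ('c, 'c) tensor \<Rightarrow> 'm" and \<eta> :: "'o \<Rightarrow> 'o \<Rightarrow> 'm \<Rightarrow> ('m, 'c) tensor"
  assumes V1: "\<theta> \<in> V1 K D C \<psi>" and W1: "\<eta> \<in> W1 K D C \<psi>"
    and \<eta>_\<theta>: "\<lbrakk>X \<in> Ob D; d \<in> carrier C\<rbrakk> \<Longrightarrow>
      sweedler (Hom D X X) C (Hom D X X) (\<eta> X X (Ident D X)) (\<lambda>e c. Comp D X X X e (\<theta> X (pure K C C c d))) =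
      counit C d \<odot>\<^bsub>Hom D X X\<^esub> Ident D X"
    and \<eta>_\<psi>_\<theta>: "\<lbrakk>X \<in> Ob D; d \<in> carrier C\<rbrakk> \<Longrightarrow>
      sweedler (Hom D X X) C (Hom D X X) (\<eta> X X (Ident D X)) (\<lambda>e c.
        entwine_sum X X (Hom D X X) d e (\<lambda>e' d'.
          Comp D X X X e' (\<theta> X (pure K C C d' c)))) =
      counit C d \<odot>\<^bsub>Hom D X X\<^esub> Ident D X"
begin

lemmas \<theta>_linear = V1D(1)[OF V1] and \<eta>_linear = W1D(1)[OF W1]
lemmas [simp] = linear_map_rules[OF \<theta>_linear, simplified] \<theta>_linear linear_map_rules[OF \<eta>_linear, simplified] \<eta>_linear

lemma act_Comp_Hom:
  "\<lbrakk>right_module K D M; X \<in> Ob D; Y \<in> Ob D; Z \<in> Ob D; f \<in> carrier (Hom D X Y); g \<in> carrier (Hom D Y Z);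
    m \<in> carrier (at_ob M Z)\<rbrakk> \<Longrightarrow> act M X Z (Comp D X Y Z g f) m = act M X Y f (act M Y Z g m)"
  using right_module.act_Comp[of K D M X Y Z f g m] by simp

lemma act_Ident_simp [simp]: "\<lbrakk>right_module K D M; X \<in> Ob D; m \<in> carrier (at_ob M X)\<rbrakk> \<Longrightarrow> act M X X (Ident D X) m = m"
  by (rule right_module.act_Ident)

text \<open>
  The first condition on \<open>\<theta>\<close>, acting on an element of a module.
\<close>

lemma act_\<theta>:
  assumes M [simp]: "right_module K D M" and [simp]: "X \<in> Ob D" "Y \<in> Ob D" "f \<in> carrier (Hom D Y X)" "c \<in> carrier C"
    "d \<in> carrier C" "m \<in> carrier (at_ob M X)"
  shows "act M Y X f (act M X X (\<theta> X (pure K C C c d)) m) =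
    entwine_sum Y X (at_ob M Y) d f (\<lambda>f' d'.
      entwine_sum Y X (at_ob M Y) c f' (\<lambda>f'' c'.
        act M Y Y (\<theta> Y (pure K C C c' d')) (act M Y X f'' m)))"
proof -
  have "act M Y X f (act M X X (\<theta> X (pure K C C c d)) m) = act M Y X (Comp D Y X X (\<theta> X (pure K C C c d)) f) m"
    by (rule act_Comp_Hom[symmetric]) simp_all
  also have "\<dots> = entwine_sum Y X (at_ob M Y) d f (\<lambda>f' d'.
      entwine_sum Y X (at_ob M Y) c f' (\<lambda>f'' c'.
        act M Y Y (\<theta> Y (pure K C C c' d')) (act M Y X f'' m)))"
    by (simp add: V1D(2)[OF V1] act_Comp_Hom)
  finally show ?thesis .
qed

text \<open>
  The second condition on \<open>\<theta>\<close>, under an arbitrary bilinear map.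
\<close>

lemma \<psi>_\<theta>_sweedler:
  assumes [simp]: "X \<in> Ob D" "c \<in> carrier C" "d \<in> carrier C" "module K T" and E: "bilinear K (Hom D X X) C T E"
  shows "comult_sum T c (\<lambda>c1 c2.
      entwine_sum X X T c1 (\<theta> X (pure K C C c2 d)) E) =
    comult_sum T d (\<lambda>d1 d2. E (\<theta> X (pure K C C c d1)) d2)"
proof -
  note [simp] = bilinearD[OF E]
  have "comult_sum T d (\<lambda>d1 d2. E (\<theta> X (pure K C C c d1)) d2) =
    sweedler (Hom D X X) C T (comult_sum (tensor K (Hom D X X) C) d
      (\<lambda>d1 d2. pure K (Hom D X X) C (\<theta> X (pure K C C c d1)) d2)) E" by simp
  also have "\<dots> = comult_sum T c (\<lambda>c1 c2.
      entwine_sum X X T c1 (\<theta> X (pure K C C c2 d)) E)"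
    by (simp add: V1D(3)[OF V1])
  finally show ?thesis by simp
qed

text \<open>
  The counit \<open>m \<otimes> d \<mapsto> M(\<theta>\<^sub>X(m\<^sub>1 \<otimes> d))(m\<^sub>0)\<close> of the adjunction with \<open>\<G>\<close> on the left.
\<close>

definition gf_counit :: "('k, 'o, 'm, 'u, 'c) entwined_module \<Rightarrow> 'o \<Rightarrow> 'u \<Rightarrow> 'u" where
  "gf_counit M = (\<lambda>X\<in>Ob D. \<lambda>t\<in>carrier (transport (at_tensor (forget M) X)).
     sweedler (at_ob M X) C (at_ob M X) (decode (at_tensor (forget M) X) t) (\<lambda>m d.
       coact_sum M X (at_ob M X) m (\<lambda>m0 m1. act M X X (\<theta> X (pure K C C m1 d)) m0)))"

text \<open>
  The unit \<open>n \<mapsto> \<Sum> N(e)(n) \<otimes> c\<close> of the same adjunction, for \<open>\<eta>(X, X)(id\<^sub>X) = \<Sum> e \<otimes> c\<close>.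
\<close>

definition fg_unit :: "('k, 'o, 'm, 'u) right_module \<Rightarrow> 'o \<Rightarrow> 'u \<Rightarrow> 'u" where
  "fg_unit N = (\<lambda>X\<in>Ob D. \<lambda>n\<in>carrier (at_ob N X). encode (at_tensor N X)
     (sweedler (Hom D X X) C (at_tensor N X) (\<eta> X X (Ident D X)) (\<lambda>e c. pure K (at_ob N X) C (act N X X e n) c)))"

text \<open>
  The first condition on \<open>\<theta>\<close> gives \<open>D\<close>-linearity: \<open>f\<close> passes \<open>d\<close> and then \<open>m\<^sub>1\<close>, just as it passes \<open>\<theta>\<^sub>X(m\<^sub>1 \<otimes> d)\<close>.
  The second gives colinearity, after coassociativity has split \<open>m\<^sub>1\<close>.
\<close>

lemma gf_counit_entwined:
  assumes M: "entwined_module K D C \<psi> M"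
  shows "gf_counit M \<in> entwined_morphisms K D C (cofree (forget M)) M"
proof (rule entwined_morphismsI)
  note [simp] = M act_cofree[where N="forget M", simplified] coact_cofree[where N="forget M", simplified]
  have "(\<lambda>X\<in>Ob D. \<lambda>t\<in>carrier (at_ob (cofree (forget M)) X).
     sweedler (at_ob M X) C (at_ob M X) (decode (at_tensor (forget M) X) t) (\<lambda>m d.
       coact_sum M X (at_ob M X) m (\<lambda>m0 m1. act M X X (\<theta> X (pure K C C m1 d)) m0)))
    \<in> module_morphisms K D (cofree (forget M)) M"
  proof (rule module_morphismsI)
    fix X Y f t assume [simp]: "X \<in> Ob D" "Y \<in> Ob D" "f \<in> carrier (Hom D Y X)"
      and "t \<in> carrier (at_ob (cofree (forget M)) X)"
    then have [simp]: "t \<in> carrier (transport (tensor K (at_ob M X) C))" by simp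
    \<comment> \<open>Expanding one side entwines \<open>f\<close> with \<open>d\<close> before it sums over the coaction of \<open>m\<close>; the other side
      does it in the opposite order.\<close>
    have swap: "entwine_sum Y X (at_ob M Y) d f (\<lambda>f' d'.
        coact_sum M X (at_ob M Y) m (\<lambda>m0 m1.
          entwine_sum Y X (at_ob M Y) m1 f' (\<lambda>f'' c'.
            act M Y Y (\<theta> Y (pure K C C c' d')) (act M Y X f'' m0)))) =
      coact_sum M X (at_ob M Y) m (\<lambda>m0 m1.
        entwine_sum Y X (at_ob M Y) d f (\<lambda>f' d'.
          entwine_sum Y X (at_ob M Y) m1 f' (\<lambda>f'' c'.
            act M Y Y (\<theta> Y (pure K C C c' d')) (act M Y X f'' m0))))"
      if [simp]: "m \<in> carrier (at_ob M X)" "d \<in> carrier C" for m d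
      by (rule sweedler_swap) simp_all
    show "sweedler (at_ob M Y) C (at_ob M Y) (decode (at_tensor (forget M) Y) (act (cofree (forget M)) Y X f t)) (\<lambda>m d.
       coact_sum M Y (at_ob M Y) m (\<lambda>m0 m1. act M Y Y (\<theta> Y (pure K C C m1 d)) m0)) =
      act M Y X f (sweedler (at_ob M X) C (at_ob M X) (decode (at_tensor (forget M) X) t) (\<lambda>m d.
       coact_sum M X (at_ob M X) m (\<lambda>m0 m1. act M X X (\<theta> X (pure K C C m1 d)) m0)))"
      by (simp add: coact_act_sweedler act_\<theta> swap)
  qed simp_all
  then show "gf_counit M \<in> module_morphisms K D (cofree (forget M)) M" by (simp add: gf_counit_def)
  fix X t assume [simp]: "X \<in> Ob D" and "t \<in> carrier (at_ob (cofree (forget M)) X)"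
  then have [simp]: "t \<in> carrier (transport (tensor K (at_ob M X) C))" by simp
  let ?T = "tensor K (at_ob M X) C"
  \<comment> \<open>the coaction of \<open>M(\<theta>\<^sub>X(m\<^sub>1 \<otimes> d))(m\<^sub>0)\<close>, in which the inner coaction comes from \<open>m\<^sub>0\<close>\<close>
  have key: "coact_sum M X ?T m (\<lambda>m0 m1. coact_sum M X ?T m0 (\<lambda>m00 m01.
      entwine_sum X X ?T m01 (\<theta> X (pure K C C m1 d)) (\<lambda>f' c'. pure K (at_ob M X) C (act M X X f' m00) c'))) =
    comult_sum ?T d (\<lambda>d1 d2. coact_sum M X ?T m (\<lambda>m0 m1.
      pure K (at_ob M X) C (act M X X (\<theta> X (pure K C C m1 d1)) m0) d2))"
    (is "?l = ?r") if [simp]: "m \<in> carrier (at_ob M X)" "d \<in> carrier C" for m d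
  proof -
    have "?l = coact_sum M X ?T m (\<lambda>m0 m1. comult_sum ?T m1 (\<lambda>c1 c2.
      entwine_sum X X ?T c1 (\<theta> X (pure K C C c2 d)) (\<lambda>f' c'. pure K (at_ob M X) C (act M X X f' m0) c')))"
      by (rule coact_coassoc_sweedler) simp_all
    also have "\<dots> = coact_sum M X ?T m (\<lambda>m0 m1. comult_sum ?T d (\<lambda>d1 d2. pure K (at_ob M X) C (act M X X (\<theta> X (pure K C C m1 d1)) m0) d2))"
      by (simp add: \<psi>_\<theta>_sweedler)
    also have "\<dots> = ?r" by (rule sweedler_swap) simp_all
    finally show ?thesis .
  qed
  show "coact M X (gf_counit M X t) =
    coact_sum (cofree (forget M)) X (tensor K (at_ob M X) C) t
     (\<lambda>t0 t1. pure K (at_ob M X) C (gf_counit M X t0) t1)"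
    by (simp add: gf_counit_def coact_act_sweedler key)
qed (simp_all add: M)

text \<open>
  Both sides are the image of \<open>\<eta>(Y, X)(f)\<close> under \<open>p \<otimes> c \<mapsto> N(p)(n) \<otimes> c\<close>, computed with the two expressions of
  \<open>W1D\<close>.
\<close>

lemma \<eta>_exchange:
  assumes N [simp]: "right_module K D N" and [simp]: "X \<in> Ob D" "Y \<in> Ob D" "f \<in> carrier (Hom D Y X)" "n \<in> carrier (at_ob N X)"
  shows "sweedler (Hom D Y Y) C (at_tensor N Y) (\<eta> Y Y (Ident D Y)) (\<lambda>e c. pure K (at_ob N Y) C (act N Y Y e (act N Y X f n)) c) =
    sweedler (Hom D X X) C (at_tensor N Y) (\<eta> X X (Ident D X)) (\<lambda>e c.
      entwine_sum Y X (at_tensor N Y) c f (\<lambda>p c'. pure K (at_ob N Y) C (act N Y X p (act N X X e n)) c'))"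
proof -
  let ?h = "\<lambda>t. sweedler (Hom D Y X) C (at_tensor N Y) t (\<lambda>p c. pure K (at_ob N Y) C (act N Y X p n) c)"
  have "?h (\<eta> Y X f) = sweedler (Hom D Y Y) C (at_tensor N Y) (\<eta> Y Y (Ident D Y)) (\<lambda>e c. pure K (at_ob N Y) C (act N Y Y e (act N Y X f n)) c)"
    by (subst W1D(2)[OF W1]) (simp_all add: act_Comp_Hom)
  moreover have "?h (\<eta> Y X f) = sweedler (Hom D X X) C (at_tensor N Y) (\<eta> X X (Ident D X)) (\<lambda>e c.
      entwine_sum Y X (at_tensor N Y) c f (\<lambda>p c'. pure K (at_ob N Y) C (act N Y X p (act N X X e n)) c'))"
    by (subst W1D(3)[OF W1]) (simp_all add: act_Comp_Hom)
  ultimately show ?thesis by simp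
qed

lemma fg_unit_morphism:
  assumes N: "right_module K D N"
  shows "fg_unit N \<in> module_morphisms K D N (cofree N)"
  unfolding fg_unit_def
proof (rule module_morphismsI)
  note [simp] = N act_cofree[OF N]
  show "(\<lambda>n. encode (at_tensor N X) (sweedler (Hom D X X) C (at_tensor N X) (\<eta> X X (Ident D X)) (\<lambda>e c. pure K (at_ob N X) C (act N X X e n) c)))
    \<in> linear_maps K (at_ob N X) (at_ob (cofree N) X)" if "X \<in> Ob D" for X
    using that by simp
  fix X Y f n assume [simp]: "X \<in> Ob D" "Y \<in> Ob D" "f \<in> carrier (Hom D Y X)" "n \<in> carrier (at_ob N X)"
  show "encode (at_tensor N Y) (sweedler (Hom D Y Y) C (at_tensor N Y) (\<eta> Y Y (Ident D Y)) (\<lambda>e c. pure K (at_ob N Y) C (act N Y Y e (act N Y X f n)) c)) =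
    act (cofree N) Y X f (encode (at_tensor N X) (sweedler (Hom D X X) C (at_tensor N X) (\<eta> X X (Ident D X)) (\<lambda>e c. pure K (at_ob N X) C (act N X X e n) c)))"
    by (simp add: \<eta>_exchange)
qed (rule N)

text \<open>
  Compatibility of coaction and action produces the left-hand side of the second equation with
  \<open>d = m\<^sub>1\<close>, which leaves
  \<open>\<epsilon>(m\<^sub>1) m\<^sub>0 = m\<close>.
\<close>

lemma triangle_forget:
  assumes M [simp]: "entwined_module K D C \<psi> M" and [simp]: "X \<in> Ob D" "m \<in> carrier (at_ob M X)"
  shows "gf_counit M X (fg_unit (forget M) X m) = m"
proof -
  let ?V = "at_ob M X" and ?t = "\<eta> X X (Ident D X)"
  have "gf_counit M X (fg_unit (forget M) X m) =
    sweedler (Hom D X X) C ?V ?t (\<lambda>e c. coact_sum M X ?V m (\<lambda>m0 m1.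
      entwine_sum X X ?V m1 e (\<lambda>e' d'. act M X X (\<theta> X (pure K C C d' c)) (act M X X e' m0))))"
    by (simp add: gf_counit_def fg_unit_def coact_act_sweedler)
  also have "\<dots> = coact_sum M X ?V m (\<lambda>m0 m1. sweedler (Hom D X X) C ?V ?t (\<lambda>e c.
      entwine_sum X X ?V m1 e (\<lambda>e' d'. act M X X (\<theta> X (pure K C C d' c)) (act M X X e' m0))))"
    by (rule sweedler_swap) simp_all
  also have "\<dots> = coact_sum M X ?V m (\<lambda>m0 m1. act M X X
     (sweedler (Hom D X X) C (Hom D X X) ?t (\<lambda>e c.
        entwine_sum X X (Hom D X X) m1 e (\<lambda>e' d'.
          Comp D X X X e' (\<theta> X (pure K C C d' c))))) m0)"
    by (simp add: act_Comp_Hom)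
  also have "\<dots> = coact_sum M X ?V m (\<lambda>m0 m1. counit C m1 \<odot>\<^bsub>?V\<^esub> m0)"
    by (simp only: \<eta>_\<psi>_\<theta> \<open>X \<in> Ob D\<close> cong: sweedler_cong) (simp add: act_smult_left)
  also have "\<dots> = m" by (rule coact_counit_sweedler) simp_all
  finally show ?thesis .
qed

text \<open>
  The second condition on \<open>\<theta>\<close> moves the comultiplication from \<open>c\<close> to \<open>d\<close>.  Then \<open>c\<close> and \<open>d\<^sub>1\<close> form the
  left-hand side of the first equation, which leaves \<open>n \<otimes> \<epsilon>(d\<^sub>1) d\<^sub>2 = n \<otimes> d\<close>.
\<close>

lemma triangle_cofree:
  assumes N [simp]: "right_module K D N" and [simp]: "X \<in> Ob D" and t [simp]: "t \<in> carrier (transport (at_tensor N X))"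
  shows "gf_counit (cofree N) X (cofree_map N (forget (cofree N)) (fg_unit N) X t) = t"
proof -
  let ?V = "at_ob N X" and ?t = "\<eta> X X (Ident D X)" and ?T = "at_tensor N X"
  note [simp] = act_cofree[OF N] coact_cofree[OF N]
  have key: "sweedler (Hom D X X) C ?T ?t (\<lambda>e c. comult_sum ?T d (\<lambda>d1 d2.
      pure K ?V C (act N X X (\<theta> X (pure K C C c d1)) (act N X X e n)) d2)) = pure K ?V C n d" (is "?l = _")
    if [simp]: "n \<in> carrier ?V" "d \<in> carrier C" for n d
  proof -
    have "?l = comult_sum ?T d (\<lambda>d1 d2. sweedler (Hom D X X) C ?T ?t (\<lambda>e c.
      pure K ?V C (act N X X (\<theta> X (pure K C C c d1)) (act N X X e n)) d2))"
      by (rule sweedler_swap) simp_all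
    also have "\<dots> = comult_sum ?T d (\<lambda>d1 d2. pure K ?V C
      (act N X X (sweedler (Hom D X X) C (Hom D X X) ?t (\<lambda>e c. Comp D X X X e (\<theta> X (pure K C C c d1)))) n) d2)"
      by (simp add: act_Comp_Hom)
    also have "\<dots> = comult_sum ?T d (\<lambda>d1 d2. counit C d1 \<odot>\<^bsub>?T\<^esub> pure K ?V C n d2)"
      by (simp only: \<eta>_\<theta> \<open>X \<in> Ob D\<close> cong: sweedler_cong) (simp add: act_smult_left pure_smult_left)
    also have "\<dots> = pure K ?V C n d" by (rule counit_left_sweedler) simp_all
    finally show ?thesis .
  qed
  have "gf_counit (cofree N) X (cofree_map N (forget (cofree N)) (fg_unit N) X t) =
    encode ?T (sweedler ?V C ?T (decode ?T t) (\<lambda>n d. sweedler (Hom D X X) C ?T ?t (\<lambda>e c. comult_sum ?T d (\<lambda>d1 d2.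
      pure K ?V C (act N X X (\<theta> X (pure K C C c d1)) (act N X X e n)) d2))))"
    by (simp add: gf_counit_def fg_unit_def cofree_map_def encode_sweedler \<psi>_\<theta>_sweedler)
  also have "\<dots> = encode ?T (sweedler ?V C ?T (decode ?T t) (pure K ?V C))"
    by (simp only: key cong: sweedler_cong)
  finally show ?thesis by simp
qed

lemma cofree_left_adjoint: "left_adjoint module_cat entwined_cat cofree_functor forget_functor"
proof (rule left_adjoint_of_unit_counit[OF functor_cofree functor_forgetful, where u=fg_unit and e=gf_counit])
  show "fg_unit N \<in> Arr module_cat N (on_ob forget_functor (on_ob cofree_functor N))" if "N \<in> Ob module_cat" for N
    using that by (simp add: fg_unit_morphism)
  show "gf_counit M \<in> Arr entwined_cat (on_ob cofree_functor (on_ob forget_functor M)) M" if "M \<in> Ob entwined_cat" for M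
    using that by (simp add: gf_counit_entwined)
next
  fix N assume "N \<in> Ob module_cat"
  then have [simp]: "right_module K D N" by simp
  show "Comp entwined_cat (on_ob cofree_functor N) (on_ob cofree_functor (on_ob forget_functor (on_ob cofree_functor N)))
      (on_ob cofree_functor N) (gf_counit (on_ob cofree_functor N))
      (on_arr cofree_functor N (on_ob forget_functor (on_ob cofree_functor N)) (fg_unit N)) =
    Ident entwined_cat (on_ob cofree_functor N)"
    by (simp add: tensor_coalgebra_arr fg_unit_morphism, simp add: compose_morphisms_eq identity_morphism_def
      triangle_cofree cong: restrict_cong)
next
  fix M assume "M \<in> Ob entwined_cat"
  then have [simp]: "entwined_module K D C \<psi> M" by simp
  show "Comp module_cat (on_ob forget_functor M) (on_ob forget_functor (on_ob cofree_functor (on_ob forget_functor M)))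
      (on_ob forget_functor M) (on_arr forget_functor (on_ob cofree_functor (on_ob forget_functor M)) M (gf_counit M))
      (fg_unit (on_ob forget_functor M)) =
    Ident module_cat (on_ob forget_functor M)"
    by (simp add: compose_morphisms_eq identity_morphism_def triangle_forget cong: restrict_cong)
next
  fix N N' f assume "N \<in> Ob module_cat" "N' \<in> Ob module_cat" "f \<in> Arr module_cat N N'"
  then have N [simp]: "right_module K D N" "right_module K D N'" and f: "f \<in> module_morphisms K D N N'" by simp_all
  note [simp] = linear_map_rules[OF module_morphismsD(1)[OF f], simplified N module_at_ob] module_morphismsD(1)[OF f]
  show "Comp module_cat N N' (on_ob forget_functor (on_ob cofree_functor N')) (fg_unit N') f =
    Comp module_cat N (on_ob forget_functor (on_ob cofree_functor N)) (on_ob forget_functor (on_ob cofree_functor N'))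
      (on_arr forget_functor (on_ob cofree_functor N) (on_ob cofree_functor N') (on_arr cofree_functor N N' f)) (fg_unit N)"
    by (simp add: tensor_coalgebra_arr f compose_morphisms_eq fg_unit_def cofree_map_def module_morphismsD(2)[OF f] cong: restrict_cong)
next
  fix M M' g assume "M \<in> Ob entwined_cat" "M' \<in> Ob entwined_cat" "g \<in> Arr entwined_cat M M'"
  then have M [simp]: "entwined_module K D C \<psi> M" "entwined_module K D C \<psi> M'" and g: "g \<in> entwined_morphisms K D C M M'" by simp_all
  note g' = entwined_morphismsD[OF M g]
  note [simp] = linear_map_rules[OF module_morphismsD(1)[OF g'(1)], simplified M module_at_ob entwined_module_right_module] module_morphismsD(1)[OF g'(1)]
  show "Comp entwined_cat (on_ob cofree_functor (on_ob forget_functor M)) (on_ob cofree_functor (on_ob forget_functor M')) M' (gf_counit M')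
      (on_arr cofree_functor (on_ob forget_functor M) (on_ob forget_functor M') (on_arr forget_functor M M' g)) =
    Comp entwined_cat (on_ob cofree_functor (on_ob forget_functor M)) M M' g (gf_counit M)"
    by (simp add: tensor_coalgebra_arr g'(1) compose_morphisms_eq gf_counit_def cofree_map_def g'(2) module_morphismsD(2)[OF g'(1)] cong: restrict_cong)
qed

end

section \<open>From the adjunction to the two transformations\<close>

text \<open>
  The unit \<open>\<omega>\<close> and the counit \<open>\<upsilon>\<close> of an adjunction with \<open>\<G>\<close> on the left, with their properties read at the
  elements of modules.
\<close>

locale cofree_adjunction = entwined_universe K D C \<psi> universe
  for K :: "'k ring" and D :: "('k, 'o, 'm) linear_category" and C :: "('k, 'c) coalgebra"
    and \<psi> :: "('o, 'm, 'c) entwining" and universe :: "'u itself" +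
  fixes \<omega> :: "('k, 'o, 'm, 'u) right_module \<Rightarrow> 'o \<Rightarrow> 'u \<Rightarrow> 'u"
    and \<upsilon> :: "('k, 'o, 'm, 'u, 'c) entwined_module \<Rightarrow> 'o \<Rightarrow> 'u \<Rightarrow> 'u"
  assumes \<omega>_morphism: "right_module K D N \<Longrightarrow> \<omega> N \<in> module_morphisms K D N (cofree N)"
    and \<upsilon>_morphism: "entwined_module K D C \<psi> M \<Longrightarrow> \<upsilon> M \<in> entwined_morphisms K D C (cofree (forget M)) M"
    and \<omega>_natural: "\<lbrakk>right_module K D N; right_module K D N'; \<alpha> \<in> module_morphisms K D N N'; X \<in> Ob D; n \<in> carrier (at_ob N X)\<rbrakk> \<Longrightarrow>
      \<omega> N' X (\<alpha> X n) = cofree_map N N' \<alpha> X (\<omega> N X n)"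
    and \<upsilon>_natural: "\<lbrakk>entwined_module K D C \<psi> M; entwined_module K D C \<psi> M'; \<beta> \<in> entwined_morphisms K D C M M'; X \<in> Ob D;
        t \<in> carrier (transport (at_tensor (forget M) X))\<rbrakk> \<Longrightarrow>
      \<upsilon> M' X (cofree_map (forget M) (forget M') \<beta> X t) = \<beta> X (\<upsilon> M X t)"
    and triangle_cofree: "\<lbrakk>right_module K D N; X \<in> Ob D; t \<in> carrier (transport (at_tensor N X))\<rbrakk> \<Longrightarrow>
      \<upsilon> (cofree N) X (cofree_map N (forget (cofree N)) (\<omega> N) X t) = t"
    and triangle_forget: "\<lbrakk>entwined_module K D C \<psi> M; X \<in> Ob D; m \<in> carrier (at_ob M X)\<rbrakk> \<Longrightarrow>
      \<upsilon> M X (\<omega> (forget M) X m) = m"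
begin

lemma \<omega>_linear: "\<lbrakk>right_module K D N; X \<in> Ob D\<rbrakk> \<Longrightarrow> \<omega> N X \<in> linear_maps K (at_ob N X) (transport (at_tensor N X))"
  using module_morphismsD(1)[OF \<omega>_morphism] by simp

lemma \<upsilon>_module_morphism:
  assumes "entwined_module K D C \<psi> M"
  shows "\<upsilon> M \<in> module_morphisms K D (cofree (forget M)) M"
  by (rule entwined_morphismsD(1)[OF _ _ \<upsilon>_morphism]) (simp_all add: assms)

lemma \<upsilon>_linear: "\<lbrakk>entwined_module K D C \<psi> M; X \<in> Ob D\<rbrakk> \<Longrightarrow>
    \<upsilon> M X \<in> linear_maps K (transport (tensor K (at_ob M X) C)) (at_ob M X)"
  using module_morphismsD(1)[OF \<upsilon>_module_morphism] by simp

lemma \<upsilon>_cofree_linear: "\<lbrakk>right_module K D N; X \<in> Ob D\<rbrakk> \<Longrightarrow>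
    \<upsilon> (cofree N) X \<in> linear_maps K (transport (tensor K (transport (at_tensor N X) :: ('k, 'u) module) C)) (transport (at_tensor N X))"
  using \<upsilon>_linear[of "cofree N"] by simp

lemma counit_map_linear: "\<lbrakk>right_module K D N; X \<in> Ob D\<rbrakk> \<Longrightarrow>
    counit_map N X \<in> linear_maps K (transport (at_tensor N X)) (at_ob N X)"
  using module_morphismsD(1)[OF counit_map_morphism] by simp

text \<open>
  Linearity at representable modules is stated separately, with the spaces in the form to
  which the simplifier rewrites \<open>at_ob\<close>.
\<close>

lemma \<omega>_representable_linear: "\<lbrakk>Y \<in> Ob D; X \<in> Ob D\<rbrakk> \<Longrightarrow>
    \<omega> (representable Y) X \<in> linear_maps K (transport (Hom D X Y)) (transport (tensor K (transport (Hom D X Y) :: ('k, 'u) module) C))"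
  using \<omega>_linear[of "representable Y"] by simp

lemma \<upsilon>_representable_linear: "\<lbrakk>Y \<in> Ob D; X \<in> Ob D\<rbrakk> \<Longrightarrow>
    \<upsilon> (cofree (representable Y)) X \<in> linear_maps K (transport (tensor K (transport (tensor K (transport (Hom D X Y) :: ('k, 'u) module) C) :: ('k, 'u) module) C))
      (transport (tensor K (transport (Hom D X Y) :: ('k, 'u) module) C))"
  using \<upsilon>_cofree_linear[of "representable Y"] by simp

lemma counit_map_representable_linear: "\<lbrakk>Y \<in> Ob D; X \<in> Ob D\<rbrakk> \<Longrightarrow>
    counit_map (representable Y) X \<in> linear_maps K (transport (tensor K (transport (Hom D X Y) :: ('k, 'u) module) C)) (transport (Hom D X Y))"
  using counit_map_linear[of "representable Y"] by simp

lemmas [simp] = \<omega>_linear \<upsilon>_linear \<upsilon>_cofree_linear counit_map_linear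
  \<omega>_representable_linear \<upsilon>_representable_linear counit_map_representable_linear
  linear_map_rules[OF \<omega>_linear, simplified] linear_map_rules[OF \<upsilon>_linear, simplified]
  linear_map_rules[OF \<upsilon>_cofree_linear, simplified] linear_map_rules[OF counit_map_linear, simplified]
  linear_map_rules[OF \<omega>_representable_linear, simplified] linear_map_rules[OF \<upsilon>_representable_linear, simplified]
  linear_map_rules[OF counit_map_representable_linear, simplified]

text \<open>
  The element \<open>(n \<otimes> c) \<otimes> d\<close> of \<open>(V \<otimes> C) \<otimes> C\<close>, with both tensor products moved into the universe.
\<close>

abbreviation pure2 :: "('k, 'u) module \<Rightarrow> 'u \<Rightarrow> 'c \<Rightarrow> 'c \<Rightarrow> 'u" where
  "pure2 V n c d \<equiv> encode (tensor K (transport (tensor K V C) :: ('k, 'u) module) C)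
     (pure K (transport (tensor K V C)) C (encode (tensor K V C) (pure K V C n c)) d)"

text \<open>
  The image of \<open>id\<^sub>X \<otimes> c \<otimes> d\<close> under \<open>\<upsilon>\<close> at \<open>\<G>(h\<^sub>X)\<close> followed by \<open>id \<otimes> \<epsilon>\<close>.
\<close>

definition \<theta> :: "'o \<Rightarrow> ('c, 'c) tensor \<Rightarrow> 'm" where
  "\<theta> X t = sweedler C C (Hom D X X) t (\<lambda>c d. decode (Hom D X X) (counit_map (representable X) X
     (\<upsilon> (cofree (representable X)) X (pure2 (transport (Hom D X X)) (encode (Hom D X X) (Ident D X)) c d))))"

text \<open>
  The unit \<open>\<omega>\<close> at the representable module \<open>h\<^sub>Y\<close>, taken back out of the universe.
\<close>

definition \<eta> :: "'o \<Rightarrow> 'o \<Rightarrow> 'm \<Rightarrow> ('m, 'c) tensor" where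
  "\<eta> X Y f = sweedler (transport (Hom D X Y) :: ('k, 'u) module) C (tensor K (Hom D X Y) C)
     (decode (tensor K (transport (Hom D X Y)) C) (\<omega> (representable Y) X (encode (Hom D X Y) f)))
     (\<lambda>h c. pure K (Hom D X Y) C (decode (Hom D X Y) h) c)"

lemma \<theta>_linear: "X \<in> Ob D \<Longrightarrow> \<theta> X \<in> linear_maps K (tensor K C C) (Hom D X X)"
  unfolding \<theta>_def[abs_def] by simp

lemma \<eta>_linear: "\<lbrakk>X \<in> Ob D; Y \<in> Ob D\<rbrakk> \<Longrightarrow> \<eta> X Y \<in> linear_maps K (Hom D X Y) (tensor K (Hom D X Y) C)"
  unfolding \<eta>_def[abs_def] by simp

lemmas [simp] = linear_map_rules[OF \<theta>_linear, simplified] \<theta>_linear linear_map_rules[OF \<eta>_linear, simplified] \<eta>_linear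

lemma \<theta>_pure:
  "\<lbrakk>X \<in> Ob D; c \<in> carrier C; d \<in> carrier C\<rbrakk> \<Longrightarrow> \<theta> X (pure K C C c d) =
    decode (Hom D X X) (counit_map (representable X) X
     (\<upsilon> (cofree (representable X)) X (pure2 (transport (Hom D X X)) (encode (Hom D X X) (Ident D X)) c d)))"
  unfolding \<theta>_def by simp

text \<open>
  Naturality of \<open>\<omega>\<close> along the Yoneda morphism \<open>h\<^sub>X \<rightarrow> N\<close> of \<open>n\<close>.
\<close>

lemma \<omega>_value:
  assumes N [simp]: "right_module K D N" and [simp]: "X \<in> Ob D" "n \<in> carrier (at_ob N X)"
  shows "\<omega> N X n = encode (at_tensor N X)
    (sweedler (Hom D X X) C (at_tensor N X) (\<eta> X X (Ident D X)) (\<lambda>e c. pure K (at_ob N X) C (act N X X e n) c))"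
proof -
  have "\<omega> N X (yoneda_map N X n X (encode (Hom D X X) (Ident D X))) =
    cofree_map (representable X) N (yoneda_map N X n) X (\<omega> (representable X) X (encode (Hom D X X) (Ident D X)))"
    by (rule \<omega>_natural) (simp_all add: yoneda_map_morphism)
  then show ?thesis
    by (simp add: yoneda_map_def cofree_map_def \<eta>_def right_module.act_Ident[OF N])
qed

lemma counit_map_cofree_map:
  assumes N [simp]: "right_module K D N" "right_module K D N'" and \<alpha>: "\<alpha> \<in> module_morphisms K D N N'"
    and [simp]: "X \<in> Ob D" "t \<in> carrier (transport (at_tensor N X))"
  shows "counit_map N' X (cofree_map N N' \<alpha> X t) = \<alpha> X (counit_map N X t)"
proof -
  note [simp] = linear_map_rules[OF module_morphismsD(1)[OF \<alpha>], simplified N module_at_ob] module_morphismsD(1)[OF \<alpha>]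
  show ?thesis by (simp add: counit_map_def cofree_map_def linear_maps_smult[OF module_morphismsD(1)[OF \<alpha>]])
qed

text \<open>
  Naturality of \<open>\<upsilon>\<close> along \<open>\<G>(y)\<close>, where \<open>y : h\<^sub>X \<rightarrow> N\<close> is the Yoneda morphism of \<open>n\<close>, and of \<open>id \<otimes> \<epsilon>\<close> along \<open>y\<close>.
\<close>

lemma counit_map_\<upsilon>:
  assumes N [simp]: "right_module K D N" and [simp]: "X \<in> Ob D" "n \<in> carrier (at_ob N X)" "c \<in> carrier C" "d \<in> carrier C"
  shows "counit_map N X (\<upsilon> (cofree N) X (pure2 (at_ob N X) n c d)) = act N X X (\<theta> X (pure K C C c d)) n"
proof -
  let ?y = "yoneda_map N X n" and ?H = "representable X" and ?id = "encode (Hom D X X) (Ident D X) :: 'u"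
  let ?s = "\<upsilon> (cofree ?H) X (pure2 (transport (Hom D X X)) ?id c d)"
  have y: "?y \<in> module_morphisms K D ?H N" by (rule yoneda_map_morphism) simp_all
  have y_id: "?y X ?id = n" by (simp add: yoneda_map_def right_module.act_Ident[OF N])
  have "pure2 (at_ob N X) n c d = cofree_map (forget (cofree ?H)) (forget (cofree N)) (cofree_map ?H N ?y) X (pure2 (transport (Hom D X X)) ?id c d)"
    by (simp add: cofree_map_def yoneda_map_def right_module.act_Ident[OF N])
  then have "\<upsilon> (cofree N) X (pure2 (at_ob N X) n c d) = cofree_map ?H N ?y X ?s"
    by (simp only:, intro \<upsilon>_natural) (simp_all add: cofree_map_entwined y)
  then have "counit_map N X (\<upsilon> (cofree N) X (pure2 (at_ob N X) n c d)) = ?y X (counit_map ?H X ?s)"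
    by (simp add: counit_map_cofree_map y)
  also have "\<dots> = act N X X (\<theta> X (pure K C C c d)) n" by (simp add: yoneda_map_def \<theta>_pure)
  finally show ?thesis .
qed

text \<open>
  The coaction is a morphism \<open>M \<rightarrow> \<G>\<F>M\<close> of entwined modules with left inverse \<open>id \<otimes> \<epsilon>\<close>; naturality of \<open>\<upsilon>\<close> along it reduces
  \<open>\<upsilon>\<close> at \<open>M\<close> to \<open>\<upsilon>\<close> at the cofree module \<open>\<G>\<F>M\<close>.
\<close>

lemma \<upsilon>_value:
  assumes M [simp]: "entwined_module K D C \<psi> M" and [simp]: "X \<in> Ob D" "m \<in> carrier (at_ob M X)" "d \<in> carrier C"
  shows "\<upsilon> M X (encode (tensor K (at_ob M X) C) (pure K (at_ob M X) C m d)) =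
    coact_sum M X (at_ob M X) m (\<lambda>m0 m1. act M X X (\<theta> X (pure K C C m1 d)) m0)"
proof -
  let ?N = "forget M" and ?V = "at_ob M X"
  let ?t = "encode (tensor K ?V C) (pure K ?V C m d) :: 'u"
  have counit: "counit_map ?N X (coaction_map M X x) = x" if "x \<in> carrier ?V" for x
    using that by (simp add: coaction_map_def counit_map_def coact_counit_sweedler)
  have "\<upsilon> (cofree ?N) X (cofree_map ?N (forget (cofree ?N)) (coaction_map M) X ?t) = coaction_map M X (\<upsilon> M X ?t)"
    by (rule \<upsilon>_natural) (simp_all add: coaction_map_entwined)
  then have "\<upsilon> M X ?t = counit_map ?N X (\<upsilon> (cofree ?N) X (cofree_map ?N (forget (cofree ?N)) (coaction_map M) X ?t))"
    by (simp add: counit)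
  also have "cofree_map ?N (forget (cofree ?N)) (coaction_map M) X ?t =
      coact_sum M X (transport (tensor K (transport (tensor K ?V C) :: ('k, 'u) module) C)) m (\<lambda>m0 m1. pure2 ?V m0 m1 d)"
  proof -
    have "encode (tensor K ?V C) (coact M X m) =
      (coact_sum M X (transport (tensor K ?V C)) m (\<lambda>m0 m1. encode (tensor K ?V C) (pure K ?V C m0 m1)) :: 'u)"
      by (subst encode_sweedler[symmetric]) simp_all
    then show ?thesis by (simp add: cofree_map_def coaction_map_def encode_sweedler)
  qed
  also have "counit_map ?N X (\<upsilon> (cofree ?N) X \<dots>) =
    coact_sum M X ?V m (\<lambda>m0 m1. counit_map ?N X (\<upsilon> (cofree ?N) X (pure2 ?V m0 m1 d)))"
    by (simp add: linear_map_rules[OF \<upsilon>_cofree_linear[of ?N X], simplified] linear_map_rules[OF counit_map_linear[of ?N X], simplified])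
  also have "\<dots> = coact_sum M X ?V m (\<lambda>m0 m1. act M X X (\<theta> X (pure K C C m1 d)) m0)"
    using counit_map_\<upsilon>[of ?N X] by simp
  finally show ?thesis .
qed

text \<open>
  Both conditions are properties of \<open>\<upsilon>\<close> at \<open>\<G>(h\<^sub>X)\<close>, evaluated at \<open>id\<^sub>X \<otimes> c \<otimes> d\<close>.  The first is \<open>D\<close>-linearity followed
  by \<open>id \<otimes> \<epsilon>\<close>.  For the second, applying \<open>id \<otimes> \<epsilon> \<otimes> id\<close> to the coaction of the value \<open>s\<close> gives the left-hand side
  by colinearity, and gives back \<open>s\<close> by the counit axiom of \<open>C\<close>; \<open>\<upsilon>_value\<close> turns \<open>s\<close> into the right-hand side.
\<close>

lemma \<theta>_V1: "\<theta> \<in> V1 K D C \<psi>"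
  unfolding V1_iff
proof (intro conjI ballI)
  show "\<theta> X \<in> linear_maps K (tensor K C C) (Hom D X X)" if "X \<in> Ob D" for X
    using that by (rule \<theta>_linear)
next
  fix X Y f c d assume [simp]: "X \<in> Ob D" "Y \<in> Ob D" "f \<in> carrier (Hom D Y X)" "c \<in> carrier C" "d \<in> carrier C"
  let ?H = "representable X" and ?id = "encode (Hom D X X) (Ident D X) :: 'u"
  let ?V = "transport (Hom D X X) :: ('k, 'u) module" and ?W = "transport (Hom D Y X) :: ('k, 'u) module"
  let ?t = "pure2 ?V ?id c d"
  have "encode (Hom D Y X) (Comp D Y X X (\<theta> X (pure K C C c d)) f) = act ?H Y X f (counit_map ?H X (\<upsilon> (cofree ?H) X ?t))"
    by (simp add: \<theta>_pure)
  also have "\<dots> = counit_map ?H Y (act (cofree ?H) Y X f (\<upsilon> (cofree ?H) X ?t))"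
    by (rule module_morphismsD(2)[OF counit_map_morphism, symmetric]) simp_all
  also have "act (cofree ?H) Y X f (\<upsilon> (cofree ?H) X ?t) = \<upsilon> (cofree ?H) Y (act (cofree (forget (cofree ?H))) Y X f ?t)"
    by (rule module_morphismsD(2)[OF \<upsilon>_module_morphism, symmetric]) simp_all
  also have "act (cofree (forget (cofree ?H))) Y X f ?t =
     entwine_sum Y X (transport (tensor K (transport (tensor K ?W C) :: ('k, 'u) module) C)) d f (\<lambda>f' d'.
       entwine_sum Y X (transport (tensor K (transport (tensor K ?W C) :: ('k, 'u) module) C)) c f' (\<lambda>f'' c'.
         pure2 ?W (encode (Hom D Y X) f'') c' d'))"
    by (simp add: act_cofree encode_sweedler)
  also have "counit_map ?H Y (\<upsilon> (cofree ?H) Y \<dots>) =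
     entwine_sum Y X ?W d f (\<lambda>f' d'.
       entwine_sum Y X ?W c f' (\<lambda>f'' c'.
         counit_map ?H Y (\<upsilon> (cofree ?H) Y (pure2 ?W (encode (Hom D Y X) f'') c' d'))))"
    by simp
  also have "\<dots> = entwine_sum Y X ?W d f (\<lambda>f' d'.
       entwine_sum Y X ?W c f' (\<lambda>f'' c'.
         encode (Hom D Y X) (Comp D Y Y X f'' (\<theta> Y (pure K C C c' d')))))"
    using counit_map_\<upsilon>[of ?H Y] by simp
  finally have "decode (Hom D Y X) (encode (Hom D Y X) (Comp D Y X X (\<theta> X (pure K C C c d)) f) :: 'u) = decode (Hom D Y X) \<dots>"
    by (rule arg_cong)
  then show "Comp D Y X X (\<theta> X (pure K C C c d)) f =
      entwine_sum Y X (Hom D Y X) d f (\<lambda>f' d'.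
        entwine_sum Y X (Hom D Y X) c f' (\<lambda>f'' c'.
          Comp D Y Y X f'' (\<theta> Y (pure K C C c' d'))))"
    by simp
next
  fix X c d assume [simp]: "X \<in> Ob D" "c \<in> carrier C" "d \<in> carrier C"
  let ?H = "representable X" and ?id = "encode (Hom D X X) (Ident D X) :: 'u"
  let ?V = "transport (Hom D X X) :: ('k, 'u) module" and ?T = "tensor K (Hom D X X) C"
  let ?U = "transport (tensor K ?V C) :: ('k, 'u) module"
  let ?s = "\<upsilon> (cofree ?H) X (pure2 ?V ?id c d)"
  \<comment> \<open>the map \<open>id \<otimes> \<epsilon> \<otimes> id\<close>\<close>
  let ?h = "\<lambda>u. sweedler ?U C ?T u (\<lambda>t c. pure K (Hom D X X) C (decode (Hom D X X) (counit_map ?H X t)) c)"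
  note [simp] = act_cofree coact_cofree
  have "coact (cofree ?H) X ?s = comult_sum (tensor K ?U C) d (\<lambda>d1 d2. pure K ?U C (\<upsilon> (cofree ?H) X (pure2 ?V ?id c d1)) d2)"
    using entwined_morphismsD(2)[OF _ _ \<upsilon>_morphism[of "cofree ?H"], of X "pure2 ?V ?id c d"] by simp
  then have "?h (coact (cofree ?H) X ?s) = ?h (comult_sum (tensor K ?U C) d (\<lambda>d1 d2. pure K ?U C (\<upsilon> (cofree ?H) X (pure2 ?V ?id c d1)) d2))"
    by (simp only:)
  also have "\<dots> = comult_sum ?T d (\<lambda>d1 d2. pure K (Hom D X X) C (\<theta> X (pure K C C c d1)) d2)"
    by (simp add: \<theta>_pure)
  finally have right: "?h (coact (cofree ?H) X ?s) = \<dots>" .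
  have left: "?h (coact (cofree ?H) X ?s) = sweedler ?V C ?T (decode (tensor K ?V C) ?s) (\<lambda>n c. pure K (Hom D X X) C (decode (Hom D X X) n) c)"
  proof -
    have counit: "counit_map ?H X (encode (tensor K ?V C) (pure K ?V C n a)) = counit C a \<odot>\<^bsub>?V\<^esub> n"
      if "n \<in> carrier ?V" "a \<in> carrier C" for n a
      using that by (simp add: counit_map_def)
    have smult: "pure K (Hom D X X) C (decode (Hom D X X) (counit C a \<odot>\<^bsub>?V\<^esub> n)) b = counit C a \<odot>\<^bsub>?T\<^esub> pure K (Hom D X X) C (decode (Hom D X X) n) b"
      if "n \<in> carrier ?V" "a \<in> carrier C" "b \<in> carrier C" for n a b
      using that by (simp add: decode_smult pure_smult_left)
    show ?thesis by (simp add: counit smult counit_left_sweedler)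
  qed
  have s: "?s = sweedler ?U C ?U (coact (cofree ?H) X (encode (tensor K ?V C) (pure K ?V C ?id c)))
       (\<lambda>m0 m1. act (cofree ?H) X X (\<theta> X (pure K C C m1 d)) m0)"
    by (rule \<upsilon>_value[of "cofree ?H" X "encode (tensor K ?V C) (pure K ?V C ?id c)" d, unfolded at_ob_cofree at_ob_representable]) simp_all
  have "sweedler ?V C ?T (decode (tensor K ?V C) ?s) (\<lambda>n c. pure K (Hom D X X) C (decode (Hom D X X) n) c) =
    comult_sum ?T c (\<lambda>c1 c2. entwine X X c1 (\<theta> X (pure K C C c2 d)))"
    by (subst s) simp
  then show "comult_sum ?T d (\<lambda>d1 d2. pure K (Hom D X X) C (\<theta> X (pure K C C c d1)) d2) =
      comult_sum ?T c (\<lambda>c1 c2. entwine X X c1 (\<theta> X (pure K C C c2 d)))"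
    using right left by (simp only:)
qed

text \<open>
  Covariance is naturality of \<open>\<omega>\<close> along the morphism of representable modules that \<open>g\<close> induces;
  contravariance is \<open>D\<close>-linearity of \<open>\<omega>\<close> at a representable module.
\<close>

lemma \<eta>_W1: "\<eta> \<in> W1 K D C \<psi>"
proof (rule W1I)
  show "\<eta> X Y \<in> linear_maps K (Hom D X Y) (tensor K (Hom D X Y) C)" if "X \<in> Ob D" "Y \<in> Ob D" for X Y
    using that by (rule \<eta>_linear)
next
  fix X Y Z f g assume [simp]: "X \<in> Ob D" "Y \<in> Ob D" "Z \<in> Ob D" "f \<in> carrier (Hom D X Y)" "g \<in> carrier (Hom D Y Z)"
  let ?y = "yoneda_map (representable Z) Y (encode (Hom D Y Z) g)"
  have y: "?y \<in> module_morphisms K D (representable Y) (representable Z)" by (rule yoneda_map_morphism) simp_all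
  have "\<omega> (representable Z) X (?y X (encode (Hom D X Y) f)) =
    cofree_map (representable Y) (representable Z) ?y X (\<omega> (representable Y) X (encode (Hom D X Y) f))"
    by (rule \<omega>_natural) (simp_all add: y)
  then have "\<omega> (representable Z) X (encode (Hom D X Z) (Comp D X Y Z g f)) =
    cofree_map (representable Y) (representable Z) ?y X (\<omega> (representable Y) X (encode (Hom D X Y) f))"
    by (simp add: yoneda_map_def)
  then show "\<eta> X Z (Comp D X Y Z g f) = sweedler (Hom D X Y) C (tensor K (Hom D X Z) C) (\<eta> X Y f) (\<lambda>f' c.
        pure K (Hom D X Z) C (Comp D X Y Z g f') c)"
    by (simp add: \<eta>_def cofree_map_def yoneda_map_def)
next
  fix X X' Y f g assume [simp]: "X \<in> Ob D" "X' \<in> Ob D" "Y \<in> Ob D" "f \<in> carrier (Hom D X Y)" "g \<in> carrier (Hom D X' X)"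
  have "\<omega> (representable Y) X' (act (representable Y) X' X g (encode (Hom D X Y) f)) =
    act (cofree (representable Y)) X' X g (\<omega> (representable Y) X (encode (Hom D X Y) f))"
    by (rule module_morphismsD(2)[OF \<omega>_morphism]) simp_all
  then show "\<eta> X' Y (Comp D X' X Y f g) = sweedler (Hom D X Y) C (tensor K (Hom D X' Y) C) (\<eta> X Y f) (\<lambda>f' c.
        entwine_sum X' X (tensor K (Hom D X' Y) C) c g (\<lambda>p c'.
          pure K (Hom D X' Y) C (Comp D X' X Y f' p) c'))"
    by (simp add: \<eta>_def act_cofree)
qed

text \<open>
  The triangle identity for \<open>\<G>(h\<^sub>Y)\<close> at \<open>f \<otimes> d\<close>, followed by \<open>id \<otimes> \<epsilon>\<close>.
\<close>

lemma \<eta>_\<theta>: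
  assumes [simp]: "X \<in> Ob D" "Y \<in> Ob D" "f \<in> carrier (Hom D X Y)" "d \<in> carrier C"
  shows "sweedler (Hom D X Y) C (Hom D X Y) (\<eta> X Y f) (\<lambda>f' c. Comp D X X Y f' (\<theta> X (pure K C C c d))) =
    counit C d \<odot>\<^bsub>Hom D X Y\<^esub> f"
proof -
  let ?H = "representable Y" and ?V = "transport (Hom D X Y) :: ('k, 'u) module"
  let ?f = "encode (Hom D X Y) f :: 'u"
  let ?t = "encode (tensor K ?V C) (pure K ?V C ?f d) :: 'u"
  let ?w = "decode (tensor K ?V C) (\<omega> ?H X ?f)"
  have "\<upsilon> (cofree ?H) X (cofree_map ?H (forget (cofree ?H)) (\<omega> ?H) X ?t) = ?t"
    by (rule triangle_cofree) simp_all
  moreover have "cofree_map ?H (forget (cofree ?H)) (\<omega> ?H) X ?t =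
    sweedler ?V C (transport (tensor K (transport (tensor K ?V C) :: ('k, 'u) module) C)) ?w (\<lambda>h c. pure2 ?V h c d)"
  proof -
    have "\<omega> ?H X ?f = encode (tensor K ?V C) (sweedler ?V C (tensor K ?V C) ?w (pure K ?V C))" by simp
    also have "\<dots> = sweedler ?V C (transport (tensor K ?V C)) ?w (\<lambda>h c. encode (tensor K ?V C) (pure K ?V C h c))"
      by (rule encode_sweedler) simp_all
    finally have w: "\<omega> ?H X ?f = \<dots>" .
    have "cofree_map ?H (forget (cofree ?H)) (\<omega> ?H) X ?t = encode (tensor K (transport (tensor K ?V C) :: ('k, 'u) module) C)
        (pure K (transport (tensor K ?V C)) C (\<omega> ?H X ?f) d)"
      by (simp add: cofree_map_def)
    also have "\<dots> = encode (tensor K (transport (tensor K ?V C) :: ('k, 'u) module) C)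
        (pure K (transport (tensor K ?V C)) C (sweedler ?V C (transport (tensor K ?V C)) ?w (\<lambda>h c. encode (tensor K ?V C) (pure K ?V C h c))) d)"
      using w by (rule arg_cong)
    also have "\<dots> = sweedler ?V C (transport (tensor K (transport (tensor K ?V C) :: ('k, 'u) module) C)) ?w (\<lambda>h c. pure2 ?V h c d)"
      by (simp add: encode_sweedler)
    finally show ?thesis .
  qed
  ultimately have "counit_map ?H X (\<upsilon> (cofree ?H) X (sweedler ?V C (transport (tensor K (transport (tensor K ?V C) :: ('k, 'u) module) C)) ?w (\<lambda>h c. pure2 ?V h c d))) =
     counit_map ?H X ?t" by simp
  then have "sweedler ?V C ?V ?w (\<lambda>h c. counit_map ?H X (\<upsilon> (cofree ?H) X (pure2 ?V h c d))) = counit C d \<odot>\<^bsub>?V\<^esub> ?f"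
    by (simp add: counit_map_def[of ?H])
  then have "sweedler ?V C ?V ?w (\<lambda>h c. encode (Hom D X Y) (Comp D X X Y (decode (Hom D X Y) h) (\<theta> X (pure K C C c d)))) = counit C d \<odot>\<^bsub>?V\<^esub> ?f"
    using counit_map_\<upsilon>[of ?H X] by simp
  then have "decode (Hom D X Y) (sweedler ?V C ?V ?w (\<lambda>h c. encode (Hom D X Y) (Comp D X X Y (decode (Hom D X Y) h) (\<theta> X (pure K C C c d))))) =
     decode (Hom D X Y) (counit C d \<odot>\<^bsub>?V\<^esub> ?f)" by (rule arg_cong)
  then show ?thesis
    by (simp add: \<eta>_def decode_smult)
qed

text \<open>
  The other triangle identity, for the entwined module \<open>\<G>(h\<^sub>X)\<close> at \<open>id\<^sub>X \<otimes> d\<close>, followed by \<open>id \<otimes> \<epsilon>\<close>.  Here \<open>\<omega>\<close> is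
  taken at \<open>\<F>\<G>(h\<^sub>X)\<close>, where \<open>\<omega>_value\<close> makes \<open>e\<close> act on \<open>id\<^sub>X \<otimes> d\<close> and so brings in \<open>\<psi>\<close>.
\<close>

lemma \<eta>_\<psi>_\<theta>_Ident:
  assumes [simp]: "X \<in> Ob D" "d \<in> carrier C"
  shows "sweedler (Hom D X X) C (Hom D X X) (\<eta> X X (Ident D X)) (\<lambda>e c.
      entwine_sum X X (Hom D X X) d e (\<lambda>e' d'.
        Comp D X X X e' (\<theta> X (pure K C C d' c)))) =
    counit C d \<odot>\<^bsub>Hom D X X\<^esub> Ident D X"
proof -
  let ?H = "representable X" and ?V = "transport (Hom D X X) :: ('k, 'u) module"
  let ?id = "encode (Hom D X X) (Ident D X) :: 'u" and ?t = "\<eta> X X (Ident D X)"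
  let ?M = "cofree ?H" and ?m = "encode (tensor K ?V C) (pure K ?V C ?id d) :: 'u"
  let ?T = "transport (tensor K (transport (tensor K ?V C) :: ('k, 'u) module) C) :: ('k, 'u) module"
  have "\<upsilon> ?M X (\<omega> (forget ?M) X ?m) = ?m" by (rule triangle_forget) simp_all
  moreover have "\<omega> (forget ?M) X ?m = sweedler (Hom D X X) C ?T ?t (\<lambda>e c.
      entwine_sum X X ?T d e (\<lambda>e' d'. pure2 ?V (encode (Hom D X X) e') d' c))"
    by (subst \<omega>_value) (simp_all add: act_cofree encode_sweedler)
  ultimately have "counit_map ?H X (\<upsilon> ?M X (sweedler (Hom D X X) C ?T ?t (\<lambda>e c.
      entwine_sum X X ?T d e (\<lambda>e' d'. pure2 ?V (encode (Hom D X X) e') d' c)))) = counit_map ?H X ?m"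
    by simp
  then have "sweedler (Hom D X X) C ?V ?t (\<lambda>e c. entwine_sum X X ?V d e (\<lambda>e' d'.
      counit_map ?H X (\<upsilon> ?M X (pure2 ?V (encode (Hom D X X) e') d' c)))) = counit C d \<odot>\<^bsub>?V\<^esub> ?id"
    by (simp add: counit_map_def[of ?H])
  then have "sweedler (Hom D X X) C ?V ?t (\<lambda>e c. entwine_sum X X ?V d e (\<lambda>e' d'.
      encode (Hom D X X) (Comp D X X X e' (\<theta> X (pure K C C d' c))))) = counit C d \<odot>\<^bsub>?V\<^esub> ?id"
    using counit_map_\<upsilon>[of ?H X] by simp
  then have "decode (Hom D X X) (sweedler (Hom D X X) C ?V ?t (\<lambda>e c. entwine_sum X X ?V d e (\<lambda>e' d'.
      encode (Hom D X X) (Comp D X X X e' (\<theta> X (pure K C C d' c)))))) = decode (Hom D X X) (counit C d \<odot>\<^bsub>?V\<^esub> ?id)"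
    by (rule arg_cong)
  then show ?thesis
    by (simp add: decode_smult)
qed

text \<open>
  By naturality \<open>\<eta>(X, Y)(f) = \<Sum> f e \<otimes> c\<close>, and multiplicativity of \<open>\<psi>\<close> separates \<open>f\<close> from \<open>e\<close>.  The case of \<open>id\<^sub>X\<close> leaves
  \<open>\<epsilon>(d\<^sup>\<psi>) f\<^sub>\<psi> = \<epsilon>(d) f\<close>.
\<close>

lemma \<eta>_\<psi>_\<theta>:
  assumes [simp]: "X \<in> Ob D" "Y \<in> Ob D" "f \<in> carrier (Hom D X Y)" "d \<in> carrier C"
  shows "sweedler (Hom D X Y) C (Hom D X Y) (\<eta> X Y f) (\<lambda>f' c.
      entwine_sum X Y (Hom D X Y) d f' (\<lambda>f'' d'.
        Comp D X X Y f'' (\<theta> X (pure K C C d' c)))) =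
    counit C d \<odot>\<^bsub>Hom D X Y\<^esub> f"
proof -
  let ?V = "Hom D X Y" and ?W = "Hom D X X" and ?t = "\<eta> X X (Ident D X)"
  have "sweedler ?V C ?V (\<eta> X Y f) (\<lambda>f' c. sweedler ?V C ?V (\<psi> X Y (pure K C ?V d f')) (\<lambda>f'' d'. Comp D X X Y f'' (\<theta> X (pure K C C d' c)))) =
    sweedler ?W C ?V ?t (\<lambda>e c. sweedler ?V C ?V (\<psi> X Y (pure K C ?V d f)) (\<lambda>f' d'.
      sweedler ?W C ?V (\<psi> X X (pure K C ?W d' e)) (\<lambda>e' d''. Comp D X X Y f' (Comp D X X X e' (\<theta> X (pure K C C d'' c))))))"
    by (subst W1D(2)[OF \<eta>_W1]) (simp_all add: \<psi>_Comp_sweedler Comp_assoc_Hom)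
  also have "\<dots> = sweedler ?V C ?V (\<psi> X Y (pure K C ?V d f)) (\<lambda>f' d'. sweedler ?W C ?V ?t (\<lambda>e c.
      sweedler ?W C ?V (\<psi> X X (pure K C ?W d' e)) (\<lambda>e' d''. Comp D X X Y f' (Comp D X X X e' (\<theta> X (pure K C C d'' c))))))"
    by (rule sweedler_swap) simp_all
  also have "\<dots> = sweedler ?V C ?V (\<psi> X Y (pure K C ?V d f)) (\<lambda>f' d'. Comp D X X Y f' (sweedler ?W C ?W ?t (\<lambda>e c.
      sweedler ?W C ?W (\<psi> X X (pure K C ?W d' e)) (\<lambda>e' d''. Comp D X X X e' (\<theta> X (pure K C C d'' c))))))"
    by simp
  also have "\<dots> = sweedler ?V C ?V (\<psi> X Y (pure K C ?V d f)) (\<lambda>f' d'. counit C d' \<odot>\<^bsub>?V\<^esub> f')"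
  proof -
    have "Comp D X X Y f' (counit C d' \<odot>\<^bsub>?W\<^esub> Ident D X) = counit C d' \<odot>\<^bsub>?V\<^esub> f'"
      if "f' \<in> carrier ?V" "d' \<in> carrier C" for f' d'
      using linear_maps_smult[OF Comp_linear_right, of X X Y f' "counit C d'" "Ident D X"] that by simp
    then show ?thesis by (simp only: \<eta>_\<psi>_\<theta>_Ident \<open>X \<in> Ob D\<close> cong: sweedler_cong)
  qed
  also have "\<dots> = counit C d \<odot>\<^bsub>?V\<^esub> f" by (rule \<psi>_counit_sweedler) simp_all
  finally show ?thesis .
qed

end

section \<open>The theorem\<close>

lemma (in entwined_universe) tsum_conditions:
  assumes \<theta>: "\<theta> \<in> V1 K D C \<psi>" and \<eta>: "\<eta> \<in> W1 K D C \<psi>"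
    and [simp]: "X \<in> Ob D" "Y \<in> Ob D" "f \<in> carrier (Hom D X Y)" "d \<in> carrier C"
  shows "tsum (Hom D X Y) (\<eta> X Y f) (\<lambda>f' c. Comp D X X Y f' (\<theta> X (pure K C C c d))) =
      sweedler (Hom D X Y) C (Hom D X Y) (\<eta> X Y f) (\<lambda>f' c. Comp D X X Y f' (\<theta> X (pure K C C c d)))"
    and "tsum (Hom D X Y) (\<eta> X Y f) (\<lambda>f' c.
        tsum (Hom D X Y) (entwine X Y d f') (\<lambda>f'' d'. Comp D X X Y f'' (\<theta> X (pure K C C d' c)))) =
      sweedler (Hom D X Y) C (Hom D X Y) (\<eta> X Y f) (\<lambda>f' c.
        entwine_sum X Y (Hom D X Y) d f' (\<lambda>f'' d'. Comp D X X Y f'' (\<theta> X (pure K C C d' c))))"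
proof -
  note [simp] = linear_map_rules(1,2)[OF V1D(1)[OF \<theta>], simplified] V1D(1)[OF \<theta>]
    linear_map_rules(1,2)[OF W1D(1)[OF \<eta>], simplified] W1D(1)[OF \<eta>]
  show "tsum (Hom D X Y) (\<eta> X Y f) (\<lambda>f' c. Comp D X X Y f' (\<theta> X (pure K C C c d))) =
      sweedler (Hom D X Y) C (Hom D X Y) (\<eta> X Y f) (\<lambda>f' c. Comp D X X Y f' (\<theta> X (pure K C C c d)))"
    by (intro tsum_eq_sweedler) simp_all
  show "tsum (Hom D X Y) (\<eta> X Y f) (\<lambda>f' c.
        tsum (Hom D X Y) (entwine X Y d f') (\<lambda>f'' d'. Comp D X X Y f'' (\<theta> X (pure K C C d' c)))) =
      sweedler (Hom D X Y) C (Hom D X Y) (\<eta> X Y f) (\<lambda>f' c.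
        entwine_sum X Y (Hom D X Y) d f' (\<lambda>f'' d'. Comp D X X Y f'' (\<theta> X (pure K C C d' c))))"
    by (intro tsum_eq_sweedler) simp_all
qed

lemma (in entwined_universe) cofree_adjunction_of_left_adjoint:
  assumes "left_adjoint module_cat entwined_cat cofree_functor forget_functor"
  obtains \<omega> :: "('k, 'o, 'm, 'u) right_module \<Rightarrow> 'o \<Rightarrow> 'u \<Rightarrow> 'u"
    and \<upsilon> :: "('k, 'o, 'm, 'u, 'c) entwined_module \<Rightarrow> 'o \<Rightarrow> 'u \<Rightarrow> 'u"
    where "cofree_adjunction K D C \<psi> \<omega> \<upsilon>"
proof (rule unit_counit_of_left_adjoint[OF assms], goal_cases)
  case (1 \<omega> \<upsilon>)
  note unit = 1(2) and counit = 1(3) and unit_nat = 1(4) and counit_nat = 1(5) and tri = 1(6,7)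
  have apply_eq: "f X m = g X m" if "f = g" for f g :: "'o \<Rightarrow> 'u \<Rightarrow> 'u" and X m using that by simp
  have "cofree_adjunction K D C \<psi> \<omega> \<upsilon>"
  proof unfold_locales
    show "\<omega> N \<in> module_morphisms K D N (cofree N)" if "right_module K D N" for N
      using unit[of N] that by simp
    show "\<upsilon> M \<in> entwined_morphisms K D C (cofree (forget M)) M" if "entwined_module K D C \<psi> M" for M
      using counit[of M] that by simp
    show "\<omega> N' X (\<alpha> X n) = cofree_map N N' \<alpha> X (\<omega> N X n)"
      if "right_module K D N" "right_module K D N'" "\<alpha> \<in> module_morphisms K D N N'" "X \<in> Ob D" "n \<in> carrier (at_ob N X)"
      for N N' \<alpha> X n
      using apply_eq[OF unit_nat[of N N' \<alpha>], of X n] that by (simp add: tensor_coalgebra_arr compose_morphisms_eq)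
    show "\<upsilon> M' X (cofree_map (forget M) (forget M') \<beta> X t) = \<beta> X (\<upsilon> M X t)"
      if "entwined_module K D C \<psi> M" "entwined_module K D C \<psi> M'" and b: "\<beta> \<in> entwined_morphisms K D C M M'" and "X \<in> Ob D"
        "t \<in> carrier (transport (at_tensor (forget M) X))"
      for M M' \<beta> X t
      using apply_eq[OF counit_nat[of M M' \<beta>], of X t] that entwined_morphism_module_morphism[OF b]
      by (simp add: tensor_coalgebra_arr compose_morphisms_eq)
    show "\<upsilon> (cofree N) X (cofree_map N (forget (cofree N)) (\<omega> N) X t) = t"
      if "right_module K D N" "X \<in> Ob D" "t \<in> carrier (transport (at_tensor N X))" for N X t
      using apply_eq[OF tri(1)[of N], of X t] that unit[of N]
      by (simp add: tensor_coalgebra_arr compose_morphisms_eq identity_morphism_def)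
    show "\<upsilon> M X (\<omega> (forget M) X m) = m"
      if "entwined_module K D C \<psi> M" "X \<in> Ob D" "m \<in> carrier (at_ob M X)" for M X m
      using apply_eq[OF tri(2)[of M], of X m] that by (simp add: compose_morphisms_eq identity_morphism_def)
  qed
  then show thesis by (rule that)
qed

theorem theorem2:
  fixes K :: "'k ring"
    and D :: "('k, 'o, 'm) linear_category"
    and C :: "('k, 'c) coalgebra"
    and \<psi> :: "('o, 'm, 'c) entwining"
  assumes entwining: "entwining_structure K D C \<psi>"
    and universe_infinite: "infinite (UNIV :: 'u set)"
    and universe_coalgebra: "\<exists>i :: 'c \<Rightarrow> 'u. inj_on i (carrier C)"
    and universe_arrows: "\<And>X Y. \<lbrakk>X \<in> Ob D; Y \<in> Ob D\<rbrakk> \<Longrightarrow> \<exists>i :: 'm \<Rightarrow> 'u. inj_on i (Arr D X Y)"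
  shows "frobenius_pair
      (entwined_category K D C \<psi> :: (('k, 'o, 'm, 'u, 'c) entwined_module, 'o \<Rightarrow> 'u \<Rightarrow> 'u) category)
      (module_category K D)
      forgetful
      (tensor_coalgebra K D C \<psi>) \<longleftrightarrow>
    (\<exists>\<theta> \<in> V1 K D C \<psi>. \<exists>\<eta> \<in> W1 K D C \<psi>.
      \<forall>X\<in>Ob D. \<forall>Y\<in>Ob D. \<forall>f\<in>Arr D X Y. \<forall>d\<in>carrier C.
        counit C d \<odot>\<^bsub>Hom D X Y\<^esub> f =
          tsum (Hom D X Y) (\<eta> X Y f) (\<lambda>f' c. Comp D X X Y f' (\<theta> X (pure K C C c d))) \<and>
        counit C d \<odot>\<^bsub>Hom D X Y\<^esub> f =
          tsum (Hom D X Y) (\<eta> X Y f) (\<lambda>f' c.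
            tsum (Hom D X Y) (\<psi> X Y (pure K C (Hom D X Y) d f')) (\<lambda>f'' d'.
              Comp D X X Y f'' (\<theta> X (pure K C C d' c)))))"
    (is "?frobenius \<longleftrightarrow> ?data")
proof -
  interpret entwining_structure K D C \<psi> by (rule entwining)
  interpret entwined_universe K D C \<psi> "TYPE('u)"
    using universe_infinite universe_coalgebra universe_arrows
    by unfold_locales (auto simp: lepoll_def)
  show ?thesis
  proof
    assume ?frobenius
    then obtain \<omega> :: "('k, 'o, 'm, 'u) right_module \<Rightarrow> 'o \<Rightarrow> 'u \<Rightarrow> 'u"
      and \<upsilon> :: "('k, 'o, 'm, 'u, 'c) entwined_module \<Rightarrow> 'o \<Rightarrow> 'u \<Rightarrow> 'u"
      where "cofree_adjunction K D C \<psi> \<omega> \<upsilon>"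
      unfolding frobenius_pair_def using cofree_adjunction_of_left_adjoint by blast
    then interpret cofree_adjunction K D C \<psi> "TYPE('u)" \<omega> \<upsilon> .
    show ?data
      by (intro bexI[OF _ \<theta>_V1] bexI[OF _ \<eta>_W1]) (simp add: tsum_conditions \<theta>_V1 \<eta>_W1 \<eta>_\<theta> \<eta>_\<psi>_\<theta>)
  next
    assume ?data
    then obtain \<theta> \<eta> where V1: "\<theta> \<in> V1 K D C \<psi>" and W1: "\<eta> \<in> W1 K D C \<psi>"
      and eq: "\<forall>X\<in>Ob D. \<forall>Y\<in>Ob D. \<forall>f\<in>Arr D X Y. \<forall>d\<in>carrier C.
        counit C d \<odot>\<^bsub>Hom D X Y\<^esub> f =
          tsum (Hom D X Y) (\<eta> X Y f) (\<lambda>f' c. Comp D X X Y f' (\<theta> X (pure K C C c d))) \<and>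
        counit C d \<odot>\<^bsub>Hom D X Y\<^esub> f =
          tsum (Hom D X Y) (\<eta> X Y f) (\<lambda>f' c.
            tsum (Hom D X Y) (\<psi> X Y (pure K C (Hom D X Y) d f')) (\<lambda>f'' d'.
              Comp D X X Y f'' (\<theta> X (pure K C C d' c))))"
      by (elim bexE) (rule that)
    have "frobenius_data TYPE('u) K D C \<psi> \<theta> \<eta>"
    proof unfold_locales
      fix X d assume X: "X \<in> Ob D" and d: "d \<in> carrier C"
      note eqs = eq[rule_format, OF X X Ident_Arr[OF X] d]
      show "sweedler (Hom D X X) C (Hom D X X) (\<eta> X X (Ident D X)) (\<lambda>e c. Comp D X X X e (\<theta> X (pure K C C c d))) =
          counit C d \<odot>\<^bsub>Hom D X X\<^esub> Ident D X"
        using eqs[THEN conjunct1] tsum_conditions(1)[OF V1 W1 X X Ident_closed[OF X] d] by (simp only:)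
      show "sweedler (Hom D X X) C (Hom D X X) (\<eta> X X (Ident D X)) (\<lambda>e c.
          entwine_sum X X (Hom D X X) d e (\<lambda>e' d'.
            Comp D X X X e' (\<theta> X (pure K C C d' c)))) = counit C d \<odot>\<^bsub>Hom D X X\<^esub> Ident D X"
        using eqs[THEN conjunct2] tsum_conditions(2)[OF V1 W1 X X Ident_closed[OF X] d] by (simp only:)
    qed (fact V1, fact W1)
    then interpret frobenius_data K D C \<psi> "TYPE('u)" \<theta> \<eta> .
    show ?frobenius
      unfolding frobenius_pair_def using forgetful_left_adjoint cofree_left_adjoint by blast
  qed
qed

end
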